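(* Let $n\geq 6$ and $p\geq 2$. Among all bicyclic graphs of order $n$, $B_1$, $B_2$ and $B_3$ are, respectively, the unique bicyclic graphs with the first three maximum $p$-Sombor spectral radii; that is, for every bicyclic graph $G$ of order $n$ not isomorphic to $B_1,B_2,B_3$, $$\rho(\mathbf{S}_{p}(G))<\rho(\mathbf{S}_{p}(B_3))<\rho(\mathbf{S}_{p}(B_2))<\rho(\mathbf{S}_{p}(B_1)).$$
   Context: All graphs are simple and connected; $d_i$ is the degree of $v_i$. The $p$-Sombor matrix $\mathbf{S}_{p}(G)$ has $(i,j)$-entry $(d_i^{p}+d_j^{p})^{1/p}$ if $v_iv_j\in E(G)$ and $0$ otherwise; $\rho(\mathbf{S}_{p}(G))$ is its largest eigenvalue. A bicyclic graph is a connected graph with $|E|=|V|+1$. The diamond is $K_4$ minus an edge, with adjacent degree-3 vertices $u,v$. The graphs (all of order $n$): $B_1$ is the diamond with $n-4$ pendant vertices attached to $u$; $B_2$ consists of two triangles sharing exactly one vertex $c$, with $n-5$ pendant vertices attached to $c$; $B_3$ is the diamond with $n-5$ pendant vertices attached to $u$ and one pendant vertex attached to $v$. *)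

theory Defs
  imports Complex_Main "Jordan_Normal_Form.Char_Poly"
begin

(* A simple graph of order n is represented with vertex set {0..<n}
   and an edge set E of 2-element subsets of {0..<n}. *)

definition simple_graph :: "nat \<Rightarrow> nat set set \<Rightarrow> bool" where
  "simple_graph n E \<longleftrightarrow> E \<subseteq> {{u, v} | u v. u < n \<and> v < n \<and> u \<noteq> v}"

definition adj :: "nat set set \<Rightarrow> nat \<Rightarrow> nat \<Rightarrow> bool" where
  "adj E u v \<longleftrightarrow> u \<noteq> v \<and> {u, v} \<in> E"

definition connected_graph :: "nat \<Rightarrow> nat set set \<Rightarrow> bool" where
  "connected_graph n E \<longleftrightarrow>
     (\<forall>u<n. \<forall>v<n. (u, v) \<in> {(x, y). adj E x y}\<^sup>*)"

definition bicyclic :: "nat \<Rightarrow> nat set set \<Rightarrow> bool" where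
  "bicyclic n E \<longleftrightarrow> simple_graph n E \<and> connected_graph n E \<and> card E = n + 1"

definition deg :: "nat \<Rightarrow> nat set set \<Rightarrow> nat \<Rightarrow> nat" where
  "deg n E u = card {v. v < n \<and> adj E u v}"

(* p-Sombor matrix *)
definition sombor_matrix :: "real \<Rightarrow> nat \<Rightarrow> nat set set \<Rightarrow> real mat" where
  "sombor_matrix p n E = mat n n (\<lambda>(i, j).
      if adj E i j then (real (deg n E i) powr p + real (deg n E j) powr p) powr (1 / p) else 0)"

(* largest (real) eigenvalue *)
definition largest_eigenvalue :: "real mat \<Rightarrow> real" where
  "largest_eigenvalue A = Max {x. eigenvalue A x}"

definition graph_iso :: "nat \<Rightarrow> nat set set \<Rightarrow> nat set set \<Rightarrow> bool" where
  "graph_iso n E1 E2 \<longleftrightarrow> (\<exists>f. bij_betw f {0..<n} {0..<n} \<and>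
      (\<forall>u<n. \<forall>v<n. adj E1 u v \<longleftrightarrow> adj E2 (f u) (f v)))"

(* diamond on vertices 0,1,2,3 with u = 0, v = 1 the adjacent degree-3 vertices *)
definition diamond :: "nat set set" where
  "diamond = {{0, 1}, {0, 2}, {0, 3}, {1, 2}, {1, 3}}"

definition B1 :: "nat \<Rightarrow> nat set set" where
  "B1 n = diamond \<union> {{0, k} | k. 4 \<le> k \<and> k < n}"

(* two triangles 0-1-2 and 0-3-4 sharing c = 0 *)
definition B2 :: "nat \<Rightarrow> nat set set" where
  "B2 n = {{0, 1}, {0, 2}, {1, 2}, {0, 3}, {0, 4}, {3, 4}} \<union> {{0, k} | k. 5 \<le> k \<and> k < n}"

definition B3 :: "nat \<Rightarrow> nat set set" where
  "B3 n = diamond \<union> {{1, 4}} \<union> {{0, k} | k. 5 \<le> k \<and> k < n}"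

abbreviation rhoS :: "real \<Rightarrow> nat \<Rightarrow> nat set set \<Rightarrow> real" where
  "rhoS p n E \<equiv> largest_eigenvalue (sombor_matrix p n E)"

end

theory Submission
  imports Defs "HOL-Analysis.Function_Topology" "HOL-Analysis.Convex"
    "Jordan_Normal_Form.Spectral_Radius" "HOL-Combinatorics.Transposition"
begin

text \<open>
  The spectral radius is the maximum of the quadratic form of the matrix on the unit sphere, so
  \<open>\<rho>(G) < \<rho>(G')\<close> as soon as the form of \<open>G'\<close> exceeds that of \<open>G\<close> at the positive Perron vector of \<open>G\<close>.
  The weight \<open>(a^p + b^p)^(1/p)\<close> is increasing and convex in each argument, hence the Kelmans shift
  (moving all private neighbours of one vertex to another one) raises the radius unless the two
  neighbourhoods are nested. Take a bicyclic graph of maximal radius among those without a vertex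
  of degree \<open>n - 1\<close>. Every Kelmans shift that keeps the graph connected must create such a vertex, so
  only adjacent pairs that dominate the graph may be non-nested. Counting the edges outside a
  spanning double star leaves \<open>B\<^sub>3\<close>, diamonds with at least two pendant vertices at both vertices of degree
  at least three (excluded by moving all but one of the pendant vertices of one of them), and a
  single sporadic graph, which is compared with \<open>B\<^sub>3\<close> by two explicit rewirings.
  A vertex of degree \<open>n - 1\<close> forces \<open>B\<^sub>1\<close> or \<open>B\<^sub>2\<close>. A Kelmans shift turns \<open>B\<^sub>2\<close> into \<open>B\<^sub>1\<close>, and \<open>B\<^sub>3\<close> is compared with
  \<open>B\<^sub>2\<close> through the characteristic equation of its quotient matrix and a test vector for \<open>B\<^sub>2\<close>.
\<close>

section \<open>Symmetric nonnegative matrices\<close>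

text \<open>The weight of an edge depends on the degrees of its ends, so moving edges from
  \<open>v\<close> to \<open>u\<close> also alters edges that stay in place: those at
  \<open>u\<close> become heavier, those at \<open>v\<close> lighter. Monotonicity alone does not
  decide the sign. Convexity does: at a common neighbour \<open>j\<close>, the loss is an increment
  of \<open>wt\<close> ending at the old degree of \<open>v\<close>, the gain an increment of the
  same length ending at the new degree of \<open>u\<close>, which is at least as large; the factors
  \<open>x v \<le> x u\<close> point the same way. Only neighbours left behind at \<open>v\<close>
  alone can lose, and a full shift leaves none.

  Uniqueness of the third place needs no separate argument: a graph without a vertex of degree
  \<open>n - 1\<close> whose radius is at least that of \<open>B3\<close> is itself a maximiser, and
  every maximiser is shown to be a copy of \<open>B3\<close>.

  The bound \<open>p \<ge> 2\<close> acts through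
  \<open>x powr p = (x\<^sup>2) powr (p / 2)\<close>: inequalities between sums of squares carry
  over from the Euclidean norm to \<open>wt\<close>. The rational constants in the comparison of
  \<open>B3\<close> with \<open>B2\<close> are ratios of such sums.\<close>

definition qform :: "nat \<Rightarrow> (nat \<Rightarrow> nat \<Rightarrow> real) \<Rightarrow> (nat \<Rightarrow> real) \<Rightarrow> real" where
  "qform n A x = (\<Sum>i<n. \<Sum>j<n. A i j * x i * x j)"

definition sqnorm :: "nat \<Rightarrow> (nat \<Rightarrow> real) \<Rightarrow> real" where
  "sqnorm n x = (\<Sum>i<n. (x i)\<^sup>2)"

lemma sqnorm_nonneg: "sqnorm n x \<ge> 0"
  by (simp add: sqnorm_def sum_nonneg)

lemma sqnorm_eq_0_iff: "sqnorm n x = 0 \<longleftrightarrow> (\<forall>i<n. x i = 0)"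
  by (auto simp: sqnorm_def sum_nonneg_eq_0_iff)

lemma qform_scale: "qform n A (\<lambda>i. c * x i) = c\<^sup>2 * qform n A x"
  by (simp add: qform_def sum_distrib_left power2_eq_square mult_ac)

lemma sqnorm_scale: "sqnorm n (\<lambda>i. c * x i) = c\<^sup>2 * sqnorm n x"
  by (simp add: sqnorm_def sum_distrib_left power_mult_distrib)

lemma qform_eq_inner: "qform n A x = (\<Sum>i<n. x i * (\<Sum>j<n. A i j * x j))"
  by (simp add: qform_def sum_distrib_left mult_ac)

lemma qform_attains_max:
  assumes "n > 0"
  obtains x M where "sqnorm n x = 1" "qform n A x = M" "\<And>y. qform n A y \<le> M * sqnorm n y"
proof -
  \<comment> \<open>Vectors are functions on all of \<open>nat\<close>. Freezing the coordinates
    from \<open>n\<close> on at 0 makes the cube compact in the product topology, and neither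
    \<open>qform n\<close> nor \<open>sqnorm n\<close> sees these coordinates.\<close>
  define K where "K = Pi\<^sub>E UNIV (\<lambda>i::nat. if i < n then {-1..1::real} else {0})"
  define S where "S = K \<inter> {x. sqnorm n x = 1}"
  have "compactin (product_topology (\<lambda>i::nat. (euclidean :: real topology)) UNIV) K"
    unfolding K_def compactin_PiE by auto
  then have K: "compact K"
    by (simp add: euclidean_product_topology)
  have cs: "continuous_on UNIV (sqnorm n)"
    unfolding sqnorm_def by (intro continuous_intros continuous_on_product_coordinates)
  have cq: "continuous_on UNIV (qform n A)"
    unfolding qform_def by (intro continuous_intros continuous_on_product_coordinates)
  have "closed {x. sqnorm n x = 1}"
    using cs by (intro closed_Collect_eq) auto
  then have S: "compact S"
    unfolding S_def using K by (rule compact_Int_closed[rotated])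
  have "(\<lambda>i. if i = 0 then 1 else 0) \<in> S"
    using assms by (auto simp: S_def K_def sqnorm_def if_distrib[of "\<lambda>z. z^2"] cong: if_cong)
  then have "S \<noteq> {}" by auto
  then obtain x where x: "x \<in> S" and max: "\<And>y. y \<in> S \<Longrightarrow> qform n A y \<le> qform n A x"
    using continuous_attains_sup[OF S _ continuous_on_subset[OF cq]] by blast
  have "qform n A y \<le> qform n A x * sqnorm n y" for y
  proof (cases "sqnorm n y = 0")
    case True
    then have "\<forall>i<n. y i = 0" by (simp add: sqnorm_eq_0_iff)
    then show ?thesis by (simp add: qform_def True)
  next
    case False
    define s where "s = sqrt (sqnorm n y)"
    have s: "s > 0" "s\<^sup>2 = sqnorm n y"
      using False sqnorm_nonneg[of n y] by (auto simp: s_def)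
    define z where "z = (\<lambda>i. if i < n then y i / s else 0)"
    have z1: "sqnorm n z = sqnorm n (\<lambda>i. (1/s) * y i)" "qform n A z = qform n A (\<lambda>i. (1/s) * y i)"
      by (auto simp: sqnorm_def qform_def z_def intro!: sum.cong)
    have sz: "sqnorm n z = 1"
      unfolding z1 sqnorm_scale s(2)[symmetric] using s(1) by (simp add: power_divide)
    have "\<bar>z i\<bar> \<le> 1" for i
    proof (cases "i < n")
      case True
      then have "(z i)\<^sup>2 \<le> sqnorm n z"
        unfolding sqnorm_def by (intro member_le_sum) auto
      then show ?thesis unfolding sz by (simp add: abs_square_le_1)
    qed (simp add: z_def)
    then have "z \<in> S"
      using sz unfolding S_def K_def by (auto simp: abs_le_iff minus_le_iff) (auto simp: z_def)
    from max[OF this] have "qform n A y / sqnorm n y \<le> qform n A x"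
      unfolding z1 qform_scale s(2)[symmetric] by (simp add: power_divide)
    then show ?thesis
      using s by (metis pos_divide_le_eq zero_less_power)
  qed
  with that[of x "qform n A x"] x show thesis by (auto simp: S_def)
qed

text \<open>If \<open>A x\<close> differed from \<open>M x\<close>, a short move from
  \<open>x\<close> along the residual \<open>r\<close> would lift the form above \<open>M\<close>
  times the squared norm to first order.\<close>

lemma qform_maximizer_eigen:
  assumes sym: "\<And>i j. A i j = A j i"
    and max: "\<And>y. qform n A y \<le> M * sqnorm n y"
    and x: "qform n A x = M * sqnorm n x" and i: "i < n"
  shows "(\<Sum>j<n. A i j * x j) = M * x i"
proof (rule ccontr)
  define r where "r i = (\<Sum>j<n. A i j * x j) - M * x i" for i
  assume "\<not> ?thesis"
  then have "r i \<noteq> 0" by (simp add: r_def)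
  then have R: "sqnorm n r > 0"
    using sqnorm_nonneg[of n r] i by (auto simp: less_le sqnorm_eq_0_iff)
  have bil: "(\<Sum>i<n. \<Sum>j<n. A i j * r i * x j) = (\<Sum>i<n. \<Sum>j<n. A i j * x i * r j)"
    by (subst sum.swap) (intro sum.cong refl, metis sym mult.commute mult.assoc)
  have Rx: "sqnorm n r = (\<Sum>i<n. \<Sum>j<n. A i j * r i * x j) - M * (\<Sum>i<n. x i * r i)"
    by (simp add: sqnorm_def r_def[of "_"] power2_eq_square algebra_simps sum_subtractf sum_distrib_left sum.distrib)
  have q: "qform n A (\<lambda>i. x i + t * r i) = qform n A x + 2 * t * (\<Sum>i<n. \<Sum>j<n. A i j * r i * x j) + t\<^sup>2 * qform n A r" for t
  proof -
    have "qform n A (\<lambda>i. x i + t * r i) = (\<Sum>i<n. \<Sum>j<n. A i j * x i * x j + t * (A i j * r i * x j)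
       + t * (A i j * x i * r j) + t\<^sup>2 * (A i j * r i * r j))"
      unfolding qform_def by (intro sum.cong refl) (simp add: algebra_simps power2_eq_square)
    also have "\<dots> = qform n A x + t * (\<Sum>i<n. \<Sum>j<n. A i j * r i * x j)
       + t * (\<Sum>i<n. \<Sum>j<n. A i j * x i * r j) + t\<^sup>2 * qform n A r"
      by (simp add: sum.distrib sum_distrib_left qform_def)
    finally show ?thesis using bil by simp
  qed
  have s: "sqnorm n (\<lambda>i. x i + t * r i) = sqnorm n x + 2 * t * (\<Sum>i<n. x i * r i) + t\<^sup>2 * sqnorm n r" for t
    by (simp add: sqnorm_def power2_eq_square algebra_simps sum.distrib sum_distrib_left)
  define c where "c = M * sqnorm n r - qform n A r"
  have le: "2 * t * sqnorm n r \<le> t\<^sup>2 * c" for t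
    using max[of "\<lambda>i. x i + t * r i"] x unfolding q s Rx c_def by (simp add: algebra_simps)
  \<comment> \<open>Small enough that the quadratic term \<open>t\<^sup>2 * c\<close> is at most
    half of the linear term.\<close>
  define t where "t = sqnorm n r / (\<bar>c\<bar> + 1)"
  have t: "t > 0" using R by (simp add: t_def)
  have "t * c \<le> t * (\<bar>c\<bar> + 1)" using t by (intro mult_left_mono) auto
  also have "\<dots> = sqnorm n r" by (simp add: t_def)
  finally have "t\<^sup>2 * c \<le> t * sqnorm n r" using t by (simp add: power2_eq_square)
  moreover have "t * sqnorm n r > 0" using t R by simp
  ultimately show False using le[of t] by linarith
qed

lemma eigen_qform:
  assumes "\<And>i. i < n \<Longrightarrow> (\<Sum>j<n. A i j * x j) = M * x i"
  shows "qform n A x = M * sqnorm n x"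
  using assms by (simp add: qform_eq_inner sqnorm_def sum_distrib_left power2_eq_square mult_ac)

lemma eigenvalue_matI:
  assumes "\<And>i. i < n \<Longrightarrow> (\<Sum>j<n. A i j * x j) = M * x i" "i < n" "x i \<noteq> 0"
  shows "eigenvalue (mat n n (\<lambda>(i, j). A i j)) (M :: real)"
proof -
  have "vec n x \<noteq> 0\<^sub>v n"
    using assms(2,3) by (metis index_vec index_zero_vec(1))
  moreover have "mat n n (\<lambda>(i, j). A i j) *\<^sub>v vec n x = M \<cdot>\<^sub>v vec n x"
    using assms(1) by (intro eq_vecI) (auto simp: scalar_prod_def atLeast0LessThan)
  ultimately show ?thesis
    unfolding eigenvalue_def eigenvector_def by (intro exI[of _ "vec n x"]) auto
qed

lemma eigenvalue_matE:
  assumes "eigenvalue (mat n n (\<lambda>(i, j). A i j)) (M :: real)"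
  obtains x i where "\<And>i. i < n \<Longrightarrow> (\<Sum>j<n. A i j * x j) = M * x i" "i < n" "x i \<noteq> 0"
proof -
  from assms obtain v where v: "v \<in> carrier_vec n" "v \<noteq> 0\<^sub>v n"
    and e: "mat n n (\<lambda>(i, j). A i j) *\<^sub>v v = M \<cdot>\<^sub>v v"
    unfolding eigenvalue_def eigenvector_def by auto
  obtain i where "i < n" "v $ i \<noteq> 0"
    using v by (metis carrier_vecD eq_vecI index_zero_vec)
  moreover have "(\<Sum>j<n. A i j * v $ j) = M * v $ i" if "i < n" for i
    using arg_cong[OF e, of "\<lambda>u. u $ i"] that v(1)
    by (auto simp: scalar_prod_def atLeast0LessThan)
  ultimately show thesis using that by blast
qed

text \<open>\<open>Max\<close> needs a finite nonempty set: the spectrum is finite, and a maximiser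
  of the form is an eigenvector. Every other eigenvalue is the Rayleigh quotient of its own
  eigenvector, hence no larger.\<close>

lemma largest_eigenvalue_qform:
  assumes sym: "\<And>i j. A i j = A j i" and n: "n > 0"
  defines "M \<equiv> largest_eigenvalue (mat n n (\<lambda>(i, j). A i j))"
  shows "qform n A y \<le> M * sqnorm n y"
    and "\<exists>x. sqnorm n x = 1 \<and> qform n A x = M"
proof -
  obtain x \<mu> where x: "sqnorm n x = 1" "qform n A x = \<mu>"
    and max: "\<And>y. qform n A y \<le> \<mu> * sqnorm n y"
    using qform_attains_max[OF n, where A = A] by blast
  have ev: "\<And>i. i < n \<Longrightarrow> (\<Sum>j<n. A i j * x j) = \<mu> * x i"
    using qform_maximizer_eigen[OF sym max] x by simp
  have "\<exists>i<n. x i \<noteq> 0" using x(1) by (metis sqnorm_eq_0_iff zero_neq_one)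
  then have e: "eigenvalue (mat n n (\<lambda>(i, j). A i j)) \<mu>"
    using eigenvalue_matI[OF ev] by blast
  have fin: "finite {k. eigenvalue (mat n n (\<lambda>(i, j). A i j)) k}"
    using card_finite_spectrum(1)[of "mat n n (\<lambda>(i, j). A i j)" n] by (auto simp: spectrum_def)
  have "k \<le> \<mu>" if k: "eigenvalue (mat n n (\<lambda>(i, j). A i j)) k" for k
  proof -
    from eigenvalue_matE[OF k] obtain z i
      where z: "\<And>i. i < n \<Longrightarrow> (\<Sum>j<n. A i j * z j) = k * z i" "i < n" "z i \<noteq> 0" by blast
    have "sqnorm n z > 0"
      using sqnorm_nonneg[of n z] z(2,3) by (auto simp: less_le sqnorm_eq_0_iff)
    with eigen_qform[OF z(1)] max[of z] show ?thesis by simp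
  qed
  then have "M = \<mu>"
    unfolding M_def largest_eigenvalue_def using e fin by (intro Max_eqI) auto
  with x max show "qform n A y \<le> M * sqnorm n y" "\<exists>x. sqnorm n x = 1 \<and> qform n A x = M"
    by auto
qed

text \<open>Taking absolute values does not lower the form, so the absolute value of a maximiser is
  again a maximiser and thus an eigenvector. A zero entry would spread along the positive entries of
  \<open>A\<close> to the whole vector.\<close>

lemma perron_vector:
  assumes sym: "\<And>i j. A i j = A j i" and nn: "\<And>i j. A i j \<ge> 0" and n: "n > 0"
    and irr: "\<And>i j. i < n \<Longrightarrow> j < n \<Longrightarrow> (i, j) \<in> {(i, j). i < n \<and> j < n \<and> A i j > 0}\<^sup>*"
  defines "M \<equiv> largest_eigenvalue (mat n n (\<lambda>(i, j). A i j))"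
  obtains x where "sqnorm n x = 1" "\<And>i. i < n \<Longrightarrow> x i > 0"
    "\<And>i. i < n \<Longrightarrow> (\<Sum>j<n. A i j * x j) = M * x i"
proof -
  note lq = largest_eigenvalue_qform[where A = A, OF sym n, folded M_def]
  obtain x where x: "sqnorm n x = 1" "qform n A x = M" using lq(2) by auto
  define y where "y i = \<bar>x i\<bar>" for i
  have y1: "sqnorm n y = 1" using x by (simp add: y_def sqnorm_def)
  have "qform n A x \<le> qform n A y"
    unfolding qform_def y_def
    by (intro sum_mono) (metis abs_ge_self abs_mult abs_of_nonneg nn)
  with lq(1)[of y] x y1 have "qform n A y = M * sqnorm n y" by simp
  from qform_maximizer_eigen[OF sym lq(1) this]
  have ev: "\<And>i. i < n \<Longrightarrow> (\<Sum>j<n. A i j * y j) = M * y i" .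
  have step: "y j = 0" if "y i = 0" "i < n" "j < n" "A i j > 0" for i j
  proof -
    have "(\<Sum>j<n. A i j * y j) = 0" using ev that by simp
    then have "A i j * y j = 0"
      using that(3) nn by (subst (asm) sum_nonneg_eq_0_iff) (auto simp: y_def)
    with that(4) show ?thesis by simp
  qed
  have "y i > 0" if i: "i < n" for i
  proof (rule ccontr)
    assume "\<not> y i > 0"
    then have "y i = 0" by (simp add: y_def)
    have "y j = 0" if j: "j < n" for j
      using irr[OF i j] by (induction) (auto simp: \<open>y i = 0\<close> intro: step)
    then have "sqnorm n y = 0" by (simp add: sqnorm_eq_0_iff)
    with y1 show False by simp
  qed
  with that y1 ev show thesis by blast
qed

section \<open>The weight function\<close>

text \<open>The inner points \<open>s + k\<close> and \<open>r\<close> are convex combinations of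
  \<open>s\<close> and \<open>r + k\<close> with interchanged weights; the two convexity
  inequalities are added.\<close>

lemma convex_on_increment_mono:
  fixes f :: "real \<Rightarrow> real"
  assumes f: "convex_on {0<..} f" and "0 < s" "s \<le> r" "0 \<le> k"
  shows "f (s + k) - f s \<le> f (r + k) - f r"
proof (cases "s = r \<or> k = 0")
  case False
  define l where "l = (r - s) / (r + k - s)"
  have l: "0 \<le> l" "l \<le> 1" using assms False by (auto simp: l_def)
  have nz: "r + k - s \<noteq> 0" using assms False by simp
  have 1: "l * s + (1 - l) * (r + k) = s + k"
  proof -
    have "l * (r + k - s) = r - s" using nz by (simp add: l_def)
    then show ?thesis by (simp add: algebra_simps)
  qed
  have 2: "(1 - l) * s + l * (r + k) = r"
    using 1 by (simp add: algebra_simps)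
  have "f (l * s + (1 - l) * (r + k)) \<le> l * f s + (1 - l) * f (r + k)"
    using convex_onD[OF f, of "1 - l" s "r + k"] l assms by simp
  moreover have "f ((1 - l) * s + l * (r + k)) \<le> (1 - l) * f s + l * f (r + k)"
    using convex_onD[OF f, of l s "r + k"] l assms by simp
  ultimately show ?thesis unfolding 1 2 by (simp add: algebra_simps)
qed auto

text \<open>For nonnegative arguments and \<open>p \<ge> 1\<close> this is the l^p norm of the pair
  \<open>(a, b)\<close>.\<close>

definition wt :: "real \<Rightarrow> real \<Rightarrow> real \<Rightarrow> real" where
  "wt p a b = (a powr p + b powr p) powr (1 / p)"

lemma wt_commute: "wt p a b = wt p b a"
  by (simp add: wt_def add.commute)

lemma wt_nonneg: "wt p a b \<ge> 0"
  by (simp add: wt_def)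

lemma wt_pos: "a > 0 \<Longrightarrow> wt p a b > 0"
  using add_pos_nonneg[of "a powr p" "b powr p"] by (simp add: wt_def)

lemma wt_powr: "p > 0 \<Longrightarrow> wt p a b powr p = a powr p + b powr p"
  by (simp add: wt_def powr_powr)

lemma wt_mono:
  assumes "p > 0" "0 \<le> a" "a \<le> a'" "0 \<le> b" "b \<le> b'"
  shows "wt p a b \<le> wt p a' b'"
  unfolding wt_def using assms by (intro powr_mono2 add_mono) auto

lemma wt_strict_mono:
  assumes "p > 0" "0 \<le> a" "a < a'" "0 \<le> b" "b \<le> b'"
  shows "wt p a b < wt p a' b'"
  unfolding wt_def using assms by (intro powr_less_mono2 add_less_le_mono powr_mono2) auto

lemma wt_scale:
  assumes "p > 0" "k \<ge> 0" "a \<ge> 0" "b \<ge> 0"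
  shows "wt p (k * a) (k * b) = k * wt p a b"
proof -
  have "wt p (k * a) (k * b) = (k powr p * (a powr p + b powr p)) powr (1 / p)"
    using assms by (simp add: wt_def powr_mult algebra_simps)
  also have "\<dots> = k * wt p a b"
    using assms by (simp add: powr_mult powr_powr wt_def)
  finally show ?thesis .
qed

text \<open>Minkowski's inequality in the plane: both pairs are normalised, and convexity of
  \<open>x powr p\<close> is applied with weights proportional to their norms.\<close>

lemma wt_triangle:
  assumes p: "p \<ge> 1" and pos: "a > 0" "b > 0" "c > 0" "d > 0"
  shows "wt p (a + c) (b + d) \<le> wt p a b + wt p c d"
proof -
  define A B where "A = wt p a b" and "B = wt p c d"
  have AB: "A > 0" "B > 0" using pos wt_pos by (auto simp: A_def B_def)
  define t where "t = B / (A + B)"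
  have t: "0 \<le> t" "t \<le> 1" "1 - t = A / (A + B)" using AB by (auto simp: t_def field_simps)
  have cv: "((x + y) / (A + B)) powr p \<le> (1 - t) * (x / A) powr p + t * (y / B) powr p"
    if "x > 0" "y > 0" for x y
  proof -
    have "(1 - t) * (x / A) + t * (y / B) = (x + y) / (A + B)"
      unfolding t(3) using AB by (simp add: t_def add_divide_distrib)
    then show ?thesis
      using convex_onD[OF powr_convex[OF p] t(1,2), of "x / A" "y / B"] that AB by simp
  qed
  have "((a + c) / (A + B)) powr p + ((b + d) / (A + B)) powr p
      \<le> (1 - t) * ((a powr p + b powr p) / A powr p) + t * ((c powr p + d powr p) / B powr p)"
    using cv[of a c] cv[of b d] pos AB by (simp add: powr_divide algebra_simps add_divide_distrib)
  also have "\<dots> = 1"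
    using AB p wt_powr[of p a b, symmetric] wt_powr[of p c d, symmetric]
    unfolding A_def[symmetric] B_def[symmetric] by simp
  finally have "(a + c) powr p + (b + d) powr p \<le> (A + B) powr p"
    using pos AB by (simp add: powr_divide field_simps)
  then have "wt p (a + c) (b + d) \<le> ((A + B) powr p) powr (1 / p)"
    unfolding wt_def using p by (intro powr_mono2) auto
  also have "\<dots> = A + B" using AB p by (simp add: powr_powr)
  finally show ?thesis by (simp add: A_def B_def)
qed

lemma wt_convex:
  assumes "p \<ge> 1" "c > 0"
  shows "convex_on {0<..} (\<lambda>x. wt p x c)"
proof (rule convex_onI)
  fix t x y :: real
  assume t: "0 < t" "t < 1" and xy: "x \<in> {0<..}" "y \<in> {0<..}"
  have "wt p ((1 - t) * x + t * y) ((1 - t) * c + t * c) \<le> wt p ((1 - t) * x) ((1 - t) * c) + wt p (t * y) (t * c)"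
    using t xy assms by (intro wt_triangle) auto
  also have "\<dots> = (1 - t) * wt p x c + t * wt p y c"
    using t xy assms by (simp add: wt_scale)
  finally show "wt p ((1 - t) *\<^sub>R x + t *\<^sub>R y) c \<le> (1 - t) * wt p x c + t * wt p y c"
    by (simp add: algebra_simps)
qed simp

lemma wt_increment_mono:
  assumes "p \<ge> 1" "c > 0" "0 < s" "s \<le> r" "0 \<le> k"
  shows "wt p (s + k) c - wt p s c \<le> wt p (r + k) c - wt p r c"
  using convex_on_increment_mono[OF wt_convex] assms by blast

text \<open>Both pairs have the same sum and the right one is more spread out. This handles the edge
  between the two vertices of a shift, whose degree sum does not change.\<close>

lemma wt_majorize:
  assumes p: "p \<ge> 1" and s: "0 < s" "s \<le> r" "0 \<le> k"
  shows "wt p r (s + k) \<le> wt p (r + k) s"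
  unfolding wt_def using convex_on_increment_mono[OF powr_convex[OF p] s] p
  by (intro powr_mono2) auto

text \<open>By convexity each of the \<open>k\<close> unit steps just below \<open>d\<close> is at
  most the step from \<open>d\<close> to \<open>d + 1\<close>.\<close>

lemma wt_slope:
  assumes "p \<ge> 1" "c > 0" "k < d"
  shows "wt p (real d) c - wt p (real (d - k)) c \<le> real k * (wt p (real d + 1) c - wt p (real d) c)"
  using assms(3)
proof (induction k)
  case (Suc k)
  have "wt p (real (d - Suc k) + 1) c - wt p (real (d - Suc k)) c \<le> wt p (real d + 1) c - wt p (real d) c"
    using Suc.prems assms by (intro wt_increment_mono) auto
  moreover have "real (d - Suc k) + 1 = real (d - k)" using Suc.prems by linarith
  ultimately show ?case using Suc by (simp add: algebra_simps)
qed simp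

text \<open>Weak majorisation for an increasing convex function: if the smaller of \<open>Z\<close>,
  \<open>V\<close> exceeds \<open>Y\<close>, its surplus over \<open>Y\<close> is transferred to the
  larger one, which stays below \<open>X\<close>.\<close>

lemma powr_majorize:
  fixes X Y Z V :: real
  assumes q: "q \<ge> 1" and "Y > 0" "0 < Z" "0 < V" "Z \<le> X" "V \<le> X" "Z + V \<le> X + Y"
  shows "Z powr q + V powr q \<le> X powr q + Y powr q"
proof -
  have *: "z powr q + v powr q \<le> X powr q + Y powr q"
    if "0 < v" "v \<le> z" "z \<le> X" "z + v \<le> X + Y" for z v
  proof (cases "v \<le> Y")
    case True
    then show ?thesis using that q assms by (intro add_mono powr_mono2) auto
  next
    case False
    then have "v powr q - Y powr q \<le> (z + (v - Y)) powr q - z powr q"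
      using convex_on_increment_mono[OF powr_convex[OF q], of Y z "v - Y"] assms that by auto
    also have "(z + (v - Y)) powr q \<le> X powr q"
      using that False assms q by (intro powr_mono2) auto
    finally show ?thesis by simp
  qed
  show ?thesis
    using *[of V Z] *[of Z V] assms by linarith
qed

text \<open>\<open>powr_majorize\<close> with exponent \<open>p / 2\<close>, applied to the squares;
  this is where \<open>p \<ge> 2\<close> is used.\<close>

lemma wt_le_of_squares:
  assumes p: "p \<ge> 2" and pos: "a > 0" "b > 0" "c > 0" "d > 0"
    and "c \<le> a" "d \<le> a" "c\<^sup>2 + d\<^sup>2 \<le> a\<^sup>2 + b\<^sup>2"
  shows "wt p c d \<le> wt p a b"
proof -
  have sq: "x powr p = (x\<^sup>2) powr (p / 2)" if "x > 0" for x :: real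
  proof -
    have "x\<^sup>2 = x powr 2" using that by simp
    then show ?thesis using that by (simp only: powr_powr) simp
  qed
  have "(c\<^sup>2) powr (p / 2) + (d\<^sup>2) powr (p / 2) \<le> (a\<^sup>2) powr (p / 2) + (b\<^sup>2) powr (p / 2)"
    using assms by (intro powr_majorize) (auto intro!: power_mono)
  then show ?thesis
    unfolding wt_def using p pos by (intro powr_mono2) (auto simp: sq)
qed

text \<open>Scaling the smaller pair by \<open>sqrt k\<close> reduces this to
  \<open>wt_le_of_squares\<close>. The natural choice of \<open>k\<close> is the ratio of the sums
  of squares, for which equality holds at \<open>p = 2\<close>.\<close>

lemma wt_sq_ratio:
  assumes p: "p \<ge> 2" and pos: "a > 0" "b > 0" "c > 0" "d > 0" and k: "k > 0"
    and "k * c\<^sup>2 \<le> a\<^sup>2" "k * d\<^sup>2 \<le> a\<^sup>2" "k * (c\<^sup>2 + d\<^sup>2) \<le> a\<^sup>2 + b\<^sup>2"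
  shows "k * (wt p c d)\<^sup>2 \<le> (wt p a b)\<^sup>2"
proof -
  have sk: "sqrt k > 0" using k by simp
  have le: "sqrt k * x \<le> a" if "k * x\<^sup>2 \<le> a\<^sup>2" for x
    by (rule power2_le_imp_le) (use that k pos in \<open>simp_all add: power_mult_distrib\<close>)
  have "sqrt k * wt p c d = wt p (sqrt k * c) (sqrt k * d)"
    using p pos sk by (simp add: wt_scale)
  also have "\<dots> \<le> wt p a b"
  proof (rule wt_le_of_squares[OF p pos(1,2)])
    show "(sqrt k * c)\<^sup>2 + (sqrt k * d)\<^sup>2 \<le> a\<^sup>2 + b\<^sup>2"
      using assms(9) k by (simp add: power_mult_distrib distrib_left)
  qed (use le assms(7,8) pos sk in simp_all)
  finally have "(sqrt k * wt p c d)\<^sup>2 \<le> (wt p a b)\<^sup>2"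
    using k by (intro power_mono) (simp_all add: wt_nonneg)
  then show ?thesis using k by (simp add: power_mult_distrib)
qed

section \<open>Sombor matrices of graphs\<close>

definition nbrs :: "nat \<Rightarrow> nat set set \<Rightarrow> nat \<Rightarrow> nat set" where
  "nbrs n E u = {v. v < n \<and> adj E u v}"

lemma deg_eq_card_nbrs: "deg n E u = card (nbrs n E u)"
  by (simp add: deg_def nbrs_def)

lemma finite_nbrs [simp]: "finite (nbrs n E u)"
  by (simp add: nbrs_def)

lemma adj_commute: "adj E u v \<longleftrightarrow> adj E v u"
  by (auto simp: adj_def insert_commute)

lemma adj_irrefl [simp]: "\<not> adj E u u"
  by (simp add: adj_def)

lemma adj_less:
  assumes "simple_graph n E" "adj E u v"
  shows "u < n" "v < n"
  using assms by (auto simp: simple_graph_def adj_def doubleton_eq_iff)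

lemma in_nbrs_iff: "simple_graph n E \<Longrightarrow> v \<in> nbrs n E u \<longleftrightarrow> adj E u v"
  by (auto simp: nbrs_def dest: adj_less)

lemma simple_graph_finite: "simple_graph n E \<Longrightarrow> finite E"
proof -
  assume "simple_graph n E"
  then have "E \<subseteq> Pow {..<n}" by (auto simp: simple_graph_def)
  then show ?thesis by (rule finite_subset) simp
qed

lemma simple_graph_edgeE:
  assumes "simple_graph n E" "e \<in> E"
  obtains a b where "e = {a, b}" "adj E a b" "a < n" "b < n" "a \<noteq> b"
proof -
  obtain a b where "e = {a, b}" "a < n" "b < n" "a \<noteq> b"
    using assms by (auto simp: simple_graph_def)
  with that assms(2) show thesis by (simp add: adj_def)
qed

lemma deg_pos: "simple_graph n E \<Longrightarrow> adj E u v \<Longrightarrow> deg n E u > 0"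
  using in_nbrs_iff[of n E v u] by (auto simp: deg_eq_card_nbrs card_gt_0_iff)

definition swt :: "real \<Rightarrow> nat \<Rightarrow> nat set set \<Rightarrow> nat \<Rightarrow> nat \<Rightarrow> real" where
  "swt p n E i j = (if adj E i j then wt p (deg n E i) (deg n E j) else 0)"

lemma sombor_matrix_swt: "sombor_matrix p n E = mat n n (\<lambda>(i, j). swt p n E i j)"
  unfolding sombor_matrix_def by (intro eq_matI) (auto simp: swt_def wt_def)

lemma swt_commute: "swt p n E i j = swt p n E j i"
  by (simp add: swt_def adj_commute wt_commute)

lemma swt_nonneg: "swt p n E i j \<ge> 0"
  by (simp add: swt_def wt_nonneg)

lemma swt_diag [simp]: "swt p n E i i = 0"
  by (simp add: swt_def)

lemma qform_le_rhoS:
  assumes "n > 0"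
  shows "qform n (swt p n E) y \<le> rhoS p n E * sqnorm n y"
  unfolding sombor_matrix_swt
  using largest_eigenvalue_qform(1)[where A = "swt p n E", OF swt_commute assms] .

definition perron :: "real \<Rightarrow> nat \<Rightarrow> nat set set \<Rightarrow> (nat \<Rightarrow> real) \<Rightarrow> bool" where
  "perron p n E x \<longleftrightarrow> sqnorm n x = 1 \<and> (\<forall>i<n. x i > 0) \<and>
     (\<forall>i<n. (\<Sum>j<n. swt p n E i j * x j) = rhoS p n E * x i)"

lemma perron_exists:
  assumes s: "simple_graph n E" and c: "connected_graph n E" and n: "n > 0"
  obtains x where "perron p n E x"
proof -
  have pos: "swt p n E i j > 0" if "adj E i j" for i j
    using that deg_pos[OF s that] by (simp add: swt_def wt_pos)
  have "(i, j) \<in> {(i, j). i < n \<and> j < n \<and> swt p n E i j > 0}\<^sup>*" if "i < n" "j < n" for i j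
  proof -
    have "{(x, y). adj E x y} \<subseteq> {(i, j). i < n \<and> j < n \<and> swt p n E i j > 0}"
      using pos adj_less[OF s] by auto
    from rtrancl_mono[OF this] show ?thesis
      using c that by (auto simp: connected_graph_def)
  qed
  then obtain x where "sqnorm n x = 1" "\<And>i. i < n \<Longrightarrow> x i > 0"
    "\<And>i. i < n \<Longrightarrow> (\<Sum>j<n. swt p n E i j * x j) = rhoS p n E * x i"
    unfolding sombor_matrix_swt
    using perron_vector[where A = "swt p n E", OF swt_commute swt_nonneg n] by blast
  then show thesis using that unfolding perron_def by blast
qed

lemma perron_qform: "perron p n E x \<Longrightarrow> qform n (swt p n E) x = rhoS p n E"
  using eigen_qform[of n "swt p n E" x "rhoS p n E"] by (auto simp: perron_def)

lemma perron_nbrs: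
  assumes "perron p n E x" "i < n"
  shows "(\<Sum>j\<in>nbrs n E i. wt p (deg n E i) (deg n E j) * x j) = rhoS p n E * x i"
proof -
  have "(\<Sum>j\<in>nbrs n E i. wt p (deg n E i) (deg n E j) * x j) = (\<Sum>j\<in>nbrs n E i. swt p n E i j * x j)"
    by (intro sum.cong) (auto simp: swt_def nbrs_def)
  also have "\<dots> = (\<Sum>j<n. swt p n E i j * x j)"
    by (intro sum.mono_neutral_left) (auto simp: swt_def nbrs_def)
  finally show ?thesis using assms by (simp add: perron_def)
qed

lemma rhoS_less_of_qform:
  assumes "perron p n E x" "n > 0" "qform n (swt p n E) x < qform n (swt p n E') x"
  shows "rhoS p n E < rhoS p n E'"
  using qform_le_rhoS[OF assms(2), of p E' x] assms(1,3) perron_qform[OF assms(1)]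
  by (simp add: perron_def)

lemma rhoS_pos:
  assumes "perron p n E x" "adj E i j" "simple_graph n E"
  shows "rhoS p n E > 0"
proof -
  note l = adj_less[OF assms(3,2)]
  have p: "swt p n E i j * x j > 0"
    using assms deg_pos[OF assms(3,2)] l by (simp add: swt_def wt_pos perron_def)
  have "swt p n E i j * x j \<le> (\<Sum>j<n. swt p n E i j * x j)"
    using l assms(1) by (intro member_le_sum) (auto simp: swt_nonneg perron_def less_imp_le)
  also have "\<dots> = rhoS p n E * x i" using assms(1) l by (simp add: perron_def)
  finally have "rhoS p n E * x i > 0" using p by simp
  moreover have "x i > 0" using assms(1) l by (simp add: perron_def)
  ultimately show ?thesis by (simp add: zero_less_mult_iff)
qed

section \<open>Invariance of the radius under isomorphism\<close>

lemma graph_iso_deg: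
  assumes f: "bij_betw f {0..<n} {0..<n}" and a: "\<forall>u<n. \<forall>v<n. adj E1 u v \<longleftrightarrow> adj E2 (f u) (f v)" and u: "u < n"
  shows "deg n E2 (f u) = deg n E1 u"
proof -
  have "bij_betw f {v. v < n \<and> adj E1 u v} {v. v < n \<and> adj E2 (f u) v}"
    unfolding bij_betw_def
  proof
    show "inj_on f {v. v < n \<and> adj E1 u v}"
      using f by (auto simp: bij_betw_def inj_on_def)
    show "f ` {v. v < n \<and> adj E1 u v} = {v. v < n \<and> adj E2 (f u) v}"
    proof (intro equalityI subsetI)
      fix w assume w: "w \<in> {v. v < n \<and> adj E2 (f u) v}"
      then have "w \<in> f ` {0..<n}" using f by (auto simp: bij_betw_def)
      with w a u show "w \<in> f ` {v. v < n \<and> adj E1 u v}" by auto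
    next
      fix w assume "w \<in> f ` {v. v < n \<and> adj E1 u v}"
      moreover have "f v < n" if "v < n" for v
        using bij_betwE[OF f] that by auto
      ultimately show "w \<in> {v. v < n \<and> adj E2 (f u) v}" using a u by auto
    qed
  qed
  then show ?thesis unfolding deg_def by (simp add: bij_betw_same_card)
qed

lemma graph_iso_rhoS:
  assumes iso: "graph_iso n E1 E2" and n: "n > 0"
  shows "rhoS p n E1 = rhoS p n E2"
proof -
  obtain f where f: "bij_betw f {0..<n} {0..<n}" and a: "\<forall>u<n. \<forall>v<n. adj E1 u v \<longleftrightarrow> adj E2 (f u) (f v)"
    using iso by (auto simp: graph_iso_def)
  have f': "bij_betw f {..<n} {..<n}" using f by (simp add: atLeast0LessThan)
  have sw: "swt p n E1 i j = swt p n E2 (f i) (f j)" if "i < n" "j < n" for i j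
    using that a graph_iso_deg[OF f a] by (simp add: swt_def)
  have q: "qform n (swt p n E2) x = qform n (swt p n E1) (\<lambda>i. x (f i))" for x
  proof -
    have "qform n (swt p n E2) x = (\<Sum>i<n. \<Sum>j<n. swt p n E2 (f i) (f j) * x (f i) * x (f j))"
      unfolding qform_def
      by (subst sum.reindex_bij_betw[OF f', symmetric], subst sum.reindex_bij_betw[OF f', symmetric]) simp
    then show ?thesis unfolding qform_def by (simp add: sw)
  qed
  have s: "sqnorm n (\<lambda>i. x (f i)) = sqnorm n x" for x
    unfolding sqnorm_def using sum.reindex_bij_betw[OF f', of "\<lambda>i. (x i)\<^sup>2"] by simp
  have ex: "\<exists>x. sqnorm n x = 1 \<and> qform n (swt p n E) x = rhoS p n E" for E
    unfolding sombor_matrix_swt using largest_eigenvalue_qform(2)[where A = "swt p n E", OF swt_commute n] .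
  show ?thesis
  proof (rule antisym)
    obtain x where x: "sqnorm n x = 1" "qform n (swt p n E1) x = rhoS p n E1" using ex by blast
    define g where "g = inv_into {..<n} f"
    have g: "g (f i) = i" if "i < n" for i
      using that f' by (simp add: g_def bij_betw_def)
    have "qform n (swt p n E2) (\<lambda>i. x (g i)) = qform n (swt p n E1) x"
      unfolding q by (simp add: qform_def g)
    moreover have "sqnorm n (\<lambda>i. x (g i)) = sqnorm n x"
      unfolding s[of "\<lambda>i. x (g i)", symmetric] by (simp add: sqnorm_def g)
    ultimately show "rhoS p n E1 \<le> rhoS p n E2"
      using qform_le_rhoS[OF n, of p E2 "\<lambda>i. x (g i)"] x by simp
    obtain x where "sqnorm n x = 1" "qform n (swt p n E2) x = rhoS p n E2" using ex by blast
    then show "rhoS p n E2 \<le> rhoS p n E1"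
      using qform_le_rhoS[OF n, of p E1 "\<lambda>i. x (f i)"] q s by simp
  qed
qed

text \<open>With \<open>P\<close> the set of all private neighbours of \<open>v\<close> this is the
  Kelmans shift. A proper subset is used in \<open>no_pendant_shift\<close>, where one neighbour
  stays at \<open>v\<close>.\<close>

definition move_edges :: "nat set set \<Rightarrow> nat \<Rightarrow> nat \<Rightarrow> nat set \<Rightarrow> nat set set" where
  "move_edges E v u P = (E - (\<lambda>w. {v, w}) ` P) \<union> (\<lambda>w. {u, w}) ` P"

text \<open>Keeping \<open>u\<close> and its neighbours out of \<open>P\<close> ensures that no new
  edge is a loop or already present. Hence the number of edges is preserved and only
  \<open>u\<close> and \<open>v\<close> change their degrees.\<close>

locale edge_move =
  fixes n E u v P
  assumes simple: "simple_graph n E" and u: "u < n" and v: "v < n" and uv: "u \<noteq> v"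
    and P: "\<And>w. w \<in> P \<Longrightarrow> adj E v w \<and> \<not> adj E u w \<and> w \<noteq> u"
begin

abbreviation "E' \<equiv> move_edges E v u P"

lemma P_less: "w \<in> P \<Longrightarrow> w < n" and P_neq: "w \<in> P \<Longrightarrow> w \<noteq> u \<and> w \<noteq> v"
  using P[of w] adj_less[OF simple, of v w] by auto

lemma finite_P: "finite P"
  by (rule finite_subset[of _ "{..<n}"]) (auto dest: P_less)

lemma simple': "simple_graph n E'"
proof -
  have "(\<lambda>w. {u, w}) ` P \<subseteq> {{u, v} |u v. u < n \<and> v < n \<and> u \<noteq> v}"
    using u P_less P_neq by blast
  then show ?thesis using simple unfolding simple_graph_def move_edges_def by blast
qed

lemma adj'_iff:
  "adj E' a b \<longleftrightarrow> a \<noteq> b \<and> (adj E a b \<and> \<not> (a = v \<and> b \<in> P \<or> b = v \<and> a \<in> P)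
     \<or> a = u \<and> b \<in> P \<or> b = u \<and> a \<in> P)"
proof -
  have "{a, b} \<in> (\<lambda>w. {z, w}) ` P \<longleftrightarrow> a = z \<and> b \<in> P \<or> b = z \<and> a \<in> P" for z
    unfolding image_iff doubleton_eq_iff by blast
  then show ?thesis unfolding adj_def move_edges_def by auto
qed

lemma adj'_u: "adj E' u w \<longleftrightarrow> adj E u w \<or> w \<in> P"
  using P_neq uv unfolding adj'_iff by (metis adj_irrefl)

lemma adj'_v: "adj E' v w \<longleftrightarrow> adj E v w \<and> w \<notin> P"
  using P_neq uv unfolding adj'_iff by (metis adj_irrefl)

lemma adj'_other: "i \<noteq> u \<Longrightarrow> i \<noteq> v \<Longrightarrow> j \<noteq> u \<Longrightarrow> j \<noteq> v \<Longrightarrow> adj E' i j \<longleftrightarrow> adj E i j"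
  unfolding adj'_iff by (metis adj_irrefl)

lemma nbrs'_u: "nbrs n E' u = nbrs n E u \<union> P"
  using P_less unfolding nbrs_def adj'_u by blast

lemma nbrs'_v: "nbrs n E' v = nbrs n E v - P"
  unfolding nbrs_def adj'_v by blast

lemma deg'_u: "deg n E' u = deg n E u + card P"
proof -
  have "nbrs n E u \<inter> P = {}" using P unfolding nbrs_def by blast
  then show ?thesis
    unfolding deg_eq_card_nbrs nbrs'_u by (intro card_Un_disjoint finite_nbrs finite_P)
qed

lemma P_subset: "P \<subseteq> nbrs n E v"
  using P P_less unfolding nbrs_def by blast

lemma deg'_v: "deg n E' v = deg n E v - card P"
  unfolding deg_eq_card_nbrs nbrs'_v using P_subset by (simp add: card_Diff_subset finite_P)

lemma deg'_other:
  assumes "w \<noteq> u" "w \<noteq> v"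
  shows "deg n E' w = deg n E w"
proof (cases "w \<in> P")
  case True
  have "adj E' w z \<longleftrightarrow> z = u \<or> adj E w z \<and> z \<noteq> v" for z
    using True assms P[OF True] adj'_other[OF assms, of z] adj'_u[of w] adj'_v[of w]
      adj_commute[of E' w u] adj_commute[of E' w v] adj_commute[of E w u] adj_commute[of E w v] uv
    by (cases "z = u"; cases "z = v") simp_all
  then have "nbrs n E' w = insert u (nbrs n E w - {v})"
    using u by (auto simp: nbrs_def)
  moreover have "u \<notin> nbrs n E w" "v \<in> nbrs n E w"
    using P[OF True] v by (auto simp: nbrs_def adj_commute)
  ultimately show ?thesis
    unfolding deg_eq_card_nbrs
    by (auto intro!: Suc_pred simp: card_gt_0_iff)
next
  case False
  have "adj E' w z \<longleftrightarrow> adj E w z" for z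
    using False assms adj'_other[OF assms, of z] adj'_u[of w] adj'_v[of w]
      adj_commute[of E' w u] adj_commute[of E' w v] adj_commute[of E w u] adj_commute[of E w v]
    by (cases "z = u"; cases "z = v") simp_all
  then have "nbrs n E' w = nbrs n E w"
    by (simp add: nbrs_def)
  then show ?thesis by (simp add: deg_eq_card_nbrs)
qed

lemma card': "card E' = card E"
proof -
  have i: "inj_on (\<lambda>w. {z, w}) P" for z :: nat
    by (auto simp: inj_on_def doubleton_eq_iff)
  have sub: "(\<lambda>w. {v, w}) ` P \<subseteq> E" using P by (auto simp: adj_def)
  have dis: "(E - (\<lambda>w. {v, w}) ` P) \<inter> (\<lambda>w. {u, w}) ` P = {}"
    using P by (auto simp: adj_def)
  have "card E' = card (E - (\<lambda>w. {v, w}) ` P) + card ((\<lambda>w. {u, w}) ` P)"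
    unfolding move_edges_def using dis simple_graph_finite[OF simple] finite_P
    by (intro card_Un_disjoint) auto
  also have "\<dots> = card E - card P + card P"
    using sub finite_P by (simp add: card_Diff_subset card_image[OF i])
  also have "\<dots> = card E"
    using card_mono[OF simple_graph_finite[OF simple] sub] by (simp add: card_image[OF i])
  finally show ?thesis .
qed

text \<open>An edge \<open>u v\<close> or a path through a common neighbour survives, because
  \<open>P\<close> contains neither \<open>u\<close> nor common neighbours. A moved neighbour is
  then reached from \<open>v\<close> through \<open>u\<close>.\<close>

lemma connected':
  assumes c: "connected_graph n E" and link: "adj E u v \<or> (\<exists>w. adj E u w \<and> adj E v w)"
  shows "connected_graph n E'"
proof -
  let ?R = "{(x, y). adj E' x y}\<^sup>*"
  have sy: "sym ?R" by (intro sym_rtrancl) (auto simp: sym_def adj_commute)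
  have uv': "(u, v) \<in> ?R"
  proof (cases "adj E u v")
    case True
    then have "adj E' u v" by (simp add: adj'_u)
    then show ?thesis by auto
  next
    case False
    with link obtain w where w: "adj E u w" "adj E v w" by auto
    moreover have "w \<notin> P" using P w by blast
    ultimately have "adj E' u w" "adj E' w v"
      using adj'_u[of w] adj'_v[of w] adj_commute[of E' w v] by simp_all
    then have "(u, w) \<in> ?R" "(w, v) \<in> ?R" by auto
    then show ?thesis by (rule rtrancl_trans)
  qed
  have vw: "(v, w) \<in> ?R" if "adj E v w" for w
  proof (cases "w \<in> P")
    case True
    then have "(u, w) \<in> ?R" by (auto simp: adj'_u)
    then show ?thesis using uv' symD[OF sy] by (meson rtrancl_trans)
  next
    case False
    with that show ?thesis by (auto simp: adj'_v)
  qed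
  have edge: "(x, y) \<in> ?R" if "adj E x y" for x y
  proof -
    consider "x = v" | "y = v" | "x = u" "y \<noteq> v" | "y = u" "x \<noteq> v" | "x \<noteq> u" "x \<noteq> v" "y \<noteq> u" "y \<noteq> v"
      by auto
    then show ?thesis
    proof cases
      case 1 then show ?thesis using vw that by simp
    next
      case 2 then show ?thesis using vw that symD[OF sy] by (simp add: adj_commute)
    next
      case 3 then show ?thesis using that by (auto simp: adj'_u)
    next
      case 4
      then have "adj E' u x" using that adj_commute by (auto simp: adj'_u)
      then have "(u, x) \<in> ?R" by auto
      then show ?thesis using 4 symD[OF sy] by auto
    next
      case 5 then show ?thesis using that by (auto simp: adj'_other)
    qed
  qed
  then have "{(x, y). adj E x y}\<^sup>* \<subseteq> ?R"
    by (intro rtrancl_subset_rtrancl) auto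
  then show ?thesis using c unfolding connected_graph_def by blast
qed

lemma bicyclic':
  assumes "bicyclic n E" "adj E u v \<or> (\<exists>w. adj E u w \<and> adj E v w)"
  shows "bicyclic n E'"
  using assms simple' card' connected' by (simp add: bicyclic_def)

end

section \<open>Kelmans shifts\<close>

text \<open>Made for moves between \<open>u\<close> and \<open>v\<close>: all other degrees are
  unchanged, so the Sombor matrices differ only in these two rows and columns. Grouping by the third
  vertex \<open>j\<close> isolates what its edges contribute.\<close>

lemma qform_pair_diff:
  assumes sym: "\<And>i j. A i j = A j i" "\<And>i j. A' i j = A' j i"
    and diag: "\<And>i. A i i = 0" "\<And>i. A' i i = 0"
    and agree: "\<And>i j. i \<noteq> u \<Longrightarrow> i \<noteq> v \<Longrightarrow> j \<noteq> u \<Longrightarrow> j \<noteq> v \<Longrightarrow> A' i j = A i j"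
    and uv: "u < n" "v < n" "u \<noteq> v"
  shows "qform n A' x - qform n A x = 2 * ((A' u v - A u v) * x u * x v
    + (\<Sum>j\<in>{..<n} - {u, v}. x j * ((A' u j - A u j) * x u + (A' v j - A v j) * x v)))"
proof -
  define D where "D i j = A' i j - A i j" for i j
  define I where "I = {..<n} - {u, v}"
  have split: "(\<Sum>j<n. f j) = f u + f v + (\<Sum>j\<in>I. f j)" for f :: "nat \<Rightarrow> real"
  proof -
    have "{..<n} = insert u (insert v I)" using uv by (auto simp: I_def)
    moreover have "u \<notin> I" "v \<notin> I" "finite I" by (auto simp: I_def)
    ultimately show ?thesis using uv by simp
  qed
  have D0: "D i j = 0" if "i \<in> I" "j \<in> I" for i j
    using that agree by (simp add: D_def I_def)
  have Ds: "D i j = D j i" for i j using sym by (simp add: D_def)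
  have Dd: "D i i = 0" for i using diag by (simp add: D_def)
  have "qform n A' x - qform n A x = (\<Sum>i<n. \<Sum>j<n. D i j * x i * x j)"
    by (simp add: qform_def D_def left_diff_distrib sum_subtractf)
  also have "\<dots> = (\<Sum>i\<in>I. D i u * x i * x u + D i v * x i * x v + (\<Sum>j\<in>I. D i j * x i * x j))
      + 2 * D u v * x u * x v + (\<Sum>j\<in>I. D u j * x u * x j) + (\<Sum>j\<in>I. D v j * x v * x j)"
    unfolding split by (simp add: Dd Ds[of v u])
  also have "(\<Sum>i\<in>I. D i u * x i * x u + D i v * x i * x v + (\<Sum>j\<in>I. D i j * x i * x j))
      = (\<Sum>j\<in>I. D u j * x u * x j) + (\<Sum>j\<in>I. D v j * x v * x j)"
  proof -
    have "(\<Sum>j\<in>I. D i j * x i * x j) = 0" if "i \<in> I" for i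
      using D0 that by (intro sum.neutral) simp
    then show ?thesis
      by (simp add: sum.distrib Ds[of _ u] Ds[of _ v] mult_ac cong: sum.cong)
  qed
  also have "(\<Sum>j\<in>I. D u j * x u * x j) + (\<Sum>j\<in>I. D v j * x v * x j) + 2 * D u v * x u * x v
      + (\<Sum>j\<in>I. D u j * x u * x j) + (\<Sum>j\<in>I. D v j * x v * x j)
      = 2 * (D u v * x u * x v + (\<Sum>j\<in>I. x j * (D u j * x u + D v j * x v)))"
    by (simp add: sum.distrib algebra_simps sum_distrib_left)
  finally show ?thesis by (simp add: D_def I_def)
qed

text \<open>\<open>deg_le\<close> compares the new degree of \<open>u\<close> with the old degree of
  \<open>v\<close>, so it can hold even if \<open>v\<close> had the larger degree.
  \<open>card_P\<close> leaves \<open>v\<close> with positive degree, within the domain on which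
  \<open>wt\<close> is shown convex.\<close>

locale edge_move_gain = edge_move +
  fixes p x
  assumes p: "p \<ge> (1::real)" and xpos: "\<And>i. i < n \<Longrightarrow> x i > (0::real)" and x_le: "x v \<le> x u"
    and deg_le: "deg n E v \<le> deg n E u + card P" and card_P: "card P < deg n E v" and P_ne: "P \<noteq> {}"
begin

abbreviation "d w \<equiv> real (deg n E w)"
abbreviation "k \<equiv> real (card P)"

text \<open>Half of the change of the form that comes from the edges joining \<open>j\<close> to
  \<open>u\<close> and \<open>v\<close>.\<close>

definition "gain j = x j * ((swt p n E' u j - swt p n E u j) * x u + (swt p n E' v j - swt p n E v j) * x v)"

lemma d'_u: "real (deg n E' u) = d u + k"
  by (simp add: deg'_u)

lemma d'_v: "real (deg n E' v) = d v - k"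
  using card_P by (simp add: deg'_v)

lemma k_pos: "k \<ge> 1"
  using P_ne finite_P by (simp add: Suc_le_eq card_gt_0_iff)

lemma qform_move:
  "qform n (swt p n E') x - qform n (swt p n E) x
    = 2 * ((swt p n E' u v - swt p n E u v) * x u * x v + (\<Sum>j\<in>{..<n} - {u, v}. gain j))"
  unfolding gain_def
proof (rule qform_pair_diff[OF swt_commute swt_commute swt_diag swt_diag _ u v uv])
  fix i j assume ij: "i \<noteq> u" "i \<noteq> v" "j \<noteq> u" "j \<noteq> v"
  show "swt p n E' i j = swt p n E i j"
    unfolding swt_def adj'_other[OF ij] deg'_other[OF ij(1,2)] deg'_other[OF ij(3,4)] ..
qed

lemma pair_gain: "swt p n E u v \<le> swt p n E' u v"
proof (cases "adj E u v")
  case True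
  have "v \<notin> P" using P_neq by blast
  have "wt p (d u) ((d v - k) + k) \<le> wt p (d u + k) (d v - k)"
    using p card_P deg_le by (intro wt_majorize) auto
  then show ?thesis
    using True by (simp only: swt_def adj'_u d'_u d'_v if_True) simp
next
  case False
  then show ?thesis by (simp add: swt_def wt_nonneg)
qed

lemma gain_P:
  assumes "j \<in> P"
  shows "gain j = x j * (x u * wt p (d u + k) (d j) - x v * wt p (d v) (d j))"
proof -
  have j: "adj E v j" "\<not> adj E u j" "j \<noteq> u" "j \<noteq> v"
    using P[OF assms] P_neq[OF assms] by auto
  have "adj E' u j" "\<not> adj E' v j" using assms by (simp_all add: adj'_u adj'_v)
  with j show ?thesis
    by (simp add: gain_def swt_def d'_u deg'_other[OF j(3,4)] algebra_simps del: of_nat_add)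
qed

lemma gain_other:
  assumes "j \<notin> P" "j \<noteq> u" "j \<noteq> v"
  shows "gain j = x j * ((if adj E u j then x u * (wt p (d u + k) (d j) - wt p (d u) (d j)) else 0)
    - (if adj E v j then x v * (wt p (d v) (d j) - wt p (d v - k) (d j)) else 0))"
proof -
  have "adj E' u j = adj E u j" "adj E' v j = adj E v j" using assms(1) by (simp_all add: adj'_u adj'_v)
  then show ?thesis
    by (simp add: gain_def swt_def d'_u d'_v deg'_other[OF assms(2,3)] algebra_simps del: of_nat_add)
qed

lemma wt_gain_pos: "wt p (d u + k) c - wt p (d u) c > 0" if "c \<ge> 0" for c
  using wt_strict_mono[of p "d u" "d u + k" c c] p k_pos that by simp

lemma gain_private:
  assumes "adj E u j" "\<not> adj E v j" "j \<noteq> v"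
  shows "gain j > 0"
proof -
  have j: "j \<notin> P" "j \<noteq> u" "j < n"
    using assms P[of j] adj_less(2)[OF simple assms(1)] by auto
  have "gain j = x j * (x u * (wt p (d u + k) (d j) - wt p (d u) (d j)))"
    using gain_other[OF j(1,2) assms(3)] assms by simp
  then show ?thesis using xpos[OF j(3)] xpos[OF u] wt_gain_pos[of "d j"] by simp
qed

text \<open>\<open>v\<close> drops from \<open>d v\<close> to \<open>d v - k\<close> while
  \<open>u\<close> rises from \<open>d u\<close> to \<open>d u + k\<close>. As
  \<open>d v - k \<le> d u\<close>, convexity makes the rise of the weight at least its fall, and
  \<open>x v \<le> x u\<close> preserves this.\<close>

lemma gain_common:
  assumes "adj E u j" "adj E v j"
  shows "gain j \<ge> 0"
proof -
  have j: "j \<notin> P" "j \<noteq> u" "j \<noteq> v" "j < n"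
    using assms P[of j] adj_less(2)[OF simple assms(1)] by auto
  have dj: "d j > 0" using deg_pos[OF simple, of j u] assms adj_commute[of E] by simp
  have "wt p (d v - k + k) (d j) - wt p (d v - k) (d j) \<le> wt p (d u + k) (d j) - wt p (d u) (d j)"
    using p dj card_P deg_le by (intro wt_increment_mono) auto
  moreover have "0 \<le> wt p (d v) (d j) - wt p (d v - k) (d j)"
    using wt_mono[of p "d v - k" "d v" "d j" "d j"] p card_P by simp
  ultimately have "x v * (wt p (d v) (d j) - wt p (d v - k) (d j)) \<le> x u * (wt p (d u + k) (d j) - wt p (d u) (d j))"
    using x_le xpos[OF u] by (intro mult_mono) auto
  then show ?thesis
    using gain_other[OF j(1-3)] assms xpos[OF j(4)] by simp
qed

lemma gain_P_strict:
  assumes "j \<in> P" "deg n E v < deg n E u + card P"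
  shows "gain j > 0"
proof -
  have "wt p (d v) (d j) < wt p (d u + k) (d j)"
    using assms p by (intro wt_strict_mono) auto
  then have "x v * wt p (d v) (d j) < x u * wt p (d u + k) (d j)"
    using x_le xpos[OF u] xpos[OF v] wt_nonneg[of p "d v" "d j"]
    by (intro mult_le_less_imp_less) auto
  then show ?thesis using gain_P[OF assms(1)] xpos[OF P_less[OF assms(1)]] by simp
qed

lemma gain_none:
  assumes "\<not> adj E u j" "\<not> adj E v j" "j \<noteq> u" "j \<noteq> v"
  shows "gain j = 0"
  using assms gain_other[of j] P[of j] by auto

text \<open>The only vertices whose \<open>gain\<close> could be negative are private neighbours of
  \<open>v\<close> outside \<open>P\<close>; \<open>all\<close> says that there are none. Strictness
  comes from any element of \<open>P\<close>.\<close>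

lemma qform_move_all:
  assumes all: "\<And>j. adj E v j \<Longrightarrow> \<not> adj E u j \<Longrightarrow> j \<noteq> u \<Longrightarrow> j \<in> P"
    and less: "deg n E v < deg n E u + card P"
  shows "qform n (swt p n E) x < qform n (swt p n E') x"
proof -
  obtain b where b: "b \<in> P" using P_ne by auto
  have "gain j \<ge> 0" if "j \<in> {..<n} - {u, v}" for j
    using that all[of j] gain_P_strict[of j] gain_private[of j] gain_common[of j] gain_none[of j] less
    by (cases "adj E u j"; cases "adj E v j") auto
  then have "(\<Sum>j\<in>{..<n} - {u, v}. gain j) > 0"
    using gain_P_strict[OF b less] P_less[OF b] P_neq[OF b] by (intro sum_pos2[of _ b]) auto
  moreover have "(swt p n E' u v - swt p n E u v) * x u * x v \<ge> 0"
    using pair_gain xpos[OF u] xpos[OF v] by simp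
  ultimately show ?thesis using qform_move by simp
qed

end

text \<open>The shift goes towards the endpoint with the larger Perron entry; both directions give isomorphic graphs.\<close>

lemma kelmans:
  assumes s: "simple_graph n E" and c: "connected_graph n E" and uv: "u \<noteq> v" and p: "p \<ge> 1"
    and link: "adj E u v \<or> (\<exists>w. adj E u w \<and> adj E v w)"
    and a: "adj E u a" "\<not> adj E v a" "a \<noteq> v" and b: "adj E v b" "\<not> adj E u b" "b \<noteq> u"
  obtains u' v' P where "{u', v'} = {u, v}" "edge_move n E u' v' P"
    "P = {w. adj E v' w \<and> \<not> adj E u' w \<and> w \<noteq> u'}"
    "rhoS p n E < rhoS p n (move_edges E v' u' P)"
proof -
  have n: "u < n" "v < n" "n > 0" using a(1) b(1) adj_less[OF s] by fastforce+
  obtain x where x: "perron p n E x" using perron_exists[OF s c n(3)] .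
  have main: "edge_move n E u' v' P \<and> rhoS p n E < rhoS p n (move_edges E v' u' P)"
    if uv': "u' < n" "v' < n" "u' \<noteq> v'" "x v' \<le> x u'"
      and link': "adj E u' v' \<or> (\<exists>w. adj E u' w \<and> adj E v' w)"
      and a': "adj E u' a'" "\<not> adj E v' a'" "a' \<noteq> v'" and b': "adj E v' b'" "\<not> adj E u' b'" "b' \<noteq> u'"
      and Pd: "P = {w. adj E v' w \<and> \<not> adj E u' w \<and> w \<noteq> u'}" for u' v' a' b' P
  proof -
    interpret edge_move n E u' v' P
      by unfold_locales (use s uv' Pd in auto)
    have Nv: "nbrs n E v' = P \<union> (nbrs n E v' \<inter> (nbrs n E u' \<union> {u'}))"
      unfolding Pd by (auto simp: in_nbrs_iff[OF s])
    define C where "C = nbrs n E v' \<inter> (nbrs n E u' \<union> {u'})"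
    have fC: "finite C" by (simp add: C_def)
    have dv: "deg n E v' = card P + card C"
      unfolding deg_eq_card_nbrs by (subst Nv, fold C_def, rule card_Un_disjoint)
        (use finite_P fC Pd in \<open>auto simp: C_def in_nbrs_iff[OF s]\<close>)
    \<comment> \<open>\<open>C\<close> is what \<open>v'\<close> keeps, so this puts the new degree
      of \<open>u'\<close> above the old degree of \<open>v'\<close>. The private neighbour
      \<open>a'\<close> gives strictness; if the two are adjacent, \<open>u'\<close> in
      \<open>C\<close> is traded for \<open>v'\<close> among the neighbours of
      \<open>u'\<close>.\<close>
    have "card C < deg n E u'"
    proof (cases "adj E u' v'")
      case True
      have "insert v' (C - {u'}) \<subset> nbrs n E u'"
        using True a' by (auto simp: C_def in_nbrs_iff[OF s])
      then have "card (insert v' (C - {u'})) < deg n E u'"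
        unfolding deg_eq_card_nbrs by (intro psubset_card_mono) auto
      moreover have "card (insert v' (C - {u'})) = Suc (card (C - {u'}))"
        using fC by (intro card_insert_disjoint) (auto simp: C_def in_nbrs_iff[OF s])
      moreover have "Suc (card (C - {u'})) = card C"
        using True by (intro card_Suc_Diff1[OF fC]) (simp add: C_def in_nbrs_iff[OF s] adj_commute)
      ultimately show ?thesis by linarith
    next
      case False
      have "C \<subset> nbrs n E u'"
        using False a' adj_commute[of E u' v'] by (auto simp: C_def in_nbrs_iff[OF s])
      then show ?thesis unfolding deg_eq_card_nbrs by (intro psubset_card_mono) auto
    qed
    \<comment> \<open>The link leaves \<open>v'\<close> with a neighbour, as \<open>card_P\<close>
      of \<open>edge_move_gain\<close> demands.\<close>
    moreover have "C \<noteq> {}"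
      using link' adj_commute[of E u' v'] by (auto simp: C_def in_nbrs_iff[OF s])
    moreover have "b' \<in> P" using b' Pd by simp
    ultimately interpret edge_move_gain n E u' v' P p x
      using dv fC p uv' x by unfold_locales (auto simp: perron_def card_gt_0_iff)
    have "qform n (swt p n E) x < qform n (swt p n (move_edges E v' u' P)) x"
      using \<open>card C < _\<close> dv by (intro qform_move_all) (auto simp: Pd)
    from rhoS_less_of_qform[OF x n(3) this] edge_move_axioms show ?thesis by simp
  qed
  show thesis
  proof (cases "x v \<le> x u")
    case True
    note m = main[OF n(1,2) uv True link a b refl]
    show thesis by (rule that[OF refl conjunct1[OF m] refl conjunct2[OF m]])
  next
    case False
    then have le: "x u \<le> x v" by simp
    have link': "adj E v u \<or> (\<exists>w. adj E v w \<and> adj E u w)" using link adj_commute by blast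
    note m = main[OF n(2,1) uv[symmetric] le link' b a refl]
    show thesis by (rule that[OF insert_commute conjunct1[OF m] refl conjunct2[OF m]])
  qed
qed

section \<open>Bicyclic graphs of maximal radius without a dominating vertex\<close>

definition undominated :: "nat \<Rightarrow> nat set set \<Rightarrow> bool" where
  "undominated n E \<longleftrightarrow> bicyclic n E \<and> (\<forall>u<n. \<exists>w<n. w \<noteq> u \<and> \<not> adj E u w)"

text \<open>Only \<open>u\<close> could become adjacent to everything, and \<open>z\<close> prevents
  it. The vertex \<open>v\<close> loses \<open>P\<close>, and an element of \<open>P\<close> that
  gains \<open>u\<close> as a neighbour now misses \<open>v\<close>.\<close>

lemma (in edge_move) undominated':
  assumes un: "undominated n E" and link: "adj E u v \<or> (\<exists>w. adj E u w \<and> adj E v w)"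
    and ne: "P \<noteq> {}" and z: "z < n" "z \<noteq> u" "\<not> adj E u z" "z \<notin> P"
  shows "undominated n E'"
proof -
  have "\<exists>w<n. w \<noteq> i \<and> \<not> adj E' i w" if i: "i < n" for i
  proof -
    consider "i = u" | "i = v" | "i \<noteq> u" "i \<noteq> v" by blast
    then show ?thesis
    proof cases
      case 1
      then show ?thesis using z by (auto simp: adj'_u)
    next
      case 2
      obtain b where "b \<in> P" using ne by auto
      then show ?thesis using 2 P_less[of b] P_neq[of b] adj'_v[of b] by auto
    next
      case 3
      obtain w where w: "w < n" "w \<noteq> i" "\<not> adj E i w"
        using un i by (auto simp: undominated_def)
      show ?thesis
      proof (cases "w = u \<and> i \<in> P")
        case True
        then have "\<not> adj E' i v" using adj'_v[of i] adj_commute[of E' i v] by simp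
        then show ?thesis using v 3 by auto
      next
        case False
        then have "\<not> adj E' i w"
          using w 3 adj'_u[of i] adj'_v[of i] adj'_other[of i w] adj_commute[of E' i w] adj_commute[of E i w]
          by (cases "w = u"; cases "w = v") auto
        then show ?thesis using w by auto
      qed
    qed
  qed
  then show ?thesis using bicyclic'[OF _ link] un by (simp add: undominated_def)
qed

locale extremal =
  fixes n E p
  assumes n: "n \<ge> 6" and p: "p \<ge> (2::real)" and un: "undominated n E"
    and max: "\<And>E'. undominated n E' \<Longrightarrow> rhoS p n E' \<le> rhoS p n E"
begin

lemma simple: "simple_graph n E" and conn: "connected_graph n E"
  and card_E: "card E = n + 1" and fin: "finite E"
  using un simple_graph_finite[of n E] by (auto simp: undominated_def bicyclic_def)

lemma adjD: "adj E u v \<Longrightarrow> u < n" "adj E u v \<Longrightarrow> v < n" "adj E u v \<Longrightarrow> u \<noteq> v" "adj E u v \<Longrightarrow> adj E v u"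
  using adj_less[OF simple] adj_commute[of E u v] by (auto simp: adj_def)

text \<open>The shifted graph has larger radius, so by maximality its receiving vertex must be
  adjacent to all others. Its neighbourhood is the union of the two old ones, and since the other
  centre is never moved, \<open>u\<close> and \<open>v\<close> were adjacent already.\<close>

lemma non_nested:
  assumes uv: "u \<noteq> v" and link: "adj E u v \<or> (\<exists>w. adj E u w \<and> adj E v w)"
    and a: "adj E u a" "\<not> adj E v a" "a \<noteq> v" and b: "adj E v b" "\<not> adj E u b" "b \<noteq> u"
  shows "adj E u v" and "z < n \<Longrightarrow> adj E u z \<or> adj E v z"
proof -
  obtain u' v' P where eq: "{u', v'} = {u, v}" and em: "edge_move n E u' v' P"
    and Pd: "P = {w. adj E v' w \<and> \<not> adj E u' w \<and> w \<noteq> u'}"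
    and less: "rhoS p n E < rhoS p n (move_edges E v' u' P)"
    using kelmans[OF simple conn uv _ link a b, of p] p by auto
  interpret edge_move n E u' v' P by fact
  have uv': "u' = u \<and> v' = v \<or> u' = v \<and> v' = u" using eq by (auto simp: doubleton_eq_iff)
  have P_ne: "P \<noteq> {}" using uv' a b unfolding Pd by blast
  have link': "adj E u' v' \<or> (\<exists>w. adj E u' w \<and> adj E v' w)" using link uv' adjD by blast
  have *: "\<not> (z < n \<and> z \<noteq> u' \<and> \<not> adj E u' z \<and> z \<notin> P)" for z
    using undominated'[OF un link' P_ne] max less by (meson not_le)
  show 1: "adj E u v"
    using *[of v'] uv' v P_neq[of v'] uv adjD(4) by auto
  assume "z < n"
  show "adj E u z \<or> adj E v z"
    using *[of z] \<open>z < n\<close> uv' 1 adjD(4)[OF 1] unfolding Pd by blast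
qed

lemma nested:
  assumes "u \<noteq> v" "\<not> adj E u v" "adj E u w" "adj E v w" "adj E u a" "\<not> adj E v a" "adj E v b"
  shows "adj E u b"
  using non_nested(1)[OF assms(1), of a b] assms adjD by metis

end

section \<open>An edge whose endpoints dominate the graph\<close>

locale extremal_pair = extremal +
  fixes u v
  assumes uv: "adj E u v" and cover: "\<And>z. z < n \<Longrightarrow> adj E u z \<or> adj E v z"
begin

definition "A = {w. adj E u w \<and> \<not> adj E v w \<and> w \<noteq> v}"
definition "B = {w. adj E v w \<and> \<not> adj E u w \<and> w \<noteq> u}"

text \<open>Edges outside the spanning double star with centres \<open>u\<close> and \<open>v\<close>; there are exactly two of them.\<close>

definition "extra a b \<longleftrightarrow> adj E a b \<and> a \<noteq> u \<and> b \<noteq> u \<and> \<not> (a = v \<and> b \<in> B) \<and> \<not> (b = v \<and> a \<in> B)"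

lemma finite_A: "finite A" and finite_B: "finite B"
  by (rule finite_subset[of _ "nbrs n E u"]; auto simp: A_def in_nbrs_iff[OF simple])
     (rule finite_subset[of _ "nbrs n E v"]; auto simp: B_def in_nbrs_iff[OF simple])

lemma card_cover: "deg n E u + card B = n - 1"
proof -
  have "nbrs n E u \<union> B = {..<n} - {u}"
  proof (rule Set.set_eqI)
    fix z
    show "z \<in> nbrs n E u \<union> B \<longleftrightarrow> z \<in> {..<n} - {u}"
      using cover[of z] adjD(2)[of u z] adjD(2)[of v z] adjD(3)[of u z]
      by (auto simp: B_def in_nbrs_iff[OF simple])
  qed
  then have "card (nbrs n E u \<union> B) = n - 1" using adjD(1)[OF uv] by simp
  moreover have "nbrs n E u \<inter> B = {}" by (auto simp: B_def in_nbrs_iff[OF simple])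
  ultimately show ?thesis
    unfolding deg_eq_card_nbrs using finite_B by (simp add: card_Un_disjoint)
qed

lemma no_three_extra:
  assumes "extra a b" "extra c d" "extra e f" "{a, b} \<noteq> {c, d}" "{a, b} \<noteq> {e, f}" "{c, d} \<noteq> {e, f}"
  shows False
proof -
  define T where "T = (\<lambda>w. {u, w}) ` nbrs n E u \<union> (\<lambda>w. {v, w}) ` B"
  have i: "inj_on (\<lambda>w. {z, w}) S" for z :: nat and S
    by (auto simp: inj_on_def doubleton_eq_iff)
  have "(\<lambda>w. {u, w}) ` nbrs n E u \<inter> (\<lambda>w. {v, w}) ` B = {}"
    using adjD(3)[OF uv] by (auto simp: B_def doubleton_eq_iff)
  then have "card T = n - 1"
    unfolding T_def using finite_B card_cover
    by (simp add: card_Un_disjoint card_image[OF i] deg_eq_card_nbrs)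
  moreover have "T \<subseteq> E" by (auto simp: T_def nbrs_def B_def adj_def)
  moreover have "{{a, b}, {c, d}, {e, f}} \<subseteq> E - T"
  proof -
    have "{s, t} \<in> E - T" if "extra s t" for s t
      using that unfolding extra_def T_def adj_def image_iff Un_iff doubleton_eq_iff Diff_iff by blast
    then show ?thesis using assms by blast
  qed
  ultimately have "card {{a, b}, {c, d}, {e, f}} + (n - 1) \<le> n + 1"
    using card_mono[OF _ \<open>T \<subseteq> E\<close>] card_mono[of "E - T" "{{a, b}, {c, d}, {e, f}}"] fin card_E
    by (simp add: card_Diff_subset finite_subset[of T])
  moreover have "card {{a, b}, {c, d}, {e, f}} = 3" using assms by simp
  ultimately show False using n by simp
qed

text \<open>\<open>A2\<close> and \<open>B2\<close> encode that \<open>A\<close> and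
  \<open>B\<close> have at least two elements. A neighbour of \<open>a\<close> outside the
  neighbourhood of \<open>v\<close> forces, by nestedness of the non-adjacent pair \<open>a\<close>,
  \<open>v\<close>, that \<open>a\<close> is adjacent to all of \<open>B\<close>. Then
  \<open>v\<close>, \<open>b1\<close> is a dominating pair, so \<open>b1\<close> meets
  \<open>a2\<close>: three extra edges.\<close>

lemma A_nbr:
  assumes A2: "\<And>a. \<exists>a'\<in>A. a' \<noteq> a" and B2: "\<And>b. \<exists>b'\<in>B. b' \<noteq> b"
    and a: "a \<in> A" and w: "adj E a w"
  shows "adj E v w"
proof (rule ccontr)
  assume nw: "\<not> adj E v w"
  have a': "adj E u a" "\<not> adj E v a" "a \<noteq> v" "a \<noteq> u" using a adjD by (auto simp: A_def)
  have all: "adj E a b" if "b \<in> B" for b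
    using that nested[of a v u w b] a' adjD uv w nw unfolding B_def by blast
  obtain b1 where b1: "b1 \<in> B" using B2 by blast
  obtain b2 where b2: "b2 \<in> B" "b2 \<noteq> b1" using B2 by blast
  obtain a2 where a2: "a2 \<in> A" "a2 \<noteq> a" using A2 by blast
  have b1': "adj E v b1" "\<not> adj E u b1" "b1 \<noteq> u" "b1 \<noteq> v" using b1 adjD by (auto simp: B_def)
  have "adj E v a2 \<or> adj E b1 a2"
    using non_nested(2)[of v b1 u a a2] a' b1' adjD all[OF b1] uv a2 unfolding A_def by blast
  then have "adj E b1 a2" using a2 by (simp add: A_def)
  then have "extra b1 a2" "extra a b1" "extra a b2"
    using all[OF b1] all[OF b2(1)] a' b1' a2 b2 adjD by (auto simp: extra_def A_def B_def)
  then show False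
    using no_three_extra[of b1 a2 a b1 a b2] a' a2 b1 b2 by (auto simp: doubleton_eq_iff A_def B_def)
qed

end

lemma (in extremal_pair) swap: "extremal_pair n E p v u"
  using uv cover adjD by unfold_locales blast+

lemma (in extremal_pair) swap_sets: "extremal_pair.A E v u = B" "extremal_pair.B E v u = A"
proof -
  interpret s: extremal_pair n E p v u by (rule swap)
  show "s.A = B" "s.B = A" by (auto simp: s.A_def s.B_def A_def B_def)
qed

context extremal_pair
begin

lemma B_nbr:
  assumes A2: "\<And>a. \<exists>a'\<in>A. a' \<noteq> a" and B2: "\<And>b. \<exists>b'\<in>B. b' \<noteq> b"
    and "b \<in> B" "adj E b w"
  shows "adj E u w"
  using extremal_pair.A_nbr[OF swap, unfolded swap_sets] assms by blast

text \<open>An edge \<open>a b\<close> would be a dominating pair, since \<open>u\<close> is private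
  to \<open>a\<close> and \<open>v\<close> to \<open>b\<close>. \<open>A_nbr\<close> and
  \<open>B_nbr\<close> then force \<open>a2\<close> to be adjacent to \<open>b\<close>, and
  \<open>b2\<close> to \<open>a\<close>, which again makes three extra edges.\<close>

lemma A_B_nonadj:
  assumes A2: "\<And>a. \<exists>a'\<in>A. a' \<noteq> a" and B2: "\<And>b. \<exists>b'\<in>B. b' \<noteq> b"
    and a: "a \<in> A" and b: "b \<in> B"
  shows "\<not> adj E a b"
proof
  assume ab: "adj E a b"
  obtain a2 where a2: "a2 \<in> A" "a2 \<noteq> a" using A2 by blast
  obtain b2 where b2: "b2 \<in> B" "b2 \<noteq> b" using B2 by blast
  have a': "adj E u a" "\<not> adj E v a" "a \<noteq> v" "a \<noteq> u" using a adjD by (auto simp: A_def)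
  have b': "adj E v b" "\<not> adj E u b" "b \<noteq> u" "b \<noteq> v" using b adjD by (auto simp: B_def)
  have cov: "adj E a z \<or> adj E b z" if "z < n" for z
    using non_nested(2)[of a b u v z] a' b' ab adjD that by blast
  have a2': "adj E u a2" "\<not> adj E v a2" "a2 \<noteq> v" "a2 \<noteq> u" using a2 adjD by (auto simp: A_def)
  have b2': "adj E v b2" "\<not> adj E u b2" "b2 \<noteq> u" "b2 \<noteq> v" using b2 adjD by (auto simp: B_def)
  have "adj E b a2" using cov[of a2] A_nbr[OF A2 B2 a, of a2] a2' adjD by blast
  moreover have "adj E a b2" using cov[of b2] B_nbr[OF A2 B2 b, of b2] b2' adjD by blast
  ultimately have "extra b a2" "extra a b2" "extra a b"
    using ab a' b' a2' b2' by (auto simp: extra_def)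
  then show False
    using no_three_extra[of b a2 a b2 a b] a' b' a2 b2 by (auto simp: doubleton_eq_iff A_def B_def)
qed

text \<open>The star assigns a common neighbour \<open>c\<close> to \<open>u\<close>, so
  \<open>v c\<close> is already extra, and so would be \<open>a c\<close>. This leaves no edge from
  \<open>c\<close> to \<open>B\<close>; then \<open>v\<close>, \<open>c\<close> is a dominating pair
  and \<open>c a2\<close> is a third extra edge.\<close>

lemma A_common_nonadj:
  assumes A2: "\<And>a. \<exists>a'\<in>A. a' \<noteq> a" and B2: "\<And>b. \<exists>b'\<in>B. b' \<noteq> b"
    and a: "a \<in> A" and c: "adj E u c" "adj E v c"
  shows "\<not> adj E a c"
proof
  assume ac: "adj E a c"
  obtain a2 where a2: "a2 \<in> A" "a2 \<noteq> a" using A2 by blast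
  have a': "adj E u a" "\<not> adj E v a" "a \<noteq> v" "a \<noteq> u" using a adjD by (auto simp: A_def)
  have c': "c \<noteq> u" "c \<noteq> v" "c \<notin> A" "c \<notin> B" using c adjD by (auto simp: A_def B_def)
  have ex: "extra a c" "extra v c" using ac c c' a' adjD(3)[OF uv] by (auto simp: extra_def)
  obtain b1 where b1: "b1 \<in> B" using B2 by blast
  obtain b2 where b2: "b2 \<in> B" "b2 \<noteq> b1" using B2 by blast
  obtain b where b: "b \<in> B" "\<not> adj E c b"
  proof (cases "adj E c b1")
    case True
    then have "extra c b1" using c' b1 adjD by (auto simp: extra_def B_def)
    then have False
      using no_three_extra[of a c v c c b1] ex a a' b1 c' adjD(3)
      by (auto simp: doubleton_eq_iff A_def B_def)
    then show ?thesis ..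
  qed (use b1 that in blast)
  have b': "adj E v b" "\<not> adj E u b" "b \<noteq> u" "b \<noteq> c" using b c by (auto simp: B_def)
  have "adj E c a2 \<or> adj E v a2"
    using non_nested(2)[of c v a b a2] a' b' b c c' ac adjD a2 unfolding A_def by blast
  then have "adj E c a2" using a2 by (simp add: A_def)
  then have "extra c a2" using c' a2 adjD by (auto simp: extra_def A_def)
  then show False
    using no_three_extra[of a c v c c a2] ex a a' a2 c' by (auto simp: doubleton_eq_iff A_def)
qed

lemma A_pendant:
  assumes A2: "\<And>a. \<exists>a'\<in>A. a' \<noteq> a" and B2: "\<And>b. \<exists>b'\<in>B. b' \<noteq> b" and a: "a \<in> A"
  shows "nbrs n E a = {u}"
proof -
  have "w = u" if w: "adj E a w" for w
    using A_nbr[OF A2 B2 a w] A_B_nonadj[OF A2 B2 a, of w] A_common_nonadj[OF A2 B2 a, of w] w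
    unfolding B_def by blast
  moreover have "adj E a u" using a adjD by (simp add: A_def)
  ultimately show ?thesis using in_nbrs_iff[OF simple, of _ a] by blast
qed

lemma B_pendant:
  assumes A2: "\<And>a. \<exists>a'\<in>A. a' \<noteq> a" and B2: "\<And>b. \<exists>b'\<in>B. b' \<noteq> b" and "b \<in> B"
  shows "nbrs n E b = {v}"
  by (rule extremal_pair.A_pendant[OF swap, unfolded swap_sets, OF B2 A2 assms(3)])

end

section \<open>Splitting the edge set into a star and the edges off its centre\<close>

definition spokes :: "nat \<Rightarrow> nat set \<Rightarrow> nat set set" where
  "spokes u W = (\<lambda>w. {u, w}) ` W"

lemma card_spokes: "card (spokes u W) = card W"
  unfolding spokes_def by (rule card_image) (auto simp: inj_on_def doubleton_eq_iff)

lemma finite_spokes: "finite W \<Longrightarrow> finite (spokes u W)"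
  by (simp add: spokes_def)

lemma doubleton_in_spokes_iff: "{a, b} \<in> spokes u W \<longleftrightarrow> a = u \<and> b \<in> W \<or> b = u \<and> a \<in> W"
  unfolding spokes_def image_iff doubleton_eq_iff by blast

lemma edges_at_vertex:
  assumes "simple_graph n E"
  shows "{e \<in> E. u \<in> e} = spokes u (nbrs n E u)"
proof (rule Set.set_eqI)
  fix e
  show "e \<in> {e \<in> E. u \<in> e} \<longleftrightarrow> e \<in> spokes u (nbrs n E u)"
  proof
    assume "e \<in> {e \<in> E. u \<in> e}"
    then obtain a b where "e = {a, b}" "adj E a b" "u = a \<or> u = b"
      using simple_graph_edgeE[OF assms, of e] by blast
    then show "e \<in> spokes u (nbrs n E u)"
      using adj_commute[of E a b] by (auto simp: doubleton_in_spokes_iff in_nbrs_iff[OF assms])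
  next
    assume "e \<in> spokes u (nbrs n E u)"
    then show "e \<in> {e \<in> E. u \<in> e}" by (auto simp: spokes_def nbrs_def adj_def)
  qed
qed

lemma card_edges_off_vertex:
  assumes "simple_graph n E"
  shows "card E = deg n E u + card {e \<in> E. u \<notin> e}"
proof -
  have "E = {e \<in> E. u \<in> e} \<union> {e \<in> E. u \<notin> e}" by blast
  then have "card E = card {e \<in> E. u \<in> e} + card {e \<in> E. u \<notin> e}"
    using simple_graph_finite[OF assms] by (metis (no_types, lifting) card_Un_disjoint disjoint_iff finite_Un mem_Collect_eq)
  then show ?thesis by (simp add: edges_at_vertex[OF assms] card_spokes deg_eq_card_nbrs)
qed

context extremal_pair
begin

text \<open>Moving all of \<open>B\<close> would make \<open>u\<close> adjacent to everything, so
  one vertex \<open>y\<close> of \<open>B\<close> stays behind. Its edge to \<open>v\<close> is the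
  only one among those from \<open>u\<close> and \<open>v\<close> to third vertices whose
  contribution falls without a compensating edge at the same vertex.\<close>

lemma no_pendant_shift:
  assumes A2: "\<And>a. \<exists>a'\<in>A. a' \<noteq> a" and B2: "\<And>b. \<exists>b'\<in>B. b' \<noteq> b"
    and x: "perron p n E x" and le: "x v \<le> x u"
  shows False
proof -
  obtain y where y: "y \<in> B" using B2 by blast
  obtain y2 where y2: "y2 \<in> B" "y2 \<noteq> y" using B2 by blast
  obtain a where a: "a \<in> A" using A2 by blast
  define P where "P = B - {y}"
  have B': "adj E v b \<and> \<not> adj E u b \<and> b \<noteq> u \<and> b \<noteq> v \<and> b < n" if "b \<in> B" for b
    using that adjD by (auto simp: B_def)
  have sw: "deg n E u + card B = n - 1" "deg n E v + card A = n - 1"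
    using card_cover extremal_pair.card_cover[OF swap] by (simp_all add: swap_sets)
  have cP: "card B = Suc (card P)" using y finite_B unfolding P_def by (simp only: card_Suc_Diff1)
  have "\<not> is_singleton A" using A2[of "the_elem A"] by (auto simp: is_singleton_def)
  then have cA: "card A \<ge> 2"
    using a card_0_eq[OF finite_A] unfolding is_singleton_altdef by (cases "card A = 0") auto
  \<comment> \<open>After the move \<open>u\<close> has degree \<open>n - 2\<close>, while
    \<open>v\<close> had degree \<open>n - 1 - card A \<le> n - 3\<close>.\<close>
  have v_less: "deg n E v + 1 \<le> deg n E u + card P" using sw cP cA n by linarith
  have cPv: "card P < deg n E v"
  proof -
    have "B \<subseteq> nbrs n E v" "u \<in> nbrs n E v" "u \<notin> B"
      using adjD(4)[OF uv] by (auto simp: B_def in_nbrs_iff[OF simple])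
    then have "B \<subset> nbrs n E v" by blast
    then have "card B < deg n E v"
      unfolding deg_eq_card_nbrs by (rule psubset_card_mono[OF finite_nbrs])
    then show ?thesis using cP by simp
  qed
  interpret em: edge_move n E u v P
    using simple adjD(1-3)[OF uv] B' by unfold_locales (auto simp: P_def)
  have P_ne: "P \<noteq> {}" using y2 by (auto simp: P_def)
  interpret g: edge_move_gain n E u v P p x
    using p x le v_less cPv P_ne by unfold_locales (auto simp: perron_def)
  have A': "adj E u w \<and> \<not> adj E v w \<and> w \<noteq> v \<and> w \<noteq> u \<and> w < n" if "w \<in> A" for w
    using that adjD by (auto simp: A_def)
  have degB: "deg n E b = 1" and xB: "rhoS p n E * x b = wt p 1 (deg n E v) * x v" if "b \<in> B" for b
  proof -
    show 1: "deg n E b = 1" by (simp add: deg_eq_card_nbrs B_pendant[OF A2 B2 that])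
    show "rhoS p n E * x b = wt p 1 (deg n E v) * x v"
      using perron_nbrs[OF x, of b] B'[OF that] 1 by (simp add: B_pendant[OF A2 B2 that])
  qed
  have rho: "rhoS p n E > 0" by (rule rhoS_pos[OF x uv simple])
  \<comment> \<open>All of \<open>B\<close> are pendant at \<open>v\<close> and satisfy the same
    eigenvalue equation.\<close>
  have xB': "x b = x y" if "b \<in> B" for b
    using xB[OF that] xB[OF y] rho by (metis less_irrefl mult_left_cancel)
  have xpos: "x v > 0" "x y > 0" "x u > 0" using g.xpos B'[OF y] adjD(1,2)[OF uv] by auto
  have nn: "g.gain j \<ge> 0" if "j < n" "j \<noteq> u" "j \<noteq> v" "j \<noteq> y" for j
    using g.gain_P_strict[of j] g.gain_private[of j] g.gain_common[of j] g.gain_none[of j] v_less that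
    unfolding P_def B_def by (cases "adj E u j"; cases "adj E v j") (auto simp: less_imp_le)
  define \<delta> where "\<delta> = wt p (real (deg n E v) + 1) 1 - wt p (deg n E v) 1"
  text \<open>
    By convexity the loss on the edge \<open>v y\<close>, which spans \<open>card P\<close> increments of the weight, is
    compensated by the moved edges, each of which gains at least the next increment.
  \<close>
  have gP: "g.gain j \<ge> x y * x v * \<delta>" if j: "j \<in> P" for j
  proof -
    have "wt p (real (deg n E v) + 1) 1 \<le> wt p (real (deg n E u) + real (card P)) 1"
      using v_less p by (intro wt_mono) auto
    then have "x v * wt p (real (deg n E v) + 1) 1 \<le> x u * wt p (real (deg n E u) + real (card P)) 1"
      using le xpos by (intro mult_mono) (auto simp: wt_nonneg)
    then have "x v * \<delta> \<le> x u * wt p (real (deg n E u) + real (card P)) 1 - x v * wt p (deg n E v) 1"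
      by (simp add: \<delta>_def algebra_simps)
    then have "x y * (x v * \<delta>) \<le> x y * (x u * wt p (real (deg n E u) + real (card P)) 1 - x v * wt p (deg n E v) 1)"
      using xpos by (intro mult_left_mono) auto
    moreover have "j \<in> B" using j by (simp add: P_def)
    ultimately show ?thesis
      using g.gain_P[OF j] degB[of j] xB'[of j] by (simp add: mult.assoc)
  qed
  have gy: "g.gain y \<ge> - (real (card P) * (x y * x v * \<delta>))"
  proof -
    have "g.gain y = - (x y * x v * (wt p (deg n E v) 1 - wt p (real (deg n E v - card P)) 1))"
      using g.gain_other[of y] B'[OF y] degB[OF y] cPv by (auto simp: P_def of_nat_diff)
    moreover have "x y * x v * (wt p (deg n E v) 1 - wt p (real (deg n E v - card P)) 1)
        \<le> x y * x v * (real (card P) * \<delta>)"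
      unfolding \<delta>_def using xpos p wt_slope[of p 1 "card P" "deg n E v"] cPv
      by (intro mult_left_mono) auto
    ultimately show ?thesis by (simp add: mult_ac)
  qed
  have ga: "g.gain a > 0" using g.gain_private[of a] A'[OF a] by blast
  have fP: "finite P" using finite_B by (simp add: P_def)
  have "a \<notin> insert y P" "y \<notin> P" using a y by (auto simp: A_def B_def P_def)
  then have "(\<Sum>j\<in>insert a (insert y P). g.gain j) = g.gain a + g.gain y + (\<Sum>j\<in>P. g.gain j)"
    using fP by simp
  moreover have "(\<Sum>j\<in>P. g.gain j) \<ge> real (card P) * (x y * x v * \<delta>)"
    using sum_bounded_below[of P "x y * x v * \<delta>" g.gain] gP by simp
  ultimately have "(\<Sum>j\<in>insert a (insert y P). g.gain j) > 0" using ga gy by linarith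
  also have "(\<Sum>j\<in>insert a (insert y P). g.gain j) \<le> (\<Sum>j\<in>{..<n} - {u, v}. g.gain j)"
  proof (rule sum_mono2)
    show "insert a (insert y P) \<subseteq> {..<n} - {u, v}"
      using A'[OF a] B' y by (auto simp: P_def)
  qed (use nn in auto)
  finally have "qform n (swt p n E) x < qform n (swt p n (move_edges E v u P)) x"
  proof -
    assume pos: "0 < (\<Sum>j\<in>{..<n} - {u, v}. g.gain j)"
    have "0 \<le> (swt p n (move_edges E v u P) u v - swt p n E u v) * x u * x v"
      using g.pair_gain xpos by simp
    with pos have "0 < qform n (swt p n (move_edges E v u P)) x - qform n (swt p n E) x"
      unfolding g.qform_move by (intro mult_pos_pos add_nonneg_pos) auto
    then show ?thesis by simp
  qed
  then have "rhoS p n E < rhoS p n (move_edges E v u P)"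
    using rhoS_less_of_qform[OF x] n by simp
  moreover have "undominated n (move_edges E v u P)"
    using em.undominated'[OF un _ P_ne, of y] uv B'[OF y] by (auto simp: P_def)
  ultimately show False using max by (meson not_le)
qed

lemma single_private: "(\<exists>a. A \<subseteq> {a}) \<or> (\<exists>b. B \<subseteq> {b})"
proof (rule ccontr)
  assume "\<not> ?thesis"
  then have A2: "\<And>a. \<exists>a'\<in>A. a' \<noteq> a" and B2: "\<And>b. \<exists>b'\<in>B. b' \<noteq> b" by blast+
  obtain x where x: "perron p n E x" using perron_exists[OF simple conn] n by auto
  show False
  proof (cases "x v \<le> x u")
    case True
    then show ?thesis using no_pendant_shift[OF A2 B2 x] by blast
  next
    case False
    then have "x u \<le> x v" by simp
    then show ?thesis
      using extremal_pair.no_pendant_shift[OF swap, unfolded swap_sets, OF B2 A2 x] by blast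
  qed
qed

end

text \<open>Start from a vertex \<open>u\<close> of maximal degree and a path \<open>u v y\<close>
  to a non-neighbour. Maximality of the degree makes \<open>u\<close>, \<open>v\<close> non-nested,
  hence a dominating pair, and by \<open>single_private\<close> one of the two misses just one
  vertex.\<close>

lemma (in extremal) almost_dominating:
  obtains u y where "u < n" "y < n" "y \<noteq> u" "\<not> adj E u y"
    "\<And>z. z < n \<Longrightarrow> z \<noteq> u \<Longrightarrow> z \<noteq> y \<Longrightarrow> adj E u z"
proof -
  have "Max (deg n E ` {..<n}) \<in> deg n E ` {..<n}"
    using n by (intro Max_in) (auto simp: lessThan_empty_iff)
  then obtain u where u: "u < n" "deg n E u = Max (deg n E ` {..<n})" by auto
  have mx: "deg n E w \<le> deg n E u" if "w < n" for w
    unfolding u(2) using that by (intro Max_ge) auto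
  obtain w where w: "w < n" "w \<noteq> u" "\<not> adj E u w" using un u by (auto simp: undominated_def)
  have "\<exists>v y. adj E u v \<and> adj E v y \<and> y \<noteq> u \<and> \<not> adj E u y"
  proof (rule ccontr)
    assume no: "\<not> ?thesis"
    have "(u, w) \<in> {(x, y). adj E x y}\<^sup>*" using conn u w by (auto simp: connected_graph_def)
    then have "w = u \<or> adj E u w" using no by (induction) (simp, blast)
    then show False using w by simp
  qed
  then obtain v y where vy: "adj E u v" "adj E v y" "y \<noteq> u" "\<not> adj E u y" by blast
  \<comment> \<open>Otherwise \<open>v\<close> is adjacent to \<open>u\<close>, to \<open>y\<close>
    and to every other neighbour of \<open>u\<close>, so its degree exceeds that of
    \<open>u\<close>.\<close>
  have "\<exists>a. adj E u a \<and> \<not> adj E v a \<and> a \<noteq> v"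
  proof (rule ccontr)
    assume "\<not> ?thesis"
    then have "insert u (insert y (nbrs n E u - {v})) \<subseteq> nbrs n E v"
      using vy adjD by (auto simp: in_nbrs_iff[OF simple])
    then have "card (insert u (insert y (nbrs n E u - {v}))) \<le> deg n E v"
      unfolding deg_eq_card_nbrs by (intro card_mono) auto
    moreover have "card (insert u (insert y (nbrs n E u - {v}))) = Suc (Suc (card (nbrs n E u - {v})))"
      using vy by (simp add: in_nbrs_iff[OF simple])
    moreover have "Suc (card (nbrs n E u - {v})) = deg n E u"
      unfolding deg_eq_card_nbrs using vy by (intro card_Suc_Diff1) (auto simp: in_nbrs_iff[OF simple])
    moreover have "deg n E v \<le> deg n E u" using mx adjD vy by blast
    ultimately show False by linarith
  qed
  then obtain a where a: "adj E u a" "\<not> adj E v a" "a \<noteq> v" by blast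
  note cov = non_nested(2)[OF adjD(3)[OF vy(1)] disjI1[OF vy(1)] a vy(2,4,3)]
  interpret extremal_pair n E p u v using vy(1) cov by unfold_locales
  show thesis using single_private
  proof (elim disjE exE)
    fix a' assume "A \<subseteq> {a'}"
    then have *: "adj E v z" if "z < n" "z \<noteq> v" "z \<noteq> a" for z
      using that a cov[of z] unfolding A_def by blast
    show thesis
      by (rule that[of v a]) (use * adjD[OF vy(1)] adjD[OF a(1)] a in auto)
  next
    fix b assume "B \<subseteq> {b}"
    then have *: "adj E u z" if "z < n" "z \<noteq> u" "z \<noteq> y" for z
      using that vy cov[of z] unfolding B_def by blast
    show thesis
      by (rule that[of u y]) (use * adjD[OF vy(1)] adjD[OF vy(2)] vy in auto)
  qed
qed

section \<open>A centre of degree \<open>n - 2\<close>: the three remaining edges\<close>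

locale extremal_star = extremal +
  fixes u y
  assumes u: "u < n" and y: "y < n" "y \<noteq> u" "\<not> adj E u y"
    and all: "\<And>z. z < n \<Longrightarrow> z \<noteq> u \<Longrightarrow> z \<noteq> y \<Longrightarrow> adj E u z"
begin

lemma nbrs_u: "nbrs n E u = {..<n} - {u, y}"
proof (rule Set.set_eqI)
  fix z
  show "z \<in> nbrs n E u \<longleftrightarrow> z \<in> {..<n} - {u, y}"
    using all[of z] y adjD(2,3)[of u z] by (auto simp: in_nbrs_iff[OF simple])
qed

definition "F = {e \<in> E. u \<notin> e}"

lemma card_F: "card F = 3"
proof -
  have "deg n E u = n - 2"
    unfolding deg_eq_card_nbrs nbrs_u using u y by simp
  then show ?thesis
    using card_edges_off_vertex[OF simple, of u] card_E n by (simp add: F_def)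
qed

lemma finite_F: "finite F"
  using fin by (simp add: F_def)

lemma in_F_iff: "{a, b} \<in> F \<longleftrightarrow> a \<noteq> u \<and> b \<noteq> u \<and> {a, b} \<in> E"
  by (auto simp: F_def)

lemma adj_F: "adj E a b \<Longrightarrow> a \<noteq> u \<Longrightarrow> b \<noteq> u \<Longrightarrow> {a, b} \<in> F"
  by (simp add: in_F_iff adj_def)

lemma E_eq: "E = spokes u ({..<n} - {u, y}) \<union> F"
  using edges_at_vertex[OF simple, of u] unfolding nbrs_u F_def by blast

lemma F_subset_card:
  assumes "S \<subseteq> F" shows "card S \<le> 3" "card S = 3 \<Longrightarrow> F = S"
  using card_mono[OF finite_F assms] card_subset_eq[OF finite_F assms] card_F by auto

text \<open>Besides \<open>s t\<close>, each of the at least three vertices other than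
  \<open>u\<close>, \<open>s\<close>, \<open>t\<close> would need its own edge to \<open>s\<close>
  or \<open>t\<close>. That is four edges off \<open>u\<close>, but \<open>F\<close> has
  three.\<close>

lemma no_cover:
  assumes st: "adj E s t" "s \<noteq> u" "t \<noteq> u"
  shows "\<exists>z<n. \<not> adj E s z \<and> \<not> adj E t z"
proof (rule ccontr)
  assume "\<not> ?thesis"
  then have cov: "\<And>z. z < n \<Longrightarrow> adj E s z \<or> adj E t z" by blast
  have "card ({..<n} - {u, s, t}) \<ge> 3"
    using n adjD[OF st(1)] u st by (simp add: card_Diff_subset)
  then obtain Z where Z: "Z \<subseteq> {..<n} - {u, s, t}" "card Z = 3" "finite Z"
    using obtain_subset_with_card_n by (metis (no_types, lifting))
  define g where "g z = (if adj E s z then {s, z} else {t, z})" for z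
  have g: "g z \<in> F - {{s, t}}" if "z \<in> Z" for z
    using that Z(1) cov[of z] st adj_F[of s z] adj_F[of t z] by (auto simp: g_def doubleton_eq_iff)
  have "inj_on g Z"
    using Z(1) unfolding g_def inj_on_def by (auto simp: doubleton_eq_iff split: if_splits)
  then have "card (insert {s, t} (g ` Z)) = 4"
    using Z g by (subst card_insert_disjoint) (auto simp: card_image)
  moreover have "insert {s, t} (g ` Z) \<subseteq> F" using g adj_F[OF st] by blast
  ultimately show False using F_subset_card(1)[of "insert {s, t} (g ` Z)"] by linarith
qed

text \<open>By \<open>no_cover\<close> the dominating-pair alternative of \<open>non_nested\<close>
  cannot occur away from \<open>u\<close>, so the neighbourhoods must be nested.\<close>

lemma nested_off_u:
  assumes "s \<noteq> t" "s \<noteq> u" "t \<noteq> u" and link: "adj E s t \<or> adj E u s \<and> adj E u t"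
    and "adj E s a" "\<not> adj E t a" "a \<noteq> t" "adj E t b" "b \<noteq> s"
  shows "adj E s b"
proof (rule ccontr)
  assume nb: "\<not> adj E s b"
  have link': "adj E s t \<or> (\<exists>w. adj E s w \<and> adj E t w)" using link adjD(4) by blast
  note nn = non_nested[OF assms(1) link' assms(5-7) assms(8) nb assms(9)]
  show False using no_cover[OF nn(1) assms(2,3)] nn(2) by blast
qed

lemma y_nbr: obtains v where "adj E y v"
proof -
  have "(y, u) \<in> {(x, y). adj E x y}\<^sup>*" using conn u y by (auto simp: connected_graph_def)
  then show thesis using y(2) that by (cases rule: converse_rtranclE) auto
qed

text \<open>\<open>u\<close> is a neighbour of \<open>v\<close> but not of \<open>y\<close>, so
  nestedness hands the neighbours of \<open>y\<close> other than \<open>v\<close> on to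
  \<open>v\<close>.\<close>

lemma y_clique:
  assumes "adj E y v" "adj E y w" "v \<noteq> w"
  shows "adj E v w"
proof -
  have "v \<noteq> u" "adj E u v" using assms(1) y adjD all by blast+
  then show ?thesis
    using nested_off_u[of v y u w] assms y adjD by blast
qed

text \<open>If \<open>y\<close> has two neighbours, they form a triangle with it and use up
  \<open>F\<close>. If \<open>v\<close> is its only neighbour, every edge of \<open>F\<close>
  contains \<open>v\<close>: an edge \<open>a b\<close> missing \<open>v\<close> would come with
  \<open>v a\<close>, \<open>v b\<close> and \<open>v y\<close>. The first case of the conclusion is
  the shape of \<open>B3\<close>.\<close>

lemma edge_structure:
  obtains v s t where "distinct [u, v, s, t, y]" "v < n" "s < n" "t < n"
      "E = spokes u ({..<n} - {u, y}) \<union> {{v, s}, {v, t}, {v, y}}"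
    | v w where "distinct [u, v, w, y]" "v < n" "w < n"
      "E = spokes u ({..<n} - {u, y}) \<union> {{v, w}, {v, y}, {w, y}}"
proof -
  obtain v where v: "adj E y v" by (rule y_nbr)
  have v': "v < n" "v \<noteq> u" "v \<noteq> y" "adj E v y" "adj E u v"
    using v adjD y all[of v] by blast+
  show thesis
  proof (cases "\<exists>w. adj E y w \<and> w \<noteq> v")
    case True
    then obtain w where w: "adj E y w" "w \<noteq> v" by blast
    have w': "w < n" "w \<noteq> u" "w \<noteq> y" "adj E w y" using w adjD y by blast+
    have vw: "adj E v w" by (rule y_clique[OF v w(1) w(2)[symmetric]])
    have "{{v, w}, {v, y}, {w, y}} \<subseteq> F"
      using vw v' w' y adj_F by simp
    moreover have "card {{v, w}, {v, y}, {w, y}} = 3"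
      using v' w w' by (auto simp: doubleton_eq_iff card_insert_if)
    ultimately have "F = {{v, w}, {v, y}, {w, y}}" by (rule F_subset_card(2))
    with E_eq have "E = spokes u ({..<n} - {u, y}) \<union> {{v, w}, {v, y}, {w, y}}" by simp
    then show thesis using that(2)[of v w] v' w w' y by simp
  next
    case False
    then have only: "w = v" if "adj E y w" for w using that by blast
    have cont: "v \<in> e" if e: "e \<in> F" for e
    proof (rule ccontr)
      assume ve: "v \<notin> e"
      obtain a b where ab: "e = {a, b}" "adj E a b"
        using simple_graph_edgeE[OF simple, of e] e unfolding F_def by blast
      have ab': "a \<noteq> u" "b \<noteq> u" "a \<noteq> v" "b \<noteq> v" using ab e ve by (auto simp: F_def)
      have aby: "a \<noteq> y" "b \<noteq> y" using only[of b] only[of a] ab ab' adjD by blast+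
      \<comment> \<open>\<open>y\<close> is adjacent to \<open>v\<close> and not to
        \<open>s\<close>, so by nestedness the neighbours of \<open>s\<close> pass to
        \<open>v\<close>.\<close>
      have vs: "adj E v t" if "adj E s t" "s \<noteq> u" "s \<noteq> v" "s \<noteq> y" "t \<noteq> v" for s t
      proof -
        have "adj E u s" using that all adjD by blast
        moreover have "\<not> adj E s y" using only[of s] that adjD by blast
        ultimately show ?thesis
          using nested_off_u[of v s y t] that v' y by blast
      qed
      have "adj E v b" "adj E v a" using vs[of a b] vs[of b a] ab ab' aby adjD by blast+
      then have "{{v, y}, {v, a}, {v, b}, {a, b}} \<subseteq> F"
        using ab ab' v' y adj_F by simp
      moreover have "card {{v, y}, {v, a}, {v, b}, {a, b}} = 4"
        using ab' aby v' adjD(3)[OF ab(2)] by (auto simp: doubleton_eq_iff card_insert_if)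
      ultimately show False using F_subset_card(1)[of "{{v, y}, {v, a}, {v, b}, {a, b}}"] by linarith
    qed
    have vyF: "{v, y} \<in> F" using adj_F v' y by simp
    then have "card (F - {{v, y}}) = 2" using card_F finite_F by simp
    then obtain e1 e2 where e: "F - {{v, y}} = {e1, e2}" "e1 \<noteq> e2" by (auto simp: card_2_iff)
    have other: "\<exists>s. e = {v, s} \<and> s < n \<and> s \<noteq> u \<and> s \<noteq> v" if eF: "e \<in> F" for e
    proof -
      obtain a b where "e = {a, b}" "a < n" "b < n" "a \<noteq> b"
        using simple_graph_edgeE[OF simple, of e] eF unfolding F_def by blast
      moreover have "v \<in> e" "u \<notin> e" using cont eF by (auto simp: F_def)
      ultimately show ?thesis by auto
    qed
    have "e1 \<in> F" "e2 \<in> F" "e1 \<noteq> {v, y}" "e2 \<noteq> {v, y}" using e(1) by blast+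
    obtain s where s: "e1 = {v, s}" "s < n" "s \<noteq> u" "s \<noteq> v" using other[OF \<open>e1 \<in> F\<close>] by blast
    obtain t where t: "e2 = {v, t}" "t < n" "t \<noteq> u" "t \<noteq> v" using other[OF \<open>e2 \<in> F\<close>] by blast
    have st: "s \<noteq> t" "s \<noteq> y" "t \<noteq> y" using \<open>e1 \<noteq> {v, y}\<close> \<open>e2 \<noteq> {v, y}\<close> e(2) s(1) t(1) by blast+
    have "F = insert {v, y} (F - {{v, y}})" using vyF by blast
    then have "F = {{v, s}, {v, t}, {v, y}}" unfolding e(1) s(1) t(1) by (simp add: insert_commute)
    with E_eq have "E = spokes u ({..<n} - {u, y}) \<union> {{v, s}, {v, t}, {v, y}}" by simp
    then show thesis using that(1)[of v s t] v' s t st y by simp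
  qed
qed

end

section \<open>The graphs \<open>B\<^sub>1\<close>, \<open>B\<^sub>2\<close>, \<open>B\<^sub>3\<close>\<close>

text \<open>Produces relabellings with prescribed values. Each step composes with the transposition
  that corrects the image of the head; it fixes the images of the remaining entries.\<close>

lemma bij_betw_extend:
  fixes xs ys :: "nat list"
  assumes "distinct xs" "distinct ys" "length xs = length ys" "set xs \<subseteq> {0..<n}" "set ys \<subseteq> {0..<n}"
  shows "\<exists>f. bij_betw f {0..<n} {0..<n} \<and> map f xs = ys"
  using assms
proof (induction xs arbitrary: ys)
  case Nil
  then show ?case by (intro exI[of _ id]) (simp add: bij_betw_def)
next
  case (Cons x xs)
  then obtain y ys' where ys: "ys = y # ys'" by (cases ys) auto
  obtain f where f: "bij_betw f {0..<n} {0..<n}" "map f xs = ys'"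
    using Cons.IH[of ys'] Cons.prems by (auto simp: ys)
  define g where "g = transpose (f x) y \<circ> f"
  have fx: "f x < n" using bij_betwE[OF f(1)] Cons.prems by auto
  have y: "y < n" using Cons.prems by (simp add: ys)
  have "transpose (f x) y ` {0..<n} = {0..<n}"
    by (rule transpose_image_eq) (use fx y in auto)
  then have "bij_betw (transpose (f x) y) {0..<n} {0..<n}"
    by (auto simp: bij_betw_def intro: inj_on_subset[OF bij_is_inj[OF bij_transpose]])
  then have "bij_betw g {0..<n} {0..<n}"
    unfolding g_def by (rule bij_betw_trans[OF f(1)])
  moreover have *: "g z = f z" if z: "z \<in> set xs" for z
  proof -
    have "f z \<in> set ys'" using z f(2) by auto
    then have "f z \<noteq> y" using Cons.prems by (auto simp: ys)
    moreover have "f z \<noteq> f x"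
    proof -
      have "z \<noteq> x" "z \<in> {0..<n}" "x \<in> {0..<n}" using z Cons.prems by auto
      then show ?thesis using inj_on_eq_iff[OF bij_betw_imp_inj_on[OF f(1)]] by blast
    qed
    ultimately show ?thesis by (simp add: g_def transpose_apply_other)
  qed
  have "map g xs = map f xs" by (rule map_cong) (simp_all add: *)
  then have "map g (x # xs) = ys" using f(2) by (simp add: ys g_def)
  ultimately show ?case by blast
qed

lemma adj_spokes: "adj (spokes u W \<union> F) a b \<longleftrightarrow>
    a \<noteq> b \<and> (a = u \<and> b \<in> W \<or> b = u \<and> a \<in> W \<or> {a, b} \<in> F)"
  by (auto simp: adj_def doubleton_in_spokes_iff)

lemma bicyclic_spokes:
  assumes u: "u < n" and W: "W \<subseteq> {..<n} - {u}"
    and F: "\<And>e. e \<in> F \<Longrightarrow> \<exists>a b. e = {a, b} \<and> a < n \<and> b < n \<and> a \<noteq> b \<and> a \<noteq> u \<and> b \<noteq> u"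
    and card: "card W + card F = n + 1"
    and reach: "\<And>z. z < n \<Longrightarrow> z \<noteq> u \<Longrightarrow> z \<notin> W \<Longrightarrow> \<exists>w\<in>W. {w, z} \<in> F"
  shows "bicyclic n (spokes u W \<union> F)"
proof -
  let ?E = "spokes u W \<union> F"
  let ?R = "{(x, y). adj ?E x y}\<^sup>*"
  have fW: "finite W" using W by (rule finite_subset) simp
  have "F \<subseteq> Pow {..<n}" using F by fastforce
  then have fF: "finite F" by (rule finite_subset) simp
  have "e \<in> {{a, b} |a b. a < n \<and> b < n \<and> a \<noteq> b}" if "e \<in> spokes u W" for e
    using that u W unfolding spokes_def by blast
  then have "simple_graph n ?E" unfolding simple_graph_def using F by blast
  moreover have "u \<notin> e" if "e \<in> F" for e using F[OF that] by auto
  then have "spokes u W \<inter> F = {}" unfolding spokes_def by blast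
  then have "card ?E = n + 1"
    using card finite_spokes[OF fW] fF by (simp add: card_Un_disjoint card_spokes)
  moreover have "connected_graph n ?E"
  proof -
    have sy: "sym ?R" by (intro sym_rtrancl) (auto simp: sym_def adj_commute)
    have W': "(u, w) \<in> ?R" if "w \<in> W" for w
    proof -
      have "w \<noteq> u" using that W by blast
      then have "adj ?E u w" using that by (simp add: adj_spokes)
      then show ?thesis by blast
    qed
    have all: "(u, z) \<in> ?R" if z: "z < n" for z
    proof (cases "z = u \<or> z \<in> W")
      case True
      then show ?thesis using W' by blast
    next
      case False
      then obtain w where w: "w \<in> W" "{w, z} \<in> F" using reach z by blast
      then have "adj ?E w z" using False by (auto simp: adj_spokes)
      then have "(w, z) \<in> ?R" by blast
      with W'[OF w(1)] show ?thesis by (rule rtrancl_trans)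
    qed
    show ?thesis unfolding connected_graph_def
      using all symD[OF sy] rtrancl_trans by metis
  qed
  ultimately show ?thesis by (simp add: bicyclic_def)
qed

text \<open>The star is described by the set \<open>S\<close> that it omits, because
  \<open>f\<close> is known explicitly only on a few listed vertices.\<close>

lemma graph_iso_spokes:
  assumes f: "bij_betw f {0..<n} {0..<n}" and u: "u < n" and S: "S \<subseteq> {0..<n}" and F: "\<And>e. e \<in> F \<Longrightarrow> e \<subseteq> {0..<n}"
  shows "graph_iso n (spokes u ({..<n} - S) \<union> F) (spokes (f u) ({..<n} - f ` S) \<union> (`) f ` F)"
proof -
  have inj: "inj_on f {0..<n}" using f by (simp add: bij_betw_def)
  have "adj (spokes u ({..<n} - S) \<union> F) a b \<longleftrightarrow> adj (spokes (f u) ({..<n} - f ` S) \<union> (`) f ` F) (f a) (f b)"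
    if ab: "a < n" "b < n" for a b
  proof -
    have eq: "f i = f j \<longleftrightarrow> i = j" if "i < n" "j < n" for i j
      using that inj by (auto simp: inj_on_def)
    have S': "f i \<in> {..<n} - f ` S \<longleftrightarrow> i \<in> {..<n} - S" if "i < n" for i
    proof -
      have "f i < n" using bij_betwE[OF f] that by auto
      moreover have "f i \<in> f ` S \<longleftrightarrow> i \<in> S"
        using that S inj by (intro inj_on_image_mem_iff) auto
      ultimately show ?thesis using that by simp
    qed
    have "{f a, f b} \<in> (`) f ` F \<longleftrightarrow> {a, b} \<in> F"
    proof
      assume "{f a, f b} \<in> (`) f ` F"
      then obtain e where e: "e \<in> F" "f ` {a, b} = f ` e" by auto
      then have "{a, b} = e" using inj F[OF e(1)] ab by (subst (asm) inj_on_image_eq_iff) auto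
      then show "{a, b} \<in> F" using e by simp
    next
      assume "{a, b} \<in> F"
      then have "f ` {a, b} \<in> (`) f ` F" by (rule imageI)
      then show "{f a, f b} \<in> (`) f ` F" by simp
    qed
    then show ?thesis unfolding adj_spokes using eq ab u S'[OF ab(1)] S'[OF ab(2)] by simp
  qed
  then show ?thesis unfolding graph_iso_def using f by blast
qed

lemma B1_eq: "n \<ge> 4 \<Longrightarrow> B1 n = spokes 0 ({..<n} - {0}) \<union> {{1, 2}, {1, 3}}"
proof -
  assume n: "n \<ge> 4"
  define K where "K = {{0, k} |k. 4 \<le> k \<and> k < n}"
  have "{..<n} - {0} = {1, 2, 3} \<union> {k. 4 \<le> k \<and> k < n}" using n by auto
  moreover have "spokes 0 {k. 4 \<le> k \<and> k < n} = K"
    unfolding spokes_def K_def by blast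
  ultimately have sp: "spokes 0 ({..<n} - {0}) = {{0, 1}, {0, 2}, {0, 3}} \<union> K"
    by (simp add: spokes_def)
  have pat: "{a, b, c, d, e} \<union> K = {a, b, c} \<union> K \<union> {d, e}" for a b c d e f :: "nat set" and K
    by blast
  show ?thesis
    unfolding B1_def diamond_def K_def[symmetric] sp by (rule pat)
qed

lemma B2_eq: "n \<ge> 5 \<Longrightarrow> B2 n = spokes 0 ({..<n} - {0}) \<union> {{1, 2}, {3, 4}}"
proof -
  assume n: "n \<ge> 5"
  define K where "K = {{0, k} |k. 5 \<le> k \<and> k < n}"
  have "{..<n} - {0} = {1, 2, 3, 4} \<union> {k. 5 \<le> k \<and> k < n}" using n by auto
  moreover have "spokes 0 {k. 5 \<le> k \<and> k < n} = K"
    unfolding spokes_def K_def by blast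
  ultimately have sp: "spokes 0 ({..<n} - {0}) = {{0, 1}, {0, 2}, {0, 3}, {0, 4}} \<union> K"
    by (simp add: spokes_def)
  have pat: "{a, b, c, d, e, f} \<union> K = {a, b, d, e} \<union> K \<union> {c, f}" for a b c d e f :: "nat set" and K
    by blast
  show ?thesis
    unfolding B2_def K_def[symmetric] sp by (rule pat)
qed

lemma B3_eq: "n \<ge> 5 \<Longrightarrow> B3 n = spokes 0 ({..<n} - {0, 4}) \<union> {{1, 2}, {1, 3}, {1, 4}}"
proof -
  assume n: "n \<ge> 5"
  define K where "K = {{0, k} |k. 5 \<le> k \<and> k < n}"
  have "{..<n} - {0, 4} = {1, 2, 3} \<union> {k. 5 \<le> k \<and> k < n}" using n by auto
  moreover have "spokes 0 {k. 5 \<le> k \<and> k < n} = K"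
    unfolding spokes_def K_def by blast
  ultimately have sp: "spokes 0 ({..<n} - {0, 4}) = {{0, 1}, {0, 2}, {0, 3}} \<union> K"
    by (simp add: spokes_def)
  have pat: "{a, b, c, d, e} \<union> {f} \<union> K = {a, b, c} \<union> K \<union> {d, e, f}" for a b c d e f :: "nat set" and K
    by blast
  show ?thesis
    unfolding B3_def diamond_def K_def[symmetric] sp by (rule pat)
qed

lemma bicyclic_B1: "n \<ge> 4 \<Longrightarrow> bicyclic n (B1 n)"
proof -
  assume n: "n \<ge> 4"
  have c: "card {{1::nat, 2}, {1, 3}} = 2" by (simp add: doubleton_eq_iff)
  show ?thesis unfolding B1_eq[OF n]
  proof (intro bicyclic_spokes)
    fix e :: "nat set" assume "e \<in> {{1, 2}, {1, 3}}"
    then show "\<exists>a b. e = {a, b} \<and> a < n \<and> b < n \<and> a \<noteq> b \<and> a \<noteq> 0 \<and> b \<noteq> 0"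
      using n by (elim insertE emptyE) (force intro: exI[of _ "1::nat"])+
  qed (use n c in auto)
qed

lemma bicyclic_B2: "n \<ge> 5 \<Longrightarrow> bicyclic n (B2 n)"
proof -
  assume n: "n \<ge> 5"
  have c: "card {{1::nat, 2}, {3, 4}} = 2" by (simp add: doubleton_eq_iff)
  show ?thesis unfolding B2_eq[OF n]
  proof (intro bicyclic_spokes)
    fix e :: "nat set" assume "e \<in> {{1, 2}, {3, 4}}"
    then show "\<exists>a b. e = {a, b} \<and> a < n \<and> b < n \<and> a \<noteq> b \<and> a \<noteq> 0 \<and> b \<noteq> 0"
      using n by (elim insertE emptyE) (force intro: exI[of _ "1::nat"] exI[of _ "3::nat"])+
  qed (use n c in auto)
qed

lemma bicyclic_B3: "n \<ge> 5 \<Longrightarrow> bicyclic n (B3 n)"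
proof -
  assume n: "n \<ge> 5"
  have c: "card {{1::nat, 2}, {1, 3}, {1, 4}} = 3" "card ({..<n} - {0, 4}) = n - 2"
    using n by (simp_all add: doubleton_eq_iff)
  show ?thesis unfolding B3_eq[OF n]
  proof (intro bicyclic_spokes)
    fix e :: "nat set" assume "e \<in> {{1, 2}, {1, 3}, {1, 4}}"
    then show "\<exists>a b. e = {a, b} \<and> a < n \<and> b < n \<and> a \<noteq> b \<and> a \<noteq> 0 \<and> b \<noteq> 0"
      using n by (elim insertE emptyE) (force intro: exI[of _ "1::nat"])+
  next
    fix z assume "z < n" "z \<noteq> 0" "z \<notin> {..<n} - {0, 4}"
    then show "\<exists>w\<in>{..<n} - {0, 4}. {w, z} \<in> {{1, 2}, {1, 3}, {1, 4}}"
      using n by (intro bexI[of _ 1]) auto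
  qed (use n c in auto)
qed

text \<open>Two edges avoid \<open>u\<close>. Disjoint ones give \<open>B2\<close>, ones with a
  common end give \<open>B1\<close>.\<close>

lemma dominated_cases:
  assumes E: "bicyclic n E" and n: "n \<ge> 5" and u: "u < n" and dom: "\<And>w. w < n \<Longrightarrow> w \<noteq> u \<Longrightarrow> adj E u w"
  shows "graph_iso n E (B1 n) \<or> graph_iso n E (B2 n)"
proof -
  have s: "simple_graph n E" and cE: "card E = n + 1" using E by (auto simp: bicyclic_def)
  define F where "F = {e \<in> E. u \<notin> e}"
  have Nu: "nbrs n E u = {..<n} - {u}"
    using dom unfolding nbrs_def by (auto simp: adj_def)
  then have "deg n E u = n - 1" using u by (simp add: deg_eq_card_nbrs)
  then have "card F = 2" using card_edges_off_vertex[OF s, of u] cE n by (simp add: F_def)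
  then obtain e1 e2 where F: "F = {e1, e2}" "e1 \<noteq> e2" by (auto simp: card_2_iff)
  have E_eq: "E = spokes u ({..<n} - {u}) \<union> F"
    using edges_at_vertex[OF s, of u] unfolding Nu F_def by blast
  have edge: "\<exists>a b. e = {a, b} \<and> a < n \<and> b < n \<and> a \<noteq> b \<and> a \<noteq> u \<and> b \<noteq> u" if e: "e \<in> F" for e
  proof -
    obtain a b where "e = {a, b}" "a < n" "b < n" "a \<noteq> b"
      using simple_graph_edgeE[OF s, of e] e unfolding F_def by blast
    then show ?thesis using e unfolding F_def by blast
  qed
  obtain a b where ab: "e1 = {a, b}" "a < n" "b < n" "a \<noteq> b" "a \<noteq> u" "b \<noteq> u" using edge[of e1] F by blast
  obtain c d where cd: "e2 = {c, d}" "c < n" "d < n" "c \<noteq> d" "c \<noteq> u" "d \<noteq> u" using edge[of e2] F by blast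
  have B1: "graph_iso n E (B1 n)"
    if h: "F = {{a', b'}, {a', c'}}" "distinct [u, a', b', c']" "a' < n" "b' < n" "c' < n" for a' b' c'
  proof -
    obtain f where f: "bij_betw f {0..<n} {0..<n}" "map f [u, a', b', c'] = [0, 1, 2, 3]"
      using bij_betw_extend[of "[u, a', b', c']" "[0, 1, 2, 3]" n] h u n by auto
    have "graph_iso n E (spokes (f u) ({..<n} - f ` {u}) \<union> (`) f ` F)"
      unfolding E_eq using h u by (intro graph_iso_spokes f(1)) auto
    moreover have "(`) f ` F = {{1, 2}, {1, 3}}" "f u = 0" using f(2) h(1) by auto
    ultimately show ?thesis using n by (simp add: B1_eq)
  qed
  show ?thesis
  proof (cases "{a, b} \<inter> {c, d} = {}")
    case True
    have "distinct [u, a, b, c, d]" using ab cd True by auto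
    then obtain f where f: "bij_betw f {0..<n} {0..<n}" "map f [u, a, b, c, d] = [0, 1, 2, 3, 4]"
      using bij_betw_extend[of "[u, a, b, c, d]" "[0, 1, 2, 3, 4]" n] ab cd u n by auto
    have "graph_iso n E (spokes (f u) ({..<n} - f ` {u}) \<union> (`) f ` F)"
      unfolding E_eq F ab(1) cd(1) using ab cd u by (intro graph_iso_spokes f(1)) auto
    moreover have "(`) f ` F = {{1, 2}, {3, 4}}" "f u = 0" using f(2) F ab cd by auto
    ultimately show ?thesis using n by (simp add: B2_eq)
  next
    case False
    then consider "a = c" | "a = d" | "b = c" | "b = d" by blast
    then show ?thesis
    proof cases
      case 1 then show ?thesis using B1[of a b d] F ab cd by auto
    next
      case 2 then show ?thesis using B1[of a b c] F ab cd by (auto simp: insert_commute)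
    next
      case 3 then show ?thesis using B1[of b a d] F ab cd by (auto simp: insert_commute)
    next
      case 4 then show ?thesis using B1[of b a c] F ab cd by (auto simp: insert_commute)
    qed
  qed
qed

lemma b3_form_iso:
  assumes "distinct [u, v, s, t, y]" "u < n" "v < n" "s < n" "t < n" "y < n"
  shows "graph_iso n (spokes u ({..<n} - {u, y}) \<union> {{v, s}, {v, t}, {v, y}}) (B3 n)"
proof -
  have n: "n \<ge> 5"
    using card_mono[of "{..<n}" "set [u, v, s, t, y]"] distinct_card[OF assms(1)] assms by auto
  obtain f where f: "bij_betw f {0..<n} {0..<n}" "map f [u, v, s, t, y] = [0, 1, 2, 3, 4]"
    using bij_betw_extend[of "[u, v, s, t, y]" "[0, 1, 2, 3, 4]" n] assms n by auto
  have "graph_iso n (spokes u ({..<n} - {u, y}) \<union> {{v, s}, {v, t}, {v, y}})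
      (spokes (f u) ({..<n} - f ` {u, y}) \<union> (`) f ` {{v, s}, {v, t}, {v, y}})"
    using assms by (intro graph_iso_spokes f(1)) auto
  moreover have "(`) f ` {{v, s}, {v, t}, {v, y}} = {{1, 2}, {1, 3}, {1, 4}}" "f u = 0" "f y = 4"
    using f(2) by auto
  moreover have "f ` {u, y} = {0, 4}" using f(2) by simp
  ultimately show ?thesis by (simp only: B3_eq[OF n])
qed

section \<open>The sporadic graph\<close>

text \<open>For rewirings that touch only five vertices. By symmetry agreement is required only for
  a first index outside them; the remaining ten pairs are listed.\<close>

lemma qform_diff_on_five:
  assumes sym: "\<And>i j. A i j = A j i" "\<And>i j. A' i j = A' j i"
    and diag: "\<And>i. A i i = 0" "\<And>i. A' i i = 0"
    and agree: "\<And>i j. i < n \<Longrightarrow> j < n \<Longrightarrow> i \<notin> {a, b, c, d, e} \<Longrightarrow> A' i j = A i j"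
    and dist: "distinct [a, b, c, d, e]" and less: "a < n" "b < n" "c < n" "d < n" "e < n"
  defines "D \<equiv> \<lambda>i j. A' i j - A i j"
  shows "qform n A' x - qform n A x = 2 * (D a b * x a * x b + D a c * x a * x c + D a d * x a * x d
    + D a e * x a * x e + D b c * x b * x c + D b d * x b * x d + D b e * x b * x e
    + D c d * x c * x d + D c e * x c * x e + D d e * x d * x e)"
proof -
  let ?Z = "{a, b, c, d, e}"
  have Dsym: "D i j = D j i" for i j unfolding D_def using sym by presburger
  have Dd: "D i i = 0" for i by (simp add: D_def diag)
  have D0: "D i j = 0" if "i < n" "j < n" "i \<notin> ?Z \<or> j \<notin> ?Z" for i j
    using that agree[of i j] agree[of j i] Dsym[of i j] unfolding D_def by auto
  have "qform n A' x - qform n A x = (\<Sum>i<n. \<Sum>j<n. D i j * x i * x j)"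
    by (simp add: qform_def D_def left_diff_distrib sum_subtractf)
  also have "\<dots> = (\<Sum>i<n. \<Sum>j\<in>?Z. D i j * x i * x j)"
    using less D0 by (intro sum.cong refl sum.mono_neutral_right) auto
  also have "\<dots> = (\<Sum>i\<in>?Z. \<Sum>j\<in>?Z. D i j * x i * x j)"
    using less D0 by (intro sum.mono_neutral_right) (auto intro!: sum.neutral)
  also have "\<dots> = (\<Sum>i\<leftarrow>[a, b, c, d, e]. \<Sum>j\<leftarrow>[a, b, c, d, e]. D i j * x i * x j)"
    using dist by (simp only: sum_list_distinct_conv_sum_set list.set)
  also have "\<dots> = 2 * (D a b * x a * x b + D a c * x a * x c + D a d * x a * x d
    + D a e * x a * x e + D b c * x b * x c + D b d * x b * x d + D b e * x b * x e
    + D c d * x c * x d + D c e * x c * x e + D d e * x d * x e)"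
    using Dsym[of b a] Dsym[of c a] Dsym[of d a] Dsym[of e a] Dsym[of c b] Dsym[of d b] Dsym[of e b]
      Dsym[of d c] Dsym[of e c] Dsym[of e d]
    by (simp add: Dd algebra_simps)
  finally show ?thesis .
qed

text \<open>A copy of \<open>B3\<close> on freely chosen vertices, so that its form can be evaluated
  at the Perron vector of another graph on the same vertices.\<close>

locale b3_form =
  fixes n u v s t y :: nat
  assumes dist: "distinct [u, v, s, t, y]" and less: "u < n" "v < n" "s < n" "t < n" "y < n" and n: "n \<ge> 6"
begin

definition "G = spokes u ({..<n} - {u, y}) \<union> {{v, s}, {v, t}, {v, y}}"

lemma adj_G: "adj G a b \<longleftrightarrow> a = u \<and> b < n \<and> b \<noteq> u \<and> b \<noteq> y \<or> b = u \<and> a < n \<and> a \<noteq> u \<and> a \<noteq> y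
    \<or> a = v \<and> b \<in> {s, t, y} \<or> b = v \<and> a \<in> {s, t, y}"
  using dist unfolding G_def adj_spokes by (auto simp: doubleton_eq_iff)

lemma nbrs_G:
  "nbrs n G u = {..<n} - {u, y}" "nbrs n G v = {u, s, t, y}" "nbrs n G s = {u, v}"
  "nbrs n G t = {u, v}" "nbrs n G y = {v}" "z < n \<Longrightarrow> z \<notin> {u, v, s, t, y} \<Longrightarrow> nbrs n G z = {u}"
  using dist less unfolding nbrs_def adj_G by auto

lemma deg_G:
  "deg n G u = n - 2" "deg n G v = 4" "deg n G s = 2" "deg n G t = 2" "deg n G y = 1"
  "z < n \<Longrightarrow> z \<notin> {u, v, s, t, y} \<Longrightarrow> deg n G z = 1"
  using dist less by (simp_all add: deg_eq_card_nbrs nbrs_G)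

lemma undominated_G: "undominated n G"
proof -
  have c: "card ({..<n} - {u, y}) = n - 2" "card {{v, s}, {v, t}, {v, y}} = 3"
    using dist less by (auto simp: doubleton_eq_iff)
  have "bicyclic n G"
    unfolding G_def
  proof (intro bicyclic_spokes)
    fix e assume "e \<in> {{v, s}, {v, t}, {v, y}}"
    then obtain z where "z \<in> {s, t, y}" "e = {v, z}" by blast
    then show "\<exists>a b. e = {a, b} \<and> a < n \<and> b < n \<and> a \<noteq> b \<and> a \<noteq> u \<and> b \<noteq> u"
      using dist less by (intro exI[of _ v] exI[of _ z]) auto
  next
    fix z assume "z < n" "z \<noteq> u" "z \<notin> {..<n} - {u, y}"
    then show "\<exists>w\<in>{..<n} - {u, y}. {w, z} \<in> {{v, s}, {v, t}, {v, y}}"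
      using dist less by (intro bexI[of _ v]) auto
  qed (use n less c in auto)
  moreover have "\<exists>w<n. w \<noteq> i \<and> \<not> adj G i w" if "i < n" for i
  proof (cases "i = v")
    case True
    have "\<not> {..<n} \<subseteq> {u, v, s, t, y}"
      using card_mono[of "{u, v, s, t, y}" "{..<n}"] card_insert_le_m1 dist n
      by (auto simp: card_insert_if)
    then obtain z where "z < n" "z \<notin> {u, v, s, t, y}" by auto
    then show ?thesis using True dist by (intro exI[of _ z]) (auto simp: adj_G)
  next
    case False
    show ?thesis
    proof (cases "i = y")
      case True
      then show ?thesis using dist less by (intro exI[of _ u]) (auto simp: adj_G)
    next
      case False
      then show ?thesis using \<open>i \<noteq> v\<close> dist less by (intro exI[of _ y]) (auto simp: adj_G)
    qed
  qed
  ultimately show ?thesis by (simp add: undominated_def)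
qed

end

text \<open>The sporadic graph: a diamond whose degree-3 vertices are \<open>v\<close> and
  \<open>w\<close>, with all \<open>n - 4\<close> pendant vertices attached to the degree-2 vertex
  \<open>u\<close>.\<close>

locale triangle_form =
  fixes n u v w y :: nat
  assumes dist: "distinct [u, v, w, y]" and less: "u < n" "v < n" "w < n" "y < n" and n: "n \<ge> 6"
begin

definition "H = spokes u ({..<n} - {u, y}) \<union> {{v, w}, {v, y}, {w, y}}"

lemma adj_H: "adj H a b \<longleftrightarrow> a = u \<and> b < n \<and> b \<noteq> u \<and> b \<noteq> y \<or> b = u \<and> a < n \<and> a \<noteq> u \<and> a \<noteq> y
    \<or> a = v \<and> b \<in> {w, y} \<or> b = v \<and> a \<in> {w, y} \<or> a = w \<and> b = y \<or> a = y \<and> b = w"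
  using dist unfolding H_def adj_spokes by (auto simp: doubleton_eq_iff)

lemma nbrs_H:
  "nbrs n H u = {..<n} - {u, y}" "nbrs n H v = {u, w, y}" "nbrs n H w = {u, v, y}"
  "nbrs n H y = {v, w}" "z < n \<Longrightarrow> z \<notin> {u, v, w, y} \<Longrightarrow> nbrs n H z = {u}"
  using dist less unfolding nbrs_def adj_H by auto

lemma deg_H:
  "deg n H u = n - 2" "deg n H v = 3" "deg n H w = 3" "deg n H y = 2"
  "z < n \<Longrightarrow> z \<notin> {u, v, w, y} \<Longrightarrow> deg n H z = 1"
  using dist less by (simp_all add: deg_eq_card_nbrs nbrs_H)

end

lemma (in triangle_form) leaf_exists: obtains s where "s < n" "s \<notin> {u, v, w, y}"
proof -
  have "\<not> {..<n} \<subseteq> {u, v, w, y}"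
    using card_mono[of "{u, v, w, y}" "{..<n}"] dist n by (auto simp: card_insert_if)
  then show thesis using that by auto
qed

text \<open>Subtracting the equations at \<open>v\<close> and \<open>w\<close> gives
  \<open>x v = x w\<close>. For \<open>x v \<le> x u\<close>, the equations at \<open>u\<close> and
  \<open>v\<close> are multiplied by the eigenvalue, and \<open>y\<close> and the pendant vertices
  are eliminated.\<close>

lemma (in triangle_form) perron_H:
  assumes x: "perron p n H x" and p: "p \<ge> 2" and s: "s < n" "s \<notin> {u, v, w, y}"
  shows "x v = x w" "x v \<le> x u"
    and "rhoS p n H * x y = wt p 3 2 * (x v + x w)"
proof -
  define l where "l = rhoS p n H"
  define D where "D = real (n - 2)"
  have pos: "x u > 0" "x v > 0" "x w > 0" "x y > 0" "x s > 0"
    using x less s by (auto simp: perron_def)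
  have xpos: "x z > 0" if "z < n" for z using x that by (simp add: perron_def)
  note pn = perron_nbrs[OF x, folded l_def]
  have eq_v: "wt p 3 D * x u + wt p 3 3 * x w + wt p 3 2 * x y = l * x v"
    using pn[OF less(2)] dist by (simp add: nbrs_H deg_H D_def add_ac)
  have eq_w: "wt p 3 D * x u + wt p 3 3 * x v + wt p 3 2 * x y = l * x w"
    using pn[OF less(3)] dist by (simp add: nbrs_H deg_H D_def add_ac)
  have eq_y: "wt p 3 2 * (x v + x w) = l * x y"
    using pn[OF less(4)] dist by (simp add: nbrs_H deg_H wt_commute[of p 2] algebra_simps)
  then show "rhoS p n H * x y = wt p 3 2 * (x v + x w)" by (simp add: l_def)
  have eq_leaf: "wt p D 1 * x u = l * x z" if "z < n" "z \<notin> {u, v, w, y}" for z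
    using pn[OF that(1)] that by (simp add: nbrs_H deg_H D_def wt_commute[of p 1])
  have lpos: "l > 0"
    using pos eq_y wt_pos[of 3 p 2] by (metis add_pos_pos mult_pos_pos zero_less_mult_pos2 zero_less_numeral)
  have "(l + wt p 3 3) * (x v - x w) = 0"
    using eq_v eq_w by (simp add: algebra_simps)
  moreover have "l + wt p 3 3 > 0" using lpos wt_nonneg[of p 3 3] by linarith
  ultimately show vw: "x v = x w" by simp
  define L where "L = {..<n} - {u, v, w, y}"
  \<comment> \<open>The two-step walks from \<open>u\<close> through two pendant vertices balance
    the term \<open>2 * a\<^sup>2\<close> that \<open>v\<close> receives through
    \<open>y\<close>.\<close>
  have cL: "real (card L) \<ge> 2"
  proof -
    have "card L = n - 4" unfolding L_def using less dist by (simp add: card_Diff_subset)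
    then show ?thesis using n by simp
  qed
  have eq_u: "2 * wt p 3 D * x v + (\<Sum>z\<in>L. wt p D 1 * x z) = l * x u"
  proof -
    have "{..<n} - {u, y} = insert v (insert w L)" using less dist by (auto simp: L_def)
    then have "(\<Sum>j\<in>{..<n} - {u, y}. wt p D (deg n H j) * x j) =
        wt p D 3 * x v + (wt p D 3 * x w + (\<Sum>z\<in>L. wt p D (deg n H z) * x z))"
      using dist by (simp add: L_def deg_H)
    also have "(\<Sum>z\<in>L. wt p D (deg n H z) * x z) = (\<Sum>z\<in>L. wt p D 1 * x z)"
      by (intro sum.cong) (auto simp: L_def deg_H)
    finally show ?thesis
      using pn[OF less(1)] vw by (simp add: nbrs_H deg_H D_def[symmetric] wt_commute[of p D 3] algebra_simps del: of_nat_diff)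
  qed
  define a where "a = wt p 3 2"
  have D4: "D \<ge> 4" using n by (simp add: D_def)
  have a_pos: "a > 0" unfolding a_def by (rule wt_pos) simp
  have w33: "a \<le> wt p 3 3" unfolding a_def using p by (intro wt_mono) auto
  have w3D: "wt p 3 3 \<le> wt p 3 D" using p D4 by (intro wt_mono) auto
  have wD1: "a \<le> wt p D 1"
  proof -
    have "wt p 3 (1 + 1) \<le> wt p (3 + 1) 1" using p by (intro wt_majorize) auto
    also have "\<dots> \<le> wt p D 1" using p D4 by (intro wt_mono) auto
    finally show ?thesis by (simp add: a_def)
  qed
  have la: "l > a"
  proof -
    have "0 < wt p 3 D * x u" "0 \<le> wt p 3 2 * x y" using pos by (simp_all add: wt_pos wt_nonneg)
    then have "wt p 3 3 * x w < l * x w" using eq_w[unfolded vw] by linarith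
    then show ?thesis using pos w33 by simp
  qed
  have leaves: "l * (\<Sum>z\<in>L. wt p D 1 * x z) \<ge> 2 * a\<^sup>2 * x u"
  proof -
    have "l * (\<Sum>z\<in>L. wt p D 1 * x z) = (\<Sum>z\<in>L. wt p D 1 * (l * x z))"
      by (simp add: sum_distrib_left mult_ac)
    also have "\<dots> = (\<Sum>z\<in>L. wt p D 1 * (wt p D 1 * x u))"
      using eq_leaf by (intro sum.cong) (auto simp: L_def)
    also have "\<dots> = real (card L) * ((wt p D 1)\<^sup>2 * x u)"
      by (simp add: power2_eq_square mult_ac)
    also have "\<dots> \<ge> 2 * (a\<^sup>2 * x u)"
      using cL wD1 a_pos pos by (intro mult_mono mult_right_mono power_mono) auto
    finally show ?thesis by simp
  qed
  \<comment> \<open>The coefficient of \<open>x u - x v\<close> when the multiplied equations at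
    \<open>u\<close> and \<open>v\<close> are subtracted.\<close>
  define c where "c = l\<^sup>2 + l * wt p 3 D - 2 * a\<^sup>2"
  have "c > 0"
  proof -
    have "l * l > a * a" using la a_pos by (intro mult_strict_mono) auto
    moreover have "l * wt p 3 D \<ge> a * a" using la a_pos w33 w3D by (intro mult_mono) auto
    ultimately show ?thesis by (simp add: c_def power2_eq_square)
  qed
  have "l * (l * x u) = 2 * (l * (wt p 3 D * x v)) + l * (\<Sum>z\<in>L. wt p D 1 * x z)"
    unfolding eq_u[symmetric] by (simp add: algebra_simps)
  moreover have "l * (l * x v) = l * (wt p 3 D * x u) + l * (wt p 3 3 * x v) + a * (2 * a * x v)"
  proof -
    have "l * (l * x v) = l * (wt p 3 D * x u) + l * (wt p 3 3 * x v) + a * (l * x y)"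
      unfolding eq_v[symmetric] using vw by (simp add: algebra_simps a_def)
    then show ?thesis using eq_y vw by (simp add: a_def)
  qed
  moreover have "l * ((wt p 3 D - wt p 3 3) * x v) \<ge> 0" using lpos w3D pos by simp
  ultimately have "c * (x u - x v) \<ge> 0"
    using leaves by (simp add: c_def algebra_simps power2_eq_square)
  then show "x v \<le> x u" using \<open>c > 0\<close> by (simp add: zero_le_mult_iff)
qed

context extremal
begin

lemma not_triangle:
  assumes "distinct [u, v, w, y]" "u < n" "v < n" "w < n" "y < n"
    and E: "E = spokes u ({..<n} - {u, y}) \<union> {{v, w}, {v, y}, {w, y}}"
  shows False
proof -
  interpret triangle_form n u v w y using assms n by unfold_locales
  have EH: "E = H" by (simp add: E H_def)
  obtain s where s: "s < n" "s \<notin> {u, v, w, y}" using leaf_exists .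
  obtain x where x: "perron p n H x" using perron_exists[OF simple conn] n by (auto simp: EH)
  define D where "D = real (n - 2)"
  have D4: "D \<ge> 4" using n by (simp add: D_def)
  have pos: "x u > 0" "x v > 0" "x w > 0" "x y > 0" "x s > 0"
    using x less s by (auto simp: perron_def)
  note xw = perron_H(1)[OF x p s, symmetric] and xu = perron_H(2)[OF x p s]
  \<comment> \<open>Both rewirings are copies of \<open>B3\<close>: \<open>u\<close> misses
    \<open>y\<close> in the first and \<open>s\<close> in the second.\<close>
  interpret G1: b3_form n u v w s y using dist less s n by unfold_locales auto
  interpret G2: b3_form n u v w y s using dist less s n by unfold_locales auto
  have le: "qform n (swt p n G) x \<le> qform n (swt p n H) x" if "undominated n G" for G
    using rhoS_less_of_qform[OF x, of G] max[OF that] n by (auto simp: EH not_less[symmetric])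
  have vals: "swt p n H u v = wt p D 3" "swt p n H u w = wt p D 3" "swt p n H u y = 0"
    "swt p n H u s = wt p D 1" "swt p n H v w = wt p 3 3" "swt p n H v y = wt p 3 2"
    "swt p n H v s = 0" "swt p n H w y = wt p 3 2" "swt p n H w s = 0" "swt p n H y s = 0"
    using dist less s by (auto simp: swt_def adj_H deg_H D_def)
  have vals1: "swt p n G1.G u v = wt p D 4" "swt p n G1.G u w = wt p D 2" "swt p n G1.G u y = 0"
    "swt p n G1.G u s = wt p D 2" "swt p n G1.G v w = wt p 4 2" "swt p n G1.G v y = wt p 4 1"
    "swt p n G1.G v s = wt p 4 2" "swt p n G1.G w y = 0" "swt p n G1.G w s = 0" "swt p n G1.G y s = 0"
    using dist less s by (auto simp: swt_def G1.adj_G G1.deg_G D_def)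
  have vals2: "swt p n G2.G u v = wt p D 4" "swt p n G2.G u w = wt p D 2" "swt p n G2.G u y = wt p D 2"
    "swt p n G2.G u s = 0" "swt p n G2.G v w = wt p 4 2" "swt p n G2.G v y = wt p 4 2"
    "swt p n G2.G v s = wt p 4 1" "swt p n G2.G w y = 0" "swt p n G2.G w s = 0" "swt p n G2.G y s = 0"
    using dist less s by (auto simp: swt_def G2.adj_G G2.deg_G D_def)
  have five: "distinct [u, v, w, y, s]" using dist s by auto
  have agree1: "swt p n G1.G i j = swt p n H i j" if "i < n" "j < n" "i \<notin> {u, v, w, y, s}" for i j
    using that dist less s by (auto simp: swt_def G1.adj_G adj_H G1.deg_G deg_H)
  have agree2: "swt p n G2.G i j = swt p n H i j" if "i < n" "j < n" "i \<notin> {u, v, w, y, s}" for i j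
    using that dist less s by (auto simp: swt_def G2.adj_G adj_H G2.deg_G deg_H)
  note q1 = qform_diff_on_five[where A = "swt p n H" and A' = "swt p n G1.G" and x = x,
      OF swt_commute swt_commute swt_diag swt_diag agree1 five less(1-4) s(1), unfolded vals vals1 xw]
  note q2 = qform_diff_on_five[where A = "swt p n H" and A' = "swt p n G2.G" and x = x,
      OF swt_commute swt_commute swt_diag swt_diag agree2 five less(1-4) s(1), unfolded vals vals2 xw]
  \<comment> \<open>In both rewirings the degrees of \<open>v\<close> and \<open>w\<close> change
    from 3 and 3 to 4 and 2. As \<open>x v = x w\<close>, convexity makes their edges to
    \<open>u\<close> gain in total.\<close>
  have conv: "2 * wt p D 3 \<le> wt p D 4 + wt p D 2"
    using wt_increment_mono[of p D 2 3 1] p D4 by (simp add: wt_commute[of p D])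
  have w33: "wt p 3 3 \<le> wt p 4 2" using wt_majorize[of p 2 3 1] p by simp
  have w32: "wt p 3 2 \<le> wt p 4 1" using wt_majorize[of p 1 3 1] p by simp
  have w42: "wt p 3 2 \<le> wt p 4 2" using p by (intro wt_mono) auto
  have wD2: "wt p 4 2 \<le> wt p D 2" using p D4 by (intro wt_mono) auto
  have wD12: "wt p D 1 < wt p D 2" using wt_strict_mono[of p 1 2 D D] p D4 by (simp add: wt_commute[of p D])
  have a_pos: "wt p 3 2 > 0" by (rule wt_pos) simp
  define b where "b = x v"
  note pos' = pos(1,2,4,5)[folded b_def]
  have t1: "x u * b * (wt p D 4 + wt p D 2 - 2 * wt p D 3) \<ge> 0"
    and t2: "b * b * (wt p 4 2 - wt p 3 3) \<ge> 0"
    and t3: "x u * x s * (wt p D 2 - wt p D 1) > 0"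
    using conv w33 wD12 pos' by auto
  text \<open>
    If \<open>x y \<le> x s\<close>, the edge \<open>w y\<close> is replaced by \<open>v s\<close>; otherwise \<open>u s\<close> and \<open>w y\<close> are replaced by \<open>u y\<close> and \<open>v s\<close>.
  \<close>
  show False
  proof (cases "x y \<le> x s")
    case True
    have "b * x y * (wt p 4 1 - wt p 3 2) \<ge> 0" using w32 pos' by simp
    moreover have "b * (wt p 3 2 * x y) \<le> b * (wt p 4 2 * x s)"
      using True w42 a_pos pos' by (intro mult_left_mono mult_mono) auto
    ultimately have "0 < x u * b * (wt p D 4 + wt p D 2 - 2 * wt p D 3) + x u * x s * (wt p D 2 - wt p D 1)
        + b * b * (wt p 4 2 - wt p 3 3) + b * x y * (wt p 4 1 - wt p 3 2)
        + (b * (wt p 4 2 * x s) - b * (wt p 3 2 * x y))"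
      using t1 t2 t3 by linarith
    then show False
      using q1 le[OF G1.undominated_G] unfolding b_def by (simp add: algebra_simps)
  next
    case False
    have "b * x y * (wt p 4 2 - wt p 3 2) \<ge> 0" using w42 pos' by simp
    moreover have "b * x s * (wt p 4 1 - wt p 3 2) \<ge> 0" using w32 pos' by simp
    moreover have "wt p 3 2 * b * (x y - x s) \<le> wt p D 2 * x u * (x y - x s)"
      using False w42 wD2 a_pos pos' xu unfolding b_def by (intro mult_right_mono mult_mono) auto
    ultimately have "0 < x u * b * (wt p D 4 + wt p D 2 - 2 * wt p D 3) + x u * x s * (wt p D 2 - wt p D 1)
        + b * b * (wt p 4 2 - wt p 3 3) + b * x y * (wt p 4 2 - wt p 3 2)
        + b * x s * (wt p 4 1 - wt p 3 2)
        + (wt p D 2 * x u * (x y - x s) - wt p 3 2 * b * (x y - x s))"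
      using t1 t2 t3 by linarith
    then show False
      using q2 le[OF G2.undominated_G] unfolding b_def by (simp add: algebra_simps)
  qed
qed

lemma iso_B3: "graph_iso n E (B3 n)"
proof -
  obtain u y where "u < n" "y < n" "y \<noteq> u" "\<not> adj E u y"
    "\<And>z. z < n \<Longrightarrow> z \<noteq> u \<Longrightarrow> z \<noteq> y \<Longrightarrow> adj E u z"
    using almost_dominating by blast
  then interpret extremal_star n E p u y by unfold_locales
  show ?thesis
  proof (rule edge_structure)
    fix v s t assume "distinct [u, v, s, t, y]" "v < n" "s < n" "t < n"
      "E = spokes u ({..<n} - {u, y}) \<union> {{v, s}, {v, t}, {v, y}}"
    then show ?thesis using b3_form_iso[of u v s t y n] u y by simp
  next
    fix v w assume "distinct [u, v, w, y]" "v < n" "w < n"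
      "E = spokes u ({..<n} - {u, y}) \<union> {{v, w}, {v, y}, {w, y}}"
    then show ?thesis using not_triangle[of u v w y] u y by blast
  qed
qed

end

section \<open>Comparison of \<open>B\<^sub>1\<close>, \<open>B\<^sub>2\<close>, \<open>B\<^sub>3\<close>\<close>

text \<open>The shift acts on vertices 1 and 3 of different triangles and keeps 0 adjacent to
  everything. So the result is a copy of \<open>B1\<close> or \<open>B2\<close>, and its larger
  radius excludes \<open>B2\<close>.\<close>

lemma rhoS_B2_less_B1:
  assumes n: "n \<ge> 5" and p: "p \<ge> 1"
  shows "rhoS p n (B2 n) < rhoS p n (B1 n)"
proof -
  have bi: "bicyclic n (B2 n)" using n by (rule bicyclic_B2)
  then have s: "simple_graph n (B2 n)" and c: "connected_graph n (B2 n)" by (auto simp: bicyclic_def)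
  have adj: "adj (B2 n) a b \<longleftrightarrow> a \<noteq> b \<and> (a = 0 \<and> b < n \<or> b = 0 \<and> a < n \<or> {a, b} \<in> {{1, 2}, {3, 4}})" for a b
    unfolding B2_eq[OF n] adj_spokes by auto
  have link: "adj (B2 n) 1 3 \<or> (\<exists>w. adj (B2 n) 1 w \<and> adj (B2 n) 3 w)"
    using n by (intro disjI2 exI[of _ 0]) (simp add: adj)
  obtain u' v' P where eq_uv: "{u', v'} = {1, 3}" and em: "edge_move n (B2 n) u' v' P"
    and Pd: "P = {w. adj (B2 n) v' w \<and> \<not> adj (B2 n) u' w \<and> w \<noteq> u'}"
    and less: "rhoS p n (B2 n) < rhoS p n (move_edges (B2 n) v' u' P)"
  proof (rule kelmans[OF s c _ p link, where a = 2 and b = 4])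
    show "adj (B2 n) 1 2" "\<not> adj (B2 n) 3 2" "adj (B2 n) 3 4" "\<not> adj (B2 n) 1 4"
      using n by (auto simp: adj doubleton_eq_iff)
  qed auto
  interpret edge_move n "B2 n" u' v' P by (rule em)
  have uv': "u' = 1 \<and> v' = 3 \<or> u' = 3 \<and> v' = 1" using eq_uv by (auto simp: doubleton_eq_iff)
  have a0: "adj (B2 n) u' 0" "adj (B2 n) v' 0" "u' \<noteq> 0" "v' \<noteq> 0" using uv' n by (auto simp: adj)
  have "bicyclic n (move_edges (B2 n) v' u' P)" using bicyclic'[OF bi] a0 by blast
  moreover have "adj (move_edges (B2 n) v' u' P) 0 w" if "w < n" "w \<noteq> 0" for w
  proof -
    have "0 \<notin> P" using a0 by (simp add: Pd)
    then have "adj (move_edges (B2 n) v' u' P) w 0"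
      using that a0 adj'_u[of 0] adj'_v[of 0] adj'_other[of w 0] adj[of w 0]
      by (cases "w = u'"; cases "w = v'") auto
    then show ?thesis by (simp add: adj_commute)
  qed
  ultimately have "graph_iso n (move_edges (B2 n) v' u' P) (B1 n) \<or> graph_iso n (move_edges (B2 n) v' u' P) (B2 n)"
    using n by (intro dominated_cases[of n _ 0]) auto
  then show ?thesis
    using graph_iso_rhoS[of n "move_edges (B2 n) v' u' P" _ p] less n by auto
qed

text \<open>Eliminating all vertices but \<open>u\<close> and \<open>v\<close> from the eigenvalue
  equations leaves \<open>P * x u = R * x v\<close> and \<open>Q * x v = R * x u\<close>. Positivity
  of the Perron vector fixes the signs of \<open>P\<close> and \<open>Q\<close>.\<close>

lemma (in b3_form) perron_G:
  assumes x: "perron p n G x"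
  defines "l \<equiv> rhoS p n G" and "D \<equiv> real (n - 2)"
  defines "P \<equiv> l\<^sup>2 - 2 * (wt p D 2)\<^sup>2 - (D - 3) * (wt p D 1)\<^sup>2"
    and "Q \<equiv> l\<^sup>2 - 2 * (wt p 4 2)\<^sup>2 - (wt p 4 1)\<^sup>2"
    and "R \<equiv> l * wt p D 4 + 2 * wt p 4 2 * wt p D 2"
  shows "l > 0" "P > 0" "Q > 0" "P * Q = R\<^sup>2"
proof -
  have pos: "x u > 0" "x v > 0" using x less by (auto simp: perron_def)
  have D4: "D \<ge> 4" using n by (simp add: D_def)
  note pn = perron_nbrs[OF x, folded l_def]
  have "bicyclic n G" using undominated_G by (simp add: undominated_def)
  then have "simple_graph n G" by (simp add: bicyclic_def)
  moreover have "adj G v y" by (simp add: adj_G)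
  ultimately show lpos: "l > 0" using rhoS_pos[OF x] by (simp add: l_def)
  have eq_s: "l * x s = wt p D 2 * x u + wt p 4 2 * x v"
    using pn[OF less(3)] dist by (simp add: nbrs_G deg_G D_def[symmetric] wt_commute[of p 2] del: of_nat_diff)
  have eq_t: "l * x t = wt p D 2 * x u + wt p 4 2 * x v"
    using pn[OF less(4)] dist by (simp add: nbrs_G deg_G D_def[symmetric] wt_commute[of p 2] del: of_nat_diff)
  have eq_y: "l * x y = wt p 4 1 * x v"
    using pn[OF less(5)] dist by (simp add: nbrs_G deg_G wt_commute[of p 1])
  have eq_z: "l * x z = wt p D 1 * x u" if "z < n" "z \<notin> {u, v, s, t, y}" for z
    using pn[OF that(1)] that by (simp add: nbrs_G deg_G D_def[symmetric] wt_commute[of p 1] del: of_nat_diff)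
  have eq_v: "l * x v = wt p D 4 * x u + wt p 4 2 * x s + wt p 4 2 * x t + wt p 4 1 * x y"
    using pn[OF less(2)] dist by (simp add: nbrs_G deg_G D_def[symmetric] wt_commute[of p 4 D] del: of_nat_diff)
  define L where "L = {..<n} - {u, v, s, t, y}"
  have cL: "real (card L) = D - 3"
  proof -
    have "card L = n - 5" unfolding L_def using less dist by (simp add: card_Diff_subset)
    then show ?thesis using n by (simp add: D_def)
  qed
  have eq_u: "l * x u = wt p D 4 * x v + wt p D 2 * x s + wt p D 2 * x t + (\<Sum>z\<in>L. wt p D 1 * x z)"
  proof -
    have "{..<n} - {u, y} = insert v (insert s (insert t L))" using less dist by (auto simp: L_def)
    then have "(\<Sum>j\<in>{..<n} - {u, y}. wt p D (deg n G j) * x j) =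
        wt p D 4 * x v + (wt p D 2 * x s + (wt p D 2 * x t + (\<Sum>z\<in>L. wt p D (deg n G z) * x z)))"
      using dist by (simp add: L_def deg_G)
    also have "(\<Sum>z\<in>L. wt p D (deg n G z) * x z) = (\<Sum>z\<in>L. wt p D 1 * x z)"
      by (intro sum.cong) (auto simp: L_def deg_G)
    finally show ?thesis
      using pn[OF less(1)] by (simp add: nbrs_G deg_G D_def[symmetric] del: of_nat_diff)
  qed
  have leaves: "l * (\<Sum>z\<in>L. wt p D 1 * x z) = (D - 3) * (wt p D 1)\<^sup>2 * x u"
  proof -
    have "l * (\<Sum>z\<in>L. wt p D 1 * x z) = (\<Sum>z\<in>L. wt p D 1 * (l * x z))"
      by (simp add: sum_distrib_left mult_ac)
    also have "\<dots> = (\<Sum>z\<in>L. wt p D 1 * (wt p D 1 * x u))"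
      using eq_z by (intro sum.cong) (auto simp: L_def)
    finally show ?thesis by (simp add: cL power2_eq_square mult_ac)
  qed
  have "l * (l * x u) = l * (wt p D 4 * x v) + wt p D 2 * (l * x s) + wt p D 2 * (l * x t)
      + l * (\<Sum>z\<in>L. wt p D 1 * x z)"
    unfolding eq_u by (simp add: algebra_simps)
  then have Pu: "P * x u = R * x v"
    unfolding eq_s eq_t leaves P_def R_def by (simp add: algebra_simps power2_eq_square)
  have "l * (l * x v) = l * (wt p D 4 * x u) + wt p 4 2 * (l * x s) + wt p 4 2 * (l * x t) + wt p 4 1 * (l * x y)"
    unfolding eq_v by (simp add: algebra_simps)
  then have Qv: "Q * x v = R * x u"
    unfolding eq_s eq_t eq_y Q_def R_def by (simp add: algebra_simps power2_eq_square)
  have "R > 0"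
    using lpos D4 wt_pos[of D p 4] wt_nonneg[of p 4 2] wt_nonneg[of p D 2] by (simp add: R_def add_pos_nonneg)
  then have "P * x u > 0" "Q * x v > 0" unfolding Pu Qv using pos by simp_all
  then show "P > 0" "Q > 0" using pos by (simp_all add: zero_less_mult_iff)
  have "(P * Q) * (x u * x v) = R\<^sup>2 * (x u * x v)"
    using arg_cong2[OF Pu Qv, of "(*)"] by (simp add: power2_eq_square mult_ac)
  then show "P * Q = R\<^sup>2" using pos by simp
qed

text \<open>The vector \<open>y\<close> solves the eigenvalue equation for \<open>l\<close> in every
  row except that of the centre 0. As \<open>l\<close> is at least the radius, the Rayleigh bound
  turns the remaining row into the inequality.\<close>

lemma B2_test_vector:
  assumes n: "n \<ge> 5" and l: "l \<ge> rhoS p n (B2 n)" "l > wt p 2 2"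
  defines "D \<equiv> real (n - 1)"
  shows "4 * (wt p D 2)\<^sup>2 / (l - wt p 2 2) + (real n - 5) * (wt p D 1)\<^sup>2 / l \<le> l"
proof -
  define \<beta> \<gamma> where "\<beta> = wt p D 2 / (l - wt p 2 2)" and "\<gamma> = wt p D 1 / l"
  define y where "y i = (if i = 0 then 1 else if i \<le> 4 then \<beta> else \<gamma>)" for i :: nat
  have lpos: "l > 0" using l(2) wt_nonneg[of p 2 2] by linarith
  let ?E = "B2 n"
  have s: "simple_graph n ?E" using bicyclic_B2[OF n] by (simp add: bicyclic_def)
  have adj: "adj ?E a b \<longleftrightarrow> a \<noteq> b \<and> (a = 0 \<and> b < n \<or> b = 0 \<and> a < n \<or> {a, b} \<in> {{1, 2}, {3, 4}})" for a b
    unfolding B2_eq[OF n] adj_spokes by auto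
  have N: "nbrs n ?E 0 = {1..<n}" "nbrs n ?E (Suc 0) = {0, 2}" "nbrs n ?E 2 = {0, 1}" "nbrs n ?E 3 = {0, 4}"
    "nbrs n ?E 4 = {0, 3}" "\<And>z. z < n \<Longrightarrow> z > 4 \<Longrightarrow> nbrs n ?E z = {0}"
    using n unfolding nbrs_def adj by (auto simp: doubleton_eq_iff)
  have dg: "deg n ?E 0 = n - 1" "\<And>z. z > 0 \<Longrightarrow> z \<le> 4 \<Longrightarrow> deg n ?E z = 2"
    "\<And>z. z < n \<Longrightarrow> z > 4 \<Longrightarrow> deg n ?E z = 1"
  proof -
    show "deg n ?E 0 = n - 1" "\<And>z. z < n \<Longrightarrow> z > 4 \<Longrightarrow> deg n ?E z = 1"
      by (simp_all add: deg_eq_card_nbrs N)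
    fix z :: nat assume "z > 0" "z \<le> 4"
    then have "z = 1 \<or> z = 2 \<or> z = 3 \<or> z = 4" by auto
    then show "deg n ?E z = 2" by (elim disjE) (simp_all add: deg_eq_card_nbrs N)
  qed
  have row: "(\<Sum>j<n. swt p n ?E i j * y j) = (\<Sum>j\<in>nbrs n ?E i. wt p (deg n ?E i) (deg n ?E j) * y j)" for i
  proof -
    have "(\<Sum>j\<in>nbrs n ?E i. wt p (deg n ?E i) (deg n ?E j) * y j) = (\<Sum>j\<in>nbrs n ?E i. swt p n ?E i j * y j)"
      by (intro sum.cong) (auto simp: swt_def nbrs_def)
    also have "\<dots> = (\<Sum>j<n. swt p n ?E i j * y j)"
      by (intro sum.mono_neutral_left) (auto simp: swt_def nbrs_def)
    finally show ?thesis ..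
  qed
  have Dr: "real (n - Suc 0) = D" by (simp add: D_def)
  have \<beta>: "wt p D 2 + wt p 2 2 * \<beta> = l * \<beta>"
    using l(2) by (simp add: \<beta>_def field_simps)
  have rows: "(\<Sum>j<n. swt p n ?E i j * y j) = l * y i" if i: "i < n" "i \<noteq> 0" for i
  proof (cases "i \<le> 4")
    case True
    then have "i = 1 \<or> i = 2 \<or> i = 3 \<or> i = 4" using i by auto
    then show ?thesis
      using \<beta> unfolding row
      by (elim disjE) (simp_all add: N dg y_def Dr wt_commute[of p 2 D] del: of_nat_diff)
  next
    case False
    then show ?thesis
      using i lpos unfolding row by (simp add: N dg y_def \<gamma>_def Dr wt_commute[of p 1 D] del: of_nat_diff)
  qed
  define r where "r = (\<Sum>j<n. swt p n ?E 0 j * y j)"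
  have split: "(\<Sum>j<n. f j) = f 0 + (\<Sum>j\<in>{1..<n}. f j)" for f :: "nat \<Rightarrow> real"
    using n by (simp add: sum.atLeast_Suc_lessThan lessThan_atLeast0)
  have "qform n (swt p n ?E) y = y 0 * r + (\<Sum>i\<in>{1..<n}. y i * (\<Sum>j<n. swt p n ?E i j * y j))"
    unfolding qform_eq_inner r_def by (rule split)
  also have "(\<Sum>i\<in>{1..<n}. y i * (\<Sum>j<n. swt p n ?E i j * y j)) = (\<Sum>i\<in>{1..<n}. y i * (l * y i))"
    using rows by (intro sum.cong) auto
  also have "y 0 * r + \<dots> = r + l * (\<Sum>i\<in>{1..<n}. (y i)\<^sup>2)"
    by (simp add: y_def[of 0] sum_distrib_left power2_eq_square mult_ac)
  finally have "qform n (swt p n ?E) y = r + l * (\<Sum>i\<in>{1..<n}. (y i)\<^sup>2)" .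
  moreover have "sqnorm n y = 1 + (\<Sum>i\<in>{1..<n}. (y i)\<^sup>2)"
    unfolding sqnorm_def split by (simp add: y_def)
  moreover have "qform n (swt p n ?E) y \<le> l * sqnorm n y"
    using qform_le_rhoS[of n p ?E y] mult_right_mono[OF l(1) sqnorm_nonneg[of n y]] n by simp
  ultimately have "r \<le> l" by (simp add: algebra_simps)
  moreover have "r = 4 * (wt p D 2 * \<beta>) + (real n - 5) * (wt p D 1 * \<gamma>)"
  proof -
    have "{1..<n} = {1, 2, 3, 4} \<union> {5..<n}" using n by auto
    moreover have "r = (\<Sum>j\<in>{1..<n}. wt p D (deg n ?E j) * y j)"
      unfolding r_def row N(1) dg(1) D_def ..
    ultimately have "r = (\<Sum>j\<in>{1, 2, 3, 4}. wt p D (deg n ?E j) * y j) + (\<Sum>j\<in>{5..<n}. wt p D (deg n ?E j) * y j)"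
      by (simp only:) (rule sum.union_disjoint, auto)
    also have "(\<Sum>j\<in>{5..<n}. wt p D (deg n ?E j) * y j) = (\<Sum>j\<in>{5..<n}. wt p D 1 * \<gamma>)"
      by (intro sum.cong) (auto simp: dg y_def)
    finally show ?thesis using n by (simp add: dg y_def of_nat_diff)
  qed
  ultimately show ?thesis by (simp add: \<beta>_def \<gamma>_def power2_eq_square)
qed

text \<open>
  For \<open>w(a, b) = wt p a b\<close> and \<open>D = n - 2\<close>, the variables \<open>a, b, d, m, h, k\<close> stand for the squares of \<open>w(D, 2)\<close>, \<open>w(4, 2)\<close>,
  \<open>w(4, 1)\<close>, \<open>w(D, 1)\<close>, \<open>w(D + 1, 2)\<close>, \<open>w(D + 1, 1)\<close>, and \<open>c\<close> for \<open>w(D, 4)\<close>. Up to the scale \<open>g\<close> all bounds but the one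
  on \<open>d\<close> are attained at \<open>p = 2\<close>.
\<close>

lemma B3_B2_inequality_large:
  fixes l a h k m c b d D :: real
  assumes D: "D \<ge> 5" and pos: "l > 0" "g > 0"
    and L: "l\<^sup>2 \<ge> 4 * h + (D - 3) * k"
    and h: "h \<ge> g * ((D + 1)\<^sup>2 + 4)" and k: "k - m \<ge> g * (2 * D + 1)" and m: "m \<ge> g * (D\<^sup>2 + 1)"
    and c: "0 \<le> c" "c\<^sup>2 \<le> g * (D\<^sup>2 + 16)" and a: "a = g * (D\<^sup>2 + 4)"
    and b: "b \<le> 20 * g" "d \<le> 20 * g"
    and R: "R = l * c + 2 * e" "e\<^sup>2 = a * b"
    and eq: "(l\<^sup>2 - 2 * a - (D - 3) * m) * (l\<^sup>2 - 2 * b - d) = R\<^sup>2"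
  shows False
proof -
  \<comment> \<open>\<open>P0\<close> and \<open>L0\<close> below are, up to the factor
    \<open>g\<close>, the lower bounds for the first factor of \<open>eq\<close> and for
    \<open>l\<^sup>2\<close> that result from inserting the bounds on \<open>h\<close>,
    \<open>k\<close> and \<open>m\<close>. The number 60 bounds \<open>2 * b + d\<close>.\<close>
  define P0 where "P0 = 4 * D\<^sup>2 + 3 * D + 9"
  have P: "l\<^sup>2 - 2 * a - (D - 3) * m \<ge> g * P0"
  proof -
    have "(D - 3) * (k - m) \<ge> (D - 3) * (g * (2 * D + 1))" using k D by (intro mult_left_mono) auto
    moreover have "4 * (g * ((D + 1)\<^sup>2 + 4)) - 2 * a + (D - 3) * (g * (2 * D + 1)) = g * P0"
      by (simp add: a P0_def power2_eq_square algebra_simps)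
    ultimately show ?thesis using L h by (simp add: algebra_simps)
  qed
  define L0 where "L0 = D ^ 3 + 3 * D\<^sup>2 + 4 * D + 14"
  have Lg: "l\<^sup>2 \<ge> g * L0"
  proof -
    have "(D - 3) * k \<ge> (D - 3) * (g * (2 * D + 1) + g * (D\<^sup>2 + 1))" using k m D by (intro mult_left_mono) auto
    moreover have "4 * (g * ((D + 1)\<^sup>2 + 4)) + (D - 3) * (g * (2 * D + 1) + g * (D\<^sup>2 + 1)) = g * L0"
      by (simp add: L0_def power2_eq_square power3_eq_cube algebra_simps)
    ultimately show ?thesis using L h by (simp add: algebra_simps)
  qed
  define j where "j = D - 5"
  have Dj: "D = j + 5" "j \<ge> 0" using D by (simp_all add: j_def)
  have "L0 \<ge> 234" unfolding L0_def Dj using Dj(2) by (simp add: power2_eq_square power3_eq_cube algebra_simps)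
  then have "g * L0 \<ge> g * 234" using pos by (intro mult_left_mono) auto
  then have L60: "l\<^sup>2 - 60 * g \<ge> 0" using Lg pos by linarith
  have Q: "l\<^sup>2 - 2 * b - d \<ge> l\<^sup>2 - 60 * g" using b by linarith
  have gP0: "g * P0 \<ge> 0" using pos D by (simp add: P0_def)
  have "g * P0 * (l\<^sup>2 - 60 * g) \<le> R\<^sup>2"
    unfolding eq[symmetric] using P Q L60 gP0 by (intro mult_mono) auto
  moreover have "R\<^sup>2 \<le> 3 / 2 * (l\<^sup>2 * c\<^sup>2) + 12 * e\<^sup>2"
  proof -
    \<comment> \<open>The cross term \<open>4 * l * c * e\<close> is split so that
      \<open>l\<^sup>2 * c\<^sup>2\<close> gets the coefficient 3/2, small enough for
      \<open>P0\<close> to absorb it.\<close>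
    have "0 \<le> (l * c - 4 * e)\<^sup>2 / 2" by simp
    then show ?thesis unfolding R(1) by (simp add: power2_eq_square algebra_simps)
  qed
  moreover have "l\<^sup>2 * c\<^sup>2 \<le> l\<^sup>2 * (g * (D\<^sup>2 + 16))" using c by (intro mult_left_mono) auto
  moreover have "e\<^sup>2 \<le> a * (20 * g)" unfolding R(2) using b pos a by (intro mult_left_mono) auto
  ultimately have "g * P0 * (l\<^sup>2 - 60 * g) \<le> 3 / 2 * (l\<^sup>2 * (g * (D\<^sup>2 + 16))) + 12 * (a * (20 * g))"
    by linarith
  then have "g * (P0 * (l\<^sup>2 - 60 * g)) \<le> g * (3 / 2 * (l\<^sup>2 * (D\<^sup>2 + 16)) + 240 * a)"
    by (simp add: algebra_simps)
  then have "P0 * (l\<^sup>2 - 60 * g) \<le> 3 / 2 * (l\<^sup>2 * (D\<^sup>2 + 16)) + 240 * a"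
    using pos by simp
  then have 1: "(P0 - 3 / 2 * (D\<^sup>2 + 16)) * l\<^sup>2 \<le> g * (60 * P0 + 240 * (D\<^sup>2 + 4))"
    by (simp add: a algebra_simps)
  have "P0 - 3 / 2 * (D\<^sup>2 + 16) \<ge> 0"
    unfolding P0_def Dj using Dj(2) by (simp add: power2_eq_square algebra_simps)
  then have "(P0 - 3 / 2 * (D\<^sup>2 + 16)) * (g * L0) \<le> (P0 - 3 / 2 * (D\<^sup>2 + 16)) * l\<^sup>2"
    using Lg by (intro mult_left_mono)
  with 1 have "g * ((P0 - 3 / 2 * (D\<^sup>2 + 16)) * L0) \<le> g * (60 * P0 + 240 * (D\<^sup>2 + 4))"
    by (simp add: algebra_simps)
  then have "(P0 - 3 / 2 * (D\<^sup>2 + 16)) * L0 \<le> 60 * P0 + 240 * (D\<^sup>2 + 4)"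
    using pos by simp
  moreover have "(P0 - 3 / 2 * (D\<^sup>2 + 16)) * L0 - (60 * P0 + 240 * (D\<^sup>2 + 4)) > 0"
  proof -
    \<comment> \<open>All coefficients in \<open>j = D - 5\<close> are positive. At
      \<open>D = 4\<close> the same polynomial is negative, hence the separate treatment of
      \<open>n = 6\<close>.\<close>
    have "(P0 - 3 / 2 * (D\<^sup>2 + 16)) * L0 - (60 * P0 + 240 * (D\<^sup>2 + 4))
        = 225 + (16769 / 2 * j + 4282 * j ^ 2 + 839 * j ^ 3 + 73 * j ^ 4 + 5 / 2 * j ^ 5)"
      unfolding P0_def L0_def Dj by (simp add: eval_nat_numeral algebra_simps)
    moreover have "16769 / 2 * j + 4282 * j ^ 2 + 839 * j ^ 3 + 73 * j ^ 4 + 5 / 2 * j ^ 5 \<ge> 0"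
      using Dj(2) by simp
    ultimately show ?thesis by linarith
  qed
  ultimately show False by linarith
qed

text \<open>
  The case \<open>D = 4\<close>, with \<open>e = w(4, 4) = 2 w(2, 2)\<close>: here the quotient equation factors because \<open>B\<^sub>3\<close> is symmetric, and
  the term \<open>w(2, 2)\<close> of the triangles of \<open>B\<^sub>2\<close> cannot be dropped.
\<close>

lemma B3_B2_inequality_small:
  fixes l a b e h k :: real
  assumes pos: "l > 0" "a > 0" "e > 0" and le: "e / 2 < l"
    and eq: "l\<^sup>2 = e * l + 4 * a + b"
    and e: "e\<^sup>2 \<le> 8 / 5 * a" and b: "17 / 20 * a \<le> b" "b \<le> a"
    and h: "h \<ge> 29 / 20 * a" and k: "k \<ge> 26 / 17 * b"
    and star: "4 * h / (l - e / 2) + k / l \<le> l"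
  shows False
proof -
  define m where "m = l - e / 2"
  have d: "m > 0" using le by (simp add: m_def)
  have "4 * h * l + k * m \<le> (e * l + 4 * a + b) * m"
    using star d pos unfolding m_def[symmetric] eq[symmetric] by (simp add: field_simps power2_eq_square)
  moreover have "29 / 5 * a * l \<le> 4 * h * l" using h pos by simp
  moreover have "26 / 17 * b * m \<le> k * m" using k d by simp
  ultimately have "29 / 5 * a * l \<le> (e * l + 4 * a - 9 / 17 * b) * m"
    by (simp add: algebra_simps)
  \<comment> \<open>From \<open>b \<ge> 17 / 20 * a\<close>:
    \<open>4 - 9 / 17 * (17 / 20) = 71 / 20\<close>.\<close>
  also have "\<dots> \<le> (e * l + 71 / 20 * a) * m"
    using b d by (intro mult_right_mono) auto
  also have "\<dots> = e * l\<^sup>2 + 71 / 20 * a * l - e\<^sup>2 * l / 2 - 71 / 40 * a * e"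
    by (simp add: m_def field_simps power2_eq_square)
  also have "e * l\<^sup>2 \<le> e * (e * l + 5 * a)"
    unfolding eq using b pos by (intro mult_left_mono) auto
  finally have "9 / 4 * a * l \<le> e\<^sup>2 * l / 2 + 129 / 40 * a * e"
    by (simp add: algebra_simps power2_eq_square)
  also have "e\<^sup>2 * l / 2 \<le> 8 / 5 * a * l / 2" using e pos by simp
  finally have "a * (29 / 20 * l) \<le> a * (129 / 40 * e)" by (simp add: algebra_simps)
  \<comment> \<open>The test vector has bounded \<open>l\<close> from above by a multiple of
    \<open>e\<close>; the equation \<open>eq\<close> now yields a lower bound for
    \<open>l * (l - e)\<close> that is too large for it.\<close>
  then have l_le: "l \<le> 129 / 58 * e" using pos by simp
  have "l * (l - e) = 4 * a + b" using eq by (simp add: algebra_simps power2_eq_square)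
  also have "\<dots> \<ge> 97 / 20 * a" using b by simp
  finally have "l * (l - e) \<ge> 97 / 20 * (5 / 8 * e\<^sup>2)" using e by simp
  moreover have "l * (l - e) \<le> 129 / 58 * e * (71 / 58 * e)"
  proof (cases "l \<ge> e")
    case True
    then show ?thesis using l_le pos by (intro mult_mono) auto
  next
    case False
    then have "l * (l - e) \<le> 0" using pos by (simp add: mult_le_0_iff)
    also have "0 \<le> 129 / 58 * e * (71 / 58 * e)" using pos by simp
    finally show ?thesis .
  qed
  ultimately have "97 / 32 * e\<^sup>2 \<le> 129 * 71 / 3364 * e\<^sup>2" by (simp add: power2_eq_square)
  then show False using pos by simp
qed

text \<open>If the claim fails, the radius \<open>l\<close> of \<open>B3\<close> satisfies both its
  own quotient equation and, being at least the radius of \<open>B2\<close>, the inequality of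
  \<open>B2_test_vector\<close>. The two are incompatible.\<close>

lemma rhoS_B3_less_B2:
  assumes n: "n \<ge> 6" and p: "p \<ge> 2"
  shows "rhoS p n (B3 n) < rhoS p n (B2 n)"
proof (rule ccontr)
  assume ge: "\<not> ?thesis"
  interpret b3_form n 0 1 2 3 4 using n by unfold_locales auto
  have G: "G = B3 n" using n unfolding G_def by (simp only: B3_eq)
  have "bicyclic n G" using undominated_G by (simp add: undominated_def)
  then obtain x where x: "perron p n G x"
    using perron_exists[of n G p] n by (auto simp: bicyclic_def)
  define l where "l = rhoS p n G"
  define D where "D = real (n - 2)"
  note pG = perron_G[OF x, folded l_def D_def]
  have le: "l \<ge> rhoS p n (B2 n)" using ge unfolding l_def G by simp
  have w22: "l > wt p 2 2"
  proof -
    have "(wt p 2 2)\<^sup>2 \<le> (wt p 4 2)\<^sup>2"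
      using p by (intro power_mono wt_mono) (auto simp: wt_nonneg)
    then have "(wt p 2 2)\<^sup>2 < l\<^sup>2" using pG(3) zero_le_power2[of "wt p 4 1"] zero_le_power2[of "wt p 4 2"] by linarith
    then show ?thesis using pG(1) by (rule power2_less_imp_less[OF _ less_imp_le])
  qed
  have D1: "real (n - 1) = D + 1" "real n - 5 = D - 3" using n by (auto simp: D_def)
  have "n \<ge> 5" using n by simp
  from B2_test_vector[OF this le w22]
  have star: "4 * (wt p (D + 1) 2)\<^sup>2 / (l - wt p 2 2) + (D - 3) * (wt p (D + 1) 1)\<^sup>2 / l \<le> l"
    unfolding D1 .
  show False
  proof (cases "n = 6")
    case True
    then have D: "D = 4" by (simp add: D_def)
    define a b e where "a = (wt p 4 2)\<^sup>2" and "b = (wt p 4 1)\<^sup>2" and "e = wt p 4 4"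
    have e2: "e = 2 * wt p 2 2" using wt_scale[of p 2 2 2] p by (simp add: e_def)
    have pos: "a > 0" "e > 0" by (simp_all add: a_def e_def wt_pos less_imp_neq[symmetric])
    \<comment> \<open>For \<open>D = 4\<close> the factors \<open>P\<close> and \<open>Q\<close> of
      \<open>perron_G\<close> coincide, so a square root can be taken of
      \<open>P * Q = R\<^sup>2\<close>.\<close>
    have "l\<^sup>2 - 2 * a - b = l * e + 2 * a"
    proof -
      have "(l\<^sup>2 - 2 * a - b)\<^sup>2 = (l * e + 2 * a)\<^sup>2"
        using pG(4) by (simp add: D a_def b_def e_def power2_eq_square mult.assoc)
      moreover have "l\<^sup>2 - 2 * a - b \<ge> 0" using pG(3) by (simp add: a_def b_def)
      moreover have "l * e + 2 * a \<ge> 0" using pG(1) pos by simp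
      ultimately show ?thesis by (simp add: power2_eq_iff_nonneg)
    qed
    then have "l\<^sup>2 = e * l + 4 * a + b" by (simp add: mult.commute)
    moreover have "e\<^sup>2 \<le> 8 / 5 * a"
      using wt_sq_ratio[of p 4 2 4 4 "5 / 8"] p by (simp add: a_def e_def)
    moreover have "17 / 20 * a \<le> b"
      using wt_sq_ratio[of p 4 1 4 2 "17 / 20"] p by (simp add: a_def b_def)
    moreover have "b \<le> a"
      unfolding a_def b_def using p by (intro power_mono wt_mono) (auto simp: wt_nonneg)
    moreover have "(wt p 5 2)\<^sup>2 \<ge> 29 / 20 * a"
      using wt_sq_ratio[of p 5 2 4 2 "29 / 20"] p by (simp add: a_def)
    moreover have "(wt p 5 1)\<^sup>2 \<ge> 26 / 17 * b"
      using wt_sq_ratio[of p 5 1 4 1 "26 / 17"] p by (simp add: b_def)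
    moreover have "4 * (wt p 5 2)\<^sup>2 / (l - e / 2) + (wt p 5 1)\<^sup>2 / l \<le> l"
      using star by (simp add: D e2)
    moreover have "e / 2 < l" using w22 by (simp add: e2)
    ultimately show False
      using B3_B2_inequality_small[OF pG(1) pos] by blast
  next
    case False
    then have D: "D \<ge> 5" using n by (simp add: D_def)
    define a where "a = (wt p D 2)\<^sup>2"
    \<comment> \<open>A scale with \<open>g = 1\<close> at \<open>p = 2\<close>, which lets the
      bounds be stated through sums of squares.\<close>
    define g where "g = a / (D\<^sup>2 + 4)"
    have Dp: "D\<^sup>2 + c > 0" if "c > 0" for c :: real
      using that by (intro add_nonneg_pos) auto
    have "wt p D 2 > 0" using D by (intro wt_pos) simp
    then have g: "g > 0" using Dp[of 4] by (simp add: g_def a_def)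
    have a: "a = g * (D\<^sup>2 + 4)" using Dp[of 4] by (simp add: g_def)
    have D2: "D\<^sup>2 \<ge> 25" and D4: "D ^ 4 \<ge> 625" using power_mono[of 5 D 2] power_mono[of 5 D 4] D by simp_all
    have DD: "16 \<le> D * D + (D * (D * (D * D)) + D * (D * (D * 2)))"
    proof -
      have "D * (D * (D * D)) \<ge> 0" "D * (D * (D * 2)) \<ge> 0" using D by simp_all
      then show ?thesis using D2 unfolding power2_eq_square by linarith
    qed
    define h k m c b d where "h = (wt p (D + 1) 2)\<^sup>2" and "k = (wt p (D + 1) 1)\<^sup>2" and "m = (wt p D 1)\<^sup>2"
      and "c = wt p D 4" and "b = (wt p 4 2)\<^sup>2" and "d = (wt p 4 1)\<^sup>2"
    \<comment> \<open>Here the term \<open>wt p 2 2\<close> of the triangles is dropped, which only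
      weakens the inequality.\<close>
    have L: "l\<^sup>2 \<ge> 4 * h + (D - 3) * k"
    proof -
      have "4 * h / l \<le> 4 * h / (l - wt p 2 2)"
        using w22 pG(1) wt_nonneg[of p 2 2] by (intro divide_left_mono) (auto simp: h_def)
      then have "4 * h / l + (D - 3) * k / l \<le> l" using star by (simp add: h_def k_def)
      then have "(4 * h + (D - 3) * k) / l \<le> l" by (simp add: add_divide_distrib)
      then show ?thesis using pG(1) by (simp add: divide_le_eq power2_eq_square)
    qed
    have h: "h \<ge> g * ((D + 1)\<^sup>2 + 4)"
    proof -
      have "((D + 1)\<^sup>2 + 4) / (D\<^sup>2 + 4) * (wt p D 2)\<^sup>2 \<le> (wt p (D + 1) 2)\<^sup>2"
        using D DD Dp[of 4] by (intro wt_sq_ratio[OF p]) (auto simp: divide_le_eq power2_eq_square algebra_simps)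
      then show ?thesis by (simp add: h_def g_def a_def mult.commute)
    qed
    have km: "k \<ge> ((D + 1)\<^sup>2 + 1) / (D\<^sup>2 + 1) * m"
      unfolding k_def m_def using D DD Dp[of 1]
      by (intro wt_sq_ratio[OF p]) (auto simp: divide_le_eq power2_eq_square algebra_simps)
    have m: "m \<ge> g * (D\<^sup>2 + 1)"
    proof -
      have "(D\<^sup>2 + 1) / (D\<^sup>2 + 4) * (wt p D 2)\<^sup>2 \<le> (wt p D 1)\<^sup>2"
        using D D2 D4 Dp[of 4] by (intro wt_sq_ratio[OF p]) (auto simp: divide_le_eq algebra_simps)
      then show ?thesis by (simp add: m_def g_def a_def mult.commute)
    qed
    have k: "k - m \<ge> g * (2 * D + 1)"
    proof -
      have *: "((D + 1)\<^sup>2 + 1) / (D\<^sup>2 + 1) = 1 + (2 * D + 1) / (D\<^sup>2 + 1)"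
        using Dp[of 1] by (simp add: field_simps power2_eq_square)
      have "k - m \<ge> (2 * D + 1) / (D\<^sup>2 + 1) * m" using km unfolding * by (simp only: distrib_right mult_1)
      moreover have "(2 * D + 1) / (D\<^sup>2 + 1) * m \<ge> (2 * D + 1) / (D\<^sup>2 + 1) * (g * (D\<^sup>2 + 1))"
        using m D Dp[of 1] by (intro mult_left_mono) auto
      moreover have "(2 * D + 1) / (D\<^sup>2 + 1) * (g * (D\<^sup>2 + 1)) = g * (2 * D + 1)"
        using Dp[of 1] by simp
      ultimately show ?thesis by linarith
    qed
    have c: "c\<^sup>2 \<le> g * (D\<^sup>2 + 16)"
    proof -
      have "(D\<^sup>2 + 4) / (D\<^sup>2 + 16) * c\<^sup>2 \<le> a"
        unfolding c_def a_def using D D2 D4 Dp[of 16]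
        by (intro wt_sq_ratio[OF p]) (auto simp: divide_le_eq algebra_simps)
      then show ?thesis using Dp[of 16] Dp[of 4] by (simp add: g_def field_simps)
    qed
    have b: "b \<le> 20 * g"
    proof -
      have "(D\<^sup>2 + 4) / 20 * b \<le> a"
        unfolding b_def a_def using D D2 by (intro wt_sq_ratio[OF p]) auto
      then show ?thesis using Dp[of 4] by (simp add: g_def field_simps)
    qed
    have "d \<le> b"
      unfolding b_def d_def using p by (intro power_mono wt_mono) (auto simp: wt_nonneg)
    then have d: "d \<le> 20 * g" using b by simp
    have "(l\<^sup>2 - 2 * a - (D - 3) * m) * (l\<^sup>2 - 2 * b - d) = (l * c + 2 * wt p 4 2 * wt p D 2)\<^sup>2"
      using pG(4) by (simp add: a_def b_def c_def d_def m_def)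
    then show False
      using B3_B2_inequality_large[OF D pG(1) g L h k m _ c a b d, of "l * c + 2 * (wt p 4 2 * wt p D 2)" "wt p 4 2 * wt p D 2"]
      by (simp add: a_def b_def c_def wt_nonneg power_mult_distrib mult_ac)
  qed
qed

section \<open>Existence of a maximiser and the final ranking\<close>

lemma finite_bicyclic: "finite {E. bicyclic n E}"
proof (rule finite_subset)
  show "{E. bicyclic n E} \<subseteq> Pow (Pow {..<n})"
    by (auto simp: bicyclic_def simple_graph_def)
qed simp

text \<open>A maximiser \<open>E0\<close> exists by finiteness and is a copy of \<open>B3\<close>.
  If \<open>E\<close> were not strictly below, it would be a maximiser too, hence a copy of
  \<open>B3\<close>.\<close>

lemma rhoS_less_B3:
  assumes n: "n \<ge> 6" and p: "p \<ge> 2" and E: "bicyclic n E"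
    and not: "\<not> graph_iso n E (B1 n)" "\<not> graph_iso n E (B2 n)" "\<not> graph_iso n E (B3 n)"
  shows "rhoS p n E < rhoS p n (B3 n)"
proof -
  define M where "M = {E. undominated n E}"
  have und: "undominated n E"
    unfolding undominated_def using E dominated_cases[OF E] n not by fastforce
  have fM: "finite M"
    unfolding M_def by (rule finite_subset[OF _ finite_bicyclic[of n]]) (auto simp: undominated_def)
  have "Max (rhoS p n ` M) \<in> rhoS p n ` M"
    using fM und by (intro Max_in) (auto simp: M_def)
  then obtain E0 where E0: "E0 \<in> M" "rhoS p n E0 = Max (rhoS p n ` M)" by auto
  have mx: "rhoS p n E' \<le> rhoS p n E0" if "undominated n E'" for E'
    unfolding E0(2) using that fM by (intro Max_ge) (auto simp: M_def)
  interpret e0: extremal n E0 p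
    using n p E0(1) mx by unfold_locales (auto simp: M_def)
  have eq: "rhoS p n E0 = rhoS p n (B3 n)"
    using graph_iso_rhoS[OF e0.iso_B3] n by simp
  show ?thesis
  proof (rule ccontr)
    assume "\<not> ?thesis"
    then have "\<And>E'. undominated n E' \<Longrightarrow> rhoS p n E' \<le> rhoS p n E" using mx eq by fastforce
    then interpret e: extremal n E p using n p und by unfold_locales
    show False using e.iso_B3 not(3) by simp
  qed
qed

theorem theorem5p3:
  fixes n :: nat and p :: real
  assumes "n \<ge> 6" and "p \<ge> 2"
  shows "bicyclic n (B1 n) \<and> bicyclic n (B2 n) \<and> bicyclic n (B3 n)
    \<and> rhoS p n (B3 n) < rhoS p n (B2 n) \<and> rhoS p n (B2 n) < rhoS p n (B1 n)
    \<and> (\<forall>E. bicyclic n E \<and> \<not> graph_iso n E (B1 n) \<and> \<not> graph_iso n E (B2 n)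
             \<and> \<not> graph_iso n E (B3 n) \<longrightarrow> rhoS p n E < rhoS p n (B3 n))"
  using assms rhoS_less_B3[OF assms] rhoS_B3_less_B2[OF assms] rhoS_B2_less_B1[of n p]
  by (simp add: bicyclic_B1 bicyclic_B2 bicyclic_B3)

end
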